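(* Let $N\ge 2$, let $\tau_n>0$, and let $K\in\mathbb{R}^{N\times N}$ be a symmetric matrix with $K\mathds{1}_N=0$, whose eigenvalues are $\lambda_1=0$ (with eigenvector $\mathds{1}_N$) and $\lambda_2,\dots,\lambda_N\in\mathbb{R}$. Let $x(t)\in\mathbb{R}^N$ be the network error, satisfying $$dx(t) = -K\,x(t-\tau_n)\,dt + \Omega\, d\bar w(t),\qquad \mathds{1}_N^\top x(t)= 0,$$ where $\Omega = I_N-\frac{1}{N}\mathds{1}_N\mathds{1}_N^\top$ and $\bar w$ is a standard $N$-dimensional Brownian motion. Then $x(t)$ is mean-square stable if and only if $$\lambda_j\in\left(0,\frac{\pi}{2\tau_n}\right),\qquad j=2,\dots,N.$$ In this case, $x(t)$ is a Gaussian process and its steady-state variance $\sigma^2(K)=\lim_{t\to+\infty}\mathbb{E}\left[\|x(t)\|^2\right]$ is $$\sigma^2(K)=\sum_{j=2}^N\sigma_I^2(\lambda_j),\qquad \sigma_I^2(\lambda_j)=\frac{1+\sin(\lambda_j\tau_n)}{2\lambda_j\cos(\lambda_j\tau_n)},$$ where $\sigma_I^2(\lambda_j)$ is the steady-state variance of the trivial solution (zero initial history) of the scalar equation $d\tilde x_j(t)=-\lambda_j\tilde x_j(t-\tau_n)\,dt+d\tilde w_j(t)$ with $\tilde w_j$ a standard scalar Brownian motion.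
   Context: $\mathds{1}_N\in\mathbb{R}^N$ is the vector of all ones. The setting: $N$ agents with scalar states $\bar x_i(t)$ obey $d\bar x_i(t)=u_{P,i}(t)\,dt+d\bar w_i(t)$, with independent standard Brownian motions $\bar w_i$ and delayed proportional feedback $u_P(t)=-K\bar x(t-\tau_n)$; the network error is $x(t)=\Omega\bar x(t)$, the mismatch between agent states and the average network state, so that the component of $x$ along $\mathds{1}_N$ is identically zero. Initial histories on $[-\tau_n,0]$ are deterministic, continuous, and orthogonal to $\mathds{1}_N$. Mean-square stable means that, for every such initial history, $\lim_{t\to+\infty}\mathbb{E}[\|x(t)\|^2]$ exists and is finite. *)

theory Defs
  imports "HOL-Probability.Probability"
begin

definition standard_BM :: "'a measure \<Rightarrow> (real \<Rightarrow> 'a \<Rightarrow> real) \<Rightarrow> bool" where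
  "standard_BM M w \<longleftrightarrow>
     prob_space M \<and>
     (\<forall>t\<ge>0. w t \<in> borel_measurable M) \<and>
     (AE \<omega> in M. w 0 \<omega> = 0) \<and>
     (\<forall>s t. 0 \<le> s \<and> s < t \<longrightarrow>
        distributed M lborel (\<lambda>\<omega>. w t \<omega> - w s \<omega>) (normal_density 0 (sqrt (t - s)))) \<and>
     (\<forall>(n::nat) t. 0 \<le> t 0 \<and> incseq t \<longrightarrow>
        prob_space.indep_vars M (\<lambda>_. borel) (\<lambda>k \<omega>. w (t (Suc k)) \<omega> - w (t k) \<omega>) {..<n}) \<and>
     (AE \<omega> in M. continuous_on {0..} (\<lambda>t. w t \<omega>))"

text \<open>Independence of the components is independence of whole paths, viewed as random
  elements of the product space over the time axis.\<close>

definition standard_BM_vec :: "'a measure \<Rightarrow> (real \<Rightarrow> 'a \<Rightarrow> real ^ 'n) \<Rightarrow> bool" where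
  "standard_BM_vec M w \<longleftrightarrow>
     (\<forall>i. standard_BM M (\<lambda>t \<omega>. w t \<omega> $ i)) \<and>
     prob_space.indep_vars M (\<lambda>_. Pi\<^sub>M {0..} (\<lambda>_. borel))
       (\<lambda>i \<omega>. \<lambda>t\<in>{0..}. w t \<omega> $ i) UNIV"

text \<open>Solutions of \<open>dx(t) = - A x(t - \<tau>) dt + dZ(t)\<close> with deterministic history \<open>\<phi>\<close> on
  \<open>[-\<tau>, 0]\<close>. The noise is additive, so the integrated equation involves no stochastic integral
  and is read pathwise. Adaptedness is not required: for linear \<open>A\<close> the
  equation determines almost every path of \<open>x\<close> from \<open>\<phi>\<close> and the path of \<open>Z\<close>.\<close>

definition sdde_solution ::
  "'a measure \<Rightarrow> real \<Rightarrow> ('v::euclidean_space \<Rightarrow> 'v) \<Rightarrow> (real \<Rightarrow> 'a \<Rightarrow> 'v) \<Rightarrow>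
     (real \<Rightarrow> 'v) \<Rightarrow> (real \<Rightarrow> 'a \<Rightarrow> 'v) \<Rightarrow> bool" where
  "sdde_solution M \<tau> A Z \<phi> x \<longleftrightarrow>
     (\<forall>t\<ge>-\<tau>. x t \<in> borel_measurable M) \<and>
     (AE \<omega> in M.
        continuous_on {-\<tau>..} (\<lambda>t. x t \<omega>) \<and>
        (\<forall>t\<in>{-\<tau>..0}. x t \<omega> = \<phi> t) \<and>
        (\<forall>t\<ge>0. x t \<omega> = \<phi> 0 - integral {0..t} (\<lambda>s. A (x (s - \<tau>) \<omega>)) + (Z t \<omega> - Z 0 \<omega>)))"

definition centering :: "real ^ 'n ^ 'n" where
  "centering = mat 1 - (1 / real CARD('n)) *\<^sub>R (\<chi> i j. 1)"

definition admissible_history :: "real \<Rightarrow> (real \<Rightarrow> real ^ 'n) \<Rightarrow> bool" where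
  "admissible_history \<tau> \<phi> \<longleftrightarrow>
     continuous_on {-\<tau>..0} \<phi> \<and> (\<forall>s\<in>{-\<tau>..0}. 1 \<bullet> \<phi> s = 0)"

definition network_error ::
  "'a measure \<Rightarrow> real \<Rightarrow> real ^ 'n ^ 'n \<Rightarrow> (real \<Rightarrow> 'a \<Rightarrow> real ^ 'n) \<Rightarrow>
     (real \<Rightarrow> real ^ 'n) \<Rightarrow> (real \<Rightarrow> 'a \<Rightarrow> real ^ 'n) \<Rightarrow> bool" where
  "network_error M \<tau> K w \<phi> x \<longleftrightarrow>
     sdde_solution M \<tau> (\<lambda>v. K *v v) (\<lambda>t \<omega>. centering *v w t \<omega>) \<phi> x \<and>
     (AE \<omega> in M. \<forall>t\<ge>-\<tau>. 1 \<bullet> x t \<omega> = 0)"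

text \<open>Integrability is explicit because the Bochner integral of a non-integrable function
  is \<open>0\<close>.\<close>

definition has_steady_state_variance ::
  "'a measure \<Rightarrow> (real \<Rightarrow> 'a \<Rightarrow> 'v::real_normed_vector) \<Rightarrow> real \<Rightarrow> bool" where
  "has_steady_state_variance M x L \<longleftrightarrow>
     (\<forall>t\<ge>0. integrable M (\<lambda>\<omega>. (norm (x t \<omega>))\<^sup>2)) \<and>
     ((\<lambda>t. \<integral>\<omega>. (norm (x t \<omega>))\<^sup>2 \<partial>M) \<longlongrightarrow> L) at_top"

definition mean_square_stable ::
  "'a measure \<Rightarrow> real \<Rightarrow> real ^ 'n ^ 'n \<Rightarrow> (real \<Rightarrow> 'a \<Rightarrow> real ^ 'n) \<Rightarrow> bool" where
  "mean_square_stable M \<tau> K w \<longleftrightarrow>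
     (\<forall>\<phi> x. admissible_history \<tau> \<phi> \<and> network_error M \<tau> K w \<phi> x \<longrightarrow>
        (\<exists>L. has_steady_state_variance M x L))"

text \<open>Real Gaussian random variables, including the degenerate (almost surely constant) ones.\<close>

definition gaussian_rv :: "'a measure \<Rightarrow> ('a \<Rightarrow> real) \<Rightarrow> bool" where
  "gaussian_rv M X \<longleftrightarrow>
     X \<in> borel_measurable M \<and>
     ((\<exists>\<mu>. AE \<omega> in M. X \<omega> = \<mu>) \<or>
      (\<exists>\<mu> \<sigma>. \<sigma> > 0 \<and> distributed M lborel X (normal_density \<mu> \<sigma>)))"

definition gaussian_process ::
  "'a measure \<Rightarrow> real set \<Rightarrow> (real \<Rightarrow> 'a \<Rightarrow> 'v::euclidean_space) \<Rightarrow> bool" where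
  "gaussian_process M T x \<longleftrightarrow>
     (\<forall>F a. finite F \<and> F \<subseteq> T \<longrightarrow> gaussian_rv M (\<lambda>\<omega>. \<Sum>t\<in>F. a t \<bullet> x t \<omega>))"

text \<open>\<open>eig 1, \<dots>, eig N\<close> list the eigenvalues of \<open>K\<close> with algebraic multiplicity.\<close>

definition eigenvalue_list :: "real ^ 'n ^ 'n \<Rightarrow> (nat \<Rightarrow> real) \<Rightarrow> bool" where
  "eigenvalue_list K eig \<longleftrightarrow> (\<forall>z. det (mat z - K) = (\<Prod>j=1..CARD('n). z - eig j))"

definition sigma_I_sq :: "real \<Rightarrow> real \<Rightarrow> real" where
  "sigma_I_sq \<tau> l = (1 + sin (l * \<tau>)) / (2 * l * cos (l * \<tau>))"

end

(*
  In an orthonormal eigenbasis of K containing a multiple of the all-ones vector, the equation splits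
  into scalar equations dz = - l z(t - tau) dt + dB. With R the fundamental solution (R = 1 on
  [0, tau], R' = - l R(. - tau) afterwards), integration by parts gives pathwise
  z(t) = deterministic + B(t) - l int_0^(t-tau) R(t-tau-s) B(s) ds. This is an almost sure limit of
  linear combinations of Gaussian increments, hence Gaussian, with variance int_0^t R^2. So the
  theorem reduces to: R is square integrable on the half line iff 0 < l < pi/(2 tau), and then
  int R^2 = sigma_I^2(l).

  If l lies outside this interval, z + l exp(- z tau) = 0 has a root with Re z >= 0. Pairing R with
  exp(- z t) yields a conserved quantity equal to 1, so R cannot tend to 0, whereas a square
  integrable R does.

  If l lies inside, an explicit quadratic functional V of the solution segment on [t - tau, t]
  satisfies V' = - R(t - tau)^2. Splitting the segment into even and odd parts about its midpoint
  writes V as a sum of squares whose boundary terms carry the factor 1 / (cos(l tau/2) - sin(l tau/2)), which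
  is positive exactly because l tau < pi/2. Hence V >= 0, R is square integrable, V tends to 0,
  and int R^2 is the initial value of V.
*)
theory Submission
  imports Defs
begin

section \<open>The scalar delay equation and its fundamental solution\<close>

text \<open>The frequency \<open>l\<close> of the Lyapunov functional is forced. A functional that
  vanishes at infinity and whose derivative is minus a squared value of the solution is the tail
  integral of that square. It is a quadratic form in the segment whose kernel is the autocorrelation
  \<open>U(s)\<close>, the integral of \<open>R(t) R(t + s)\<close> over \<open>t >= 0\<close>. With
  \<open>U\<close> extended evenly, \<open>U'(s) = - l U(tau - s)\<close> on
  \<open>[0, tau]\<close>, hence \<open>U'' = - l^2 U\<close>. The kernel form hides positivity; the
  coupling of \<open>s\<close> with \<open>tau - s\<close> suggests recentring the segment at its
  midpoint. Brownian paths have no bounded variation, so no integral against \<open>dB\<close> is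
  formed: only the differentiable part \<open>z - B\<close> is integrated by parts. Gaussian laws
  are handled through characteristic functions \<open>exp (- u^2 v / 2)\<close>: this form includes
  the degenerate case \<open>v = 0\<close>, is multiplicative over independent summands and survives
  almost sure limits.\<close>

lemma continuous_primitive:
  fixes f :: "real \<Rightarrow> 'a::banach"
  assumes "continuous_on UNIV f"
  obtains F where "\<And>x. (F has_vector_derivative f x) (at x)"
    and "\<And>a b. a \<le> b \<Longrightarrow> integral {a..b} f = F b - F a"
proof -
  define F where "F = (\<lambda>x. if 0 \<le> x then integral {0..x} f else - integral {x..0} f)"
  have int: "f integrable_on {a..b}" for a b
    by (rule integrable_continuous_interval) (rule continuous_on_subset[OF assms], simp)
  have eq: "F u = integral {a..u} f - integral {a..0} f" if "a \<le> u" "a \<le> 0" for a u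
    using Henstock_Kurzweil_Integration.integral_combine[OF that(2) _ int, of u]
      Henstock_Kurzweil_Integration.integral_combine[OF that(1) _ int, of 0]
    by (auto simp: F_def algebra_simps)
  have der: "(F has_vector_derivative f x) (at x)" for x
  proof -
    \<comment> \<open>Both \<open>0\<close> and \<open>x\<close> lie inside \<open>{a..b}\<close>,
      so near \<open>x\<close> the oriented integral from \<open>0\<close> differs from the integral
      from \<open>a\<close> by a constant, whatever the sign of \<open>x\<close>.\<close>
    define a b where "a = - \<bar>x\<bar> - 1" and "b = \<bar>x\<bar> + 1"
    have x: "x \<in> {a<..<b}" by (auto simp: a_def b_def)
    have a0: "a \<le> 0" by (simp add: a_def)
    have "((\<lambda>u. integral {a..u} f) has_vector_derivative f x) (at x within {a..b})"
      using x continuous_on_subset[OF assms] by (intro integral_has_vector_derivative) auto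
    then have "((\<lambda>u. integral {a..u} f) has_vector_derivative f x) (at x within {a<..<b})"
      by (rule has_vector_derivative_within_subset) auto
    then have "((\<lambda>u. integral {a..u} f) has_vector_derivative f x) (at x)"
      using at_within_open[OF x] by simp
    then have "((\<lambda>u. integral {a..u} f - integral {a..0} f) has_vector_derivative f x) (at x)"
      by (auto intro!: derivative_eq_intros)
    then show ?thesis
      by (rule has_vector_derivative_transform_within_open[where S="{a<..<b}"])
        (use x a0 in \<open>auto intro!: eq[symmetric]\<close>)
  qed
  have "integral {a..b} f = F b - F a" if "a \<le> b" for a b
    by (rule integral_unique, rule fundamental_theorem_of_calculus[OF that])
      (rule has_vector_derivative_at_within[OF der])
  with der that show ?thesis by blast
qed

lemma continuous_on_primitive:
  "(\<And>x. (F has_vector_derivative f x) (at x)) \<Longrightarrow> continuous_on S F"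
  by (meson continuous_at_imp_continuous_on has_vector_derivative_continuous)

lemma primitive_field_derivative:
  fixes f :: "real \<Rightarrow> real"
  assumes "\<And>x. (F has_vector_derivative f x) (at x)" "(g has_field_derivative D) (at x within S)"
  shows "((\<lambda>x. F (g x)) has_field_derivative f (g x) * D) (at x within S)"
  using assms by (metis DERIV_chain2 has_real_derivative_iff_has_vector_derivative)

lemma continuous_on_UNIV_halflines:
  assumes "\<And>n::nat. continuous_on {..of_nat n * c} f" "(c::real) > 0"
  shows "continuous_on UNIV f"
proof (rule continuous_at_imp_continuous_on, clarify)
  fix x :: real
  obtain n :: nat where n: "x / c < real n" using reals_Archimedean2 by blast
  then have "x < real n * c" using assms(2) by (simp add: pos_divide_less_eq)
  then have "x \<in> interior {..real n * c}" by simp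
  then show "isCont f x" using assms(1)[of n] continuous_on_interior by blast
qed

text \<open>Method of steps: \<open>P (Suc n)\<close> at time \<open>t\<close> reads
  \<open>P n\<close> only up to \<open>t - \<tau>\<close>, so each iteration settles the solution on
  one more interval of length \<open>\<tau>\<close>, and the iterates become stationary on every
  half line.\<close>

lemma delay_equation_exists:
  fixes G :: "real \<Rightarrow> real"
  assumes G: "continuous_on UNIV G" and tau: "\<tau> > 0"
  obtains z where "continuous_on UNIV z" "\<And>t. t \<le> 0 \<Longrightarrow> z t = G t"
    "\<And>t. t \<ge> 0 \<Longrightarrow> z t = G t - l * integral {0..t} (\<lambda>s. z (s - \<tau>))"
proof -
  \<comment> \<open>The \<open>max 0 t\<close> keeps every iterate equal to \<open>G\<close> at
    nonpositive times.\<close>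
  define P where "P = rec_nat G (\<lambda>_ f t. G t - l * integral {0..max 0 t} (\<lambda>s. f (s - \<tau>)))"
  have P0: "P 0 = G" and PS: "P (Suc n) = (\<lambda>t. G t - l * integral {0..max 0 t} (\<lambda>s. P n (s - \<tau>)))" for n
    by (simp_all add: P_def)
  have cont: "continuous_on UNIV (P n)" for n
  proof (induct n)
    case 0 show ?case using G by (simp add: P0)
  next
    case (Suc n)
    have "continuous_on UNIV (\<lambda>s. P n (s - \<tau>))"
      by (intro continuous_on_compose2[OF Suc] continuous_intros) auto
    then obtain F where F: "\<And>x. (F has_vector_derivative P n (x - \<tau>)) (at x)"
      and FI: "\<And>a b. a \<le> b \<Longrightarrow> integral {a..b} (\<lambda>s. P n (s - \<tau>)) = F b - F a"
      using continuous_primitive by blast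
    have "continuous_on UNIV (\<lambda>t. G t - l * (F (max 0 t) - F 0))"
      by (intro continuous_intros G continuous_on_compose2[OF continuous_on_primitive[OF F]]) auto
    then show ?case by (simp add: PS FI)
  qed
  have step: "P (Suc n) t = P n t" if "t \<le> real n * \<tau>" for n t
    using that
  proof (induct n arbitrary: t)
    case 0 then show ?case by (simp add: P0 PS max_def)
  next
    case (Suc n)
    have "integral {0..max 0 t} (\<lambda>s. P (Suc n) (s - \<tau>)) = integral {0..max 0 t} (\<lambda>s. P n (s - \<tau>))"
    proof (intro integral_cong Suc.hyps)
      fix s assume "s \<in> {0..max 0 t}"
      moreover have "0 \<le> real n * \<tau>" using tau by simp
      ultimately show "s - \<tau> \<le> real n * \<tau>"
        using Suc.prems tau by (auto simp: algebra_simps max_def split: if_splits)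
    qed
    then show ?case by (subst (1 2) PS) simp
  qed
  have stable: "P (n + k) t = P n t" if "t \<le> real n * \<tau>" for n k t
  proof (induct k)
    case (Suc k)
    have "t \<le> real (n + k) * \<tau>"
      by (rule order_trans[OF that]) (use tau in \<open>simp add: mult_right_mono\<close>)
    from step[OF this] Suc show ?case by simp
  qed simp
  \<comment> \<open>The chosen index is the first one whose iterate is already final at
    \<open>t\<close>; it is \<open>0\<close> for \<open>t \<le> 0\<close>.\<close>
  define z where "z = (\<lambda>t. P (nat \<lceil>t / \<tau>\<rceil>) t)"
  have zP: "z t = P n t" if "t \<le> real n * \<tau>" for n t
  proof -
    let ?k = "nat \<lceil>t / \<tau>\<rceil>"
    have "t / \<tau> \<le> real n" using that tau by (simp add: pos_divide_le_eq)
    then have "?k \<le> n" by linarith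
    moreover have "t / \<tau> \<le> real ?k" by linarith
    then have "t \<le> real ?k * \<tau>" using tau by (simp add: pos_divide_le_eq)
    ultimately show ?thesis using stable[of t ?k "n - ?k"] by (simp add: z_def)
  qed
  have zc: "continuous_on UNIV z"
  proof (rule continuous_on_UNIV_halflines[OF _ tau])
    fix n :: nat
    show "continuous_on {..of_nat n * \<tau>} z"
      using continuous_on_subset[OF cont[of n]] by (rule continuous_on_eq) (auto simp: zP[of _ n])
  qed
  have z0: "z t = G t" if "t \<le> 0" for t using zP[of t 0] that by (simp add: P0)
  have ze: "z t = G t - l * integral {0..t} (\<lambda>s. z (s - \<tau>))" if "t \<ge> 0" for t
  proof -
    let ?k = "nat \<lceil>t / \<tau>\<rceil>"
    have "t / \<tau> \<le> real ?k" by linarith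
    then have k: "t \<le> real ?k * \<tau>" using tau by (simp add: pos_divide_le_eq)
    then have "z t = P (Suc ?k) t" using step[OF k] zP[OF k] by simp
    also have "\<dots> = G t - l * integral {0..t} (\<lambda>s. P ?k (s - \<tau>))" using that by (simp add: PS)
    also have "integral {0..t} (\<lambda>s. P ?k (s - \<tau>)) = integral {0..t} (\<lambda>s. z (s - \<tau>))"
      by (intro integral_cong zP[symmetric]) (use k tau in auto)
    finally show ?thesis .
  qed
  show ?thesis by (rule that[OF zc z0 ze])
qed

text \<open>Continuing the value \<open>1\<close> to all times below \<open>\<tau>\<close> makes
  \<open>R\<close> continuous on the whole line. The fundamental solution proper vanishes at
  negative times and jumps at \<open>0\<close>; that jump is recorded only in
  \<open>causal_kernel\<close>.\<close>

locale fundamental_solution =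
  fixes \<tau> l :: real and R :: "real \<Rightarrow> real"
  assumes tau: "\<tau> > 0"
    and cont: "continuous_on UNIV R"
    and R_initial: "\<And>t. t \<le> \<tau> \<Longrightarrow> R t = 1"
    and R_eq: "\<And>t. t \<ge> \<tau> \<Longrightarrow> R t = 1 - l * integral {0..t - \<tau>} R"

lemma fundamental_solution_exists:
  assumes tau: "\<tau> > 0"
  obtains R where "fundamental_solution \<tau> l R"
proof -
  obtain z where z: "continuous_on UNIV z" "\<And>t. t \<le> 0 \<Longrightarrow> z t = 1"
    "\<And>t. t \<ge> 0 \<Longrightarrow> z t = 1 - l * integral {0..t} (\<lambda>s. z (s - \<tau>))"
    using delay_equation_exists[OF continuous_on_const tau] by metis
  \<comment> \<open>Translating the solution with history \<open>1\<close> by \<open>\<tau>\<close>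
    turns its delayed value \<open>z (s - \<tau>)\<close> into \<open>R s\<close>.\<close>
  have "fundamental_solution \<tau> l (\<lambda>t. z (t - \<tau>))"
    by standard (use tau z in \<open>auto intro!: continuous_on_compose2[OF z(1)] continuous_intros\<close>)
  then show ?thesis by (rule that)
qed

context fundamental_solution
begin

lemma cont_on: "continuous_on S R"
  using cont continuous_on_subset by blast

lemma cont_compose [continuous_intros]: "continuous_on S f \<Longrightarrow> continuous_on S (\<lambda>x. R (f x))"
  by (rule continuous_on_compose2[OF cont]) auto

lemma R_int [intro]: "R integrable_on {a..b}"
  by (rule integrable_continuous_interval[OF cont_on])

text \<open>The inequality is strict because \<open>R\<close> in general has a kink at
  \<open>\<tau>\<close>: the one-sided derivatives are \<open>0\<close> and
  \<open>- l\<close>.\<close>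

lemma R_deriv:
  assumes "t > \<tau>"
  shows "(R has_real_derivative - l * R (t - \<tau>)) (at t)"
proof -
  obtain F where F: "\<And>x. (F has_vector_derivative R x) (at x)"
    and FI: "\<And>a b. a \<le> b \<Longrightarrow> integral {a..b} R = F b - F a"
    using continuous_primitive[OF cont] by blast
  have "((\<lambda>t. 1 - l * (F (t - \<tau>) - F 0)) has_real_derivative - l * R (t - \<tau>)) (at t)"
    by (auto intro!: derivative_eq_intros primitive_field_derivative[OF F])
  then show ?thesis
    by (rule has_field_derivative_transform_within_open[where S="{\<tau><..}"])
      (use assms R_eq FI in auto)
qed

lemma R_deriv_chain:
  assumes "g x > \<tau>" "(g has_real_derivative D) (at x)"
  shows "((\<lambda>x. R (g x)) has_real_derivative - l * R (g x - \<tau>) * D) (at x)"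
  by (rule DERIV_chain2[OF R_deriv[OF assms(1)] assms(2)])

text \<open>Integration by parts of \<open>R (t - s)\<close> against the differentiable process \<open>z - B\<close>.\<close>

lemma variation_of_constants:
  assumes z: "continuous_on {-\<tau>..} z" and B: "continuous_on {0..} B"
    and eq: "\<And>t. t \<ge> 0 \<Longrightarrow> z t = z 0 - l * integral {0..t} (\<lambda>s. z (s - \<tau>)) + B t"
    and t: "t \<ge> 0"
  shows "z t = (R t * z 0 - l * integral {-\<tau>..min 0 (t - \<tau>)} (\<lambda>s. R (t - \<tau> - s) * z s))
      + (B t - l * integral {0..t - \<tau>} (\<lambda>s. R (t - \<tau> - s) * B s))"
proof -
  \<comment> \<open>The constant extension below \<open>-\<tau>\<close> is continuous on the whole
    line, so the delayed term has a global primitive.\<close>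
  define zz where "zz = (\<lambda>s. z (max (-\<tau>) s))"
  have zzc: "continuous_on UNIV zz"
    unfolding zz_def by (intro continuous_on_compose2[OF z] continuous_intros) auto
  have zz: "zz s = z s" if "s \<ge> -\<tau>" for s using that by (simp add: zz_def)
  have "continuous_on UNIV (\<lambda>s. zz (s - \<tau>))"
    by (intro continuous_on_compose2[OF zzc] continuous_intros) auto
  then obtain F where F: "\<And>x. (F has_vector_derivative zz (x - \<tau>)) (at x)"
    and FI: "\<And>a b. a \<le> b \<Longrightarrow> integral {a..b} (\<lambda>s. zz (s - \<tau>)) = F b - F a"
    using continuous_primitive by blast
  \<comment> \<open>At nonnegative times this is \<open>z - B\<close>; with the noise removed it is
    differentiable.\<close>
  define m where "m = (\<lambda>s. z 0 - l * (F s - F 0))"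
  have m: "m s = z s - B s" if "s \<ge> 0" for s
  proof -
    have "integral {0..s} (\<lambda>s. z (s - \<tau>)) = F s - F 0"
      using that zz by (subst FI[symmetric]) (auto intro!: integral_cong)
    with eq[OF that] show ?thesis by (simp add: m_def)
  qed
  have dm: "(m has_real_derivative - l * zz (s - \<tau>)) (at s)" for s
    unfolding m_def
    by (auto intro!: derivative_eq_intros F simp: has_real_derivative_iff_has_vector_derivative[symmetric])
      (auto intro!: derivative_eq_intros F simp: has_real_derivative_iff_has_vector_derivative)
  have mc: "continuous_on S m" for S
    using dm by (meson DERIV_isCont continuous_at_imp_continuous_on)
  have FI': "F b - F a = integral {a - \<tau>..b - \<tau>} z" if "0 \<le> a" "a \<le> b" for a b
  proof -
    have "F b - F a = integral {a..b} (\<lambda>s. zz (s - \<tau>))" using FI that by simp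
    also have "\<dots> = integral {a - \<tau>..b - \<tau>} zz"
      using integral_shift[of a "-\<tau>" b zz] continuous_on_subset[OF zzc] by (simp add: o_def)
    also have "\<dots> = integral {a - \<tau>..b - \<tau>} z"
      using that zz by (intro integral_cong) auto
    finally show ?thesis .
  qed
  show ?thesis
  proof (cases "t \<le> \<tau>")
    case True
    have "integral {-\<tau>..t - \<tau>} (\<lambda>s. R (t - \<tau> - s) * z s) = integral {-\<tau>..t - \<tau>} z"
      using True t by (intro integral_cong) (auto simp: R_initial)
    moreover have "integral {0..t - \<tau>} (\<lambda>s. R (t - \<tau> - s) * B s) = 0"
      using True by (cases "t = \<tau>") auto
    moreover have "F t - F 0 = integral {-\<tau>..t - \<tau>} z" using FI'[of 0 t] t by simp
    moreover have "min 0 (t - \<tau>) = t - \<tau>" using True by simp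
    ultimately show ?thesis
      using m[OF t] True R_initial[of t] by (simp add: m_def del: min.absorb1 min.absorb2)
  next
    case False
    \<comment> \<open>For \<open>s < u\<close> the argument \<open>t - s\<close> exceeds
      \<open>\<tau>\<close>, where \<open>R\<close> follows its differential equation. From
      \<open>u\<close> to \<open>t\<close> the delayed kernel \<open>R (u - s)\<close> and its shift
      by \<open>\<tau>\<close> are \<open>1\<close>, and the increment of \<open>m\<close> is
      computed directly.\<close>
    define u where "u = t - \<tau>"
    have u: "u > 0" using False by (simp add: u_def)
    define f where "f = (\<lambda>s. l * R (t - s - \<tau>) * m s - l * R (t - s) * zz (s - \<tau>))"
    have "(f has_integral (R (t - u) * m u - R (t - 0) * m 0)) {0..u}"
    proof (rule fundamental_theorem_of_calculus_interior)
      show "continuous_on {0..u} (\<lambda>s. R (t - s) * m s)"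
        by (intro continuous_intros mc)
      fix s assume "s \<in> {0<..<u}"
      then have "t - s > \<tau>" by (auto simp: u_def)
      then show "((\<lambda>s. R (t - s) * m s) has_vector_derivative f s) (at s)"
        unfolding has_real_derivative_iff_has_vector_derivative[symmetric] f_def
        by (auto intro!: derivative_eq_intros dm R_deriv_chain)
    qed (use u in simp)
    moreover have "R (t - u) = 1" by (simp add: u_def R_initial)
    moreover have "m 0 = z 0" by (simp add: m_def)
    ultimately have fI: "integral {0..u} f = m u - R t * z 0" by (simp add: integral_unique)
    have i1: "integral {0..u} (\<lambda>s. R (t - s) * zz (s - \<tau>))
        = integral {-\<tau>..u - \<tau>} (\<lambda>s. R (u - s) * z s)"
    proof -
      have "integral {0..u} (\<lambda>s. R (t - s) * zz (s - \<tau>))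
          = integral {0 + - \<tau>..u + - \<tau>} (\<lambda>s. R (u - s) * zz s)"
        by (subst integral_shift[symmetric])
           (auto intro!: continuous_intros continuous_on_subset[OF zzc] simp: o_def u_def algebra_simps)
      also have "\<dots> = integral {-\<tau>..u - \<tau>} (\<lambda>s. R (u - s) * z s)"
        by (simp, intro integral_cong) (auto simp: zz)
      finally show ?thesis .
    qed
    have Rz_int: "(\<lambda>s. R (u - s) * z s) integrable_on {a..b}" if "a \<ge> -\<tau>" for a b
      by (intro integrable_continuous_interval continuous_intros continuous_on_subset[OF z]) (use that in auto)
    have RB_int: "(\<lambda>s. R (u - s) * B s) integrable_on {0..b}" for b
      by (intro integrable_continuous_interval continuous_intros continuous_on_subset[OF B]) auto
    have "integral {0..u} f = integral {0..u} (\<lambda>s. l * (R (t - s - \<tau>) * m s))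
         - integral {0..u} (\<lambda>s. l * (R (t - s) * zz (s - \<tau>)))"
      unfolding f_def mult.assoc
      by (intro Henstock_Kurzweil_Integration.integral_diff integrable_continuous_interval continuous_intros mc
          continuous_on_compose2[OF zzc]) auto
    also have "integral {0..u} (\<lambda>s. l * (R (t - s - \<tau>) * m s))
        = l * (integral {0..u} (\<lambda>s. R (u - s) * z s) - integral {0..u} (\<lambda>s. R (u - s) * B s))"
    proof -
      have "integral {0..u} (\<lambda>s. R (t - s - \<tau>) * m s)
          = integral {0..u} (\<lambda>s. R (u - s) * z s - R (u - s) * B s)"
        by (intro integral_cong) (auto simp: m u_def algebra_simps)
      also have "\<dots> = integral {0..u} (\<lambda>s. R (u - s) * z s) - integral {0..u} (\<lambda>s. R (u - s) * B s)"
        by (intro Henstock_Kurzweil_Integration.integral_diff Rz_int RB_int) (use tau in auto)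
      finally show ?thesis by simp
    qed
    also have "integral {0..u} (\<lambda>s. l * (R (t - s) * zz (s - \<tau>)))
        = l * integral {-\<tau>..u - \<tau>} (\<lambda>s. R (u - s) * z s)"
      by (simp add: i1)
    finally have A: "m u - R t * z 0 = l * (integral {0..u} (\<lambda>s. R (u - s) * z s)
        - integral {0..u} (\<lambda>s. R (u - s) * B s)) - l * integral {-\<tau>..u - \<tau>} (\<lambda>s. R (u - s) * z s)"
      using fI by simp
    have "m t - m u = - l * (F t - F u)" by (simp add: m_def algebra_simps)
    also have "F t - F u = integral {u - \<tau>..u} z"
      using FI'[of u t] u tau by (simp add: u_def)
    also have "\<dots> = integral {u - \<tau>..u} (\<lambda>s. R (u - s) * z s)"
      by (intro integral_cong) (auto simp: R_initial)
    finally have C: "m t - m u = - l * integral {u - \<tau>..u} (\<lambda>s. R (u - s) * z s)" .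
    \<comment> \<open>Two splittings of the same integral over \<open>{-\<tau>..u}\<close>; in the
      sum of \<open>A\<close> and \<open>C\<close> everything but the part over the history
      \<open>{-\<tau>..0}\<close> cancels.\<close>
    have D: "integral {-\<tau>..u - \<tau>} (\<lambda>s. R (u - s) * z s) + integral {u - \<tau>..u} (\<lambda>s. R (u - s) * z s)
        = integral {-\<tau>..u} (\<lambda>s. R (u - s) * z s)"
      by (rule Henstock_Kurzweil_Integration.integral_combine) (use u tau Rz_int in auto)
    have E: "integral {-\<tau>..0} (\<lambda>s. R (u - s) * z s) + integral {0..u} (\<lambda>s. R (u - s) * z s)
        = integral {-\<tau>..u} (\<lambda>s. R (u - s) * z s)"
      by (rule Henstock_Kurzweil_Integration.integral_combine) (use u tau Rz_int in auto)
    have mm: "min 0 (t - \<tau>) = 0" using u by (simp add: u_def)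
    have zt: "z t = m t + B t" using m[OF t] by simp
    have "m t = R t * z 0 - l * integral {-\<tau>..0} (\<lambda>s. R (u - s) * z s)
        - l * integral {0..u} (\<lambda>s. R (u - s) * B s)"
    proof -
      let ?I = "\<lambda>a b. integral {a..b} (\<lambda>s. R (u - s) * z s)"
      have "l * (?I (-\<tau>) (u - \<tau>) + ?I (u - \<tau>) u) = l * (?I (-\<tau>) 0 + ?I 0 u)"
        using D E by simp
      then show ?thesis using A C by (simp add: distrib_left right_diff_distrib)
    qed
    then show ?thesis unfolding zt mm u_def by simp
  qed
qed

end

section \<open>Unstable characteristic roots\<close>

context fundamental_solution
begin

lemma R_sq_primitive:
  obtains Q where "\<And>x. (Q has_real_derivative (R x)\<^sup>2) (at x)"
    "\<And>a b. a \<le> b \<Longrightarrow> integral {a..b} (\<lambda>s. (R s)\<^sup>2) = Q b - Q a"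
proof -
  have "continuous_on UNIV (\<lambda>s. (R s)\<^sup>2)" by (intro continuous_intros cont)
  then show thesis
    using continuous_primitive that by (metis has_real_derivative_iff_has_vector_derivative)
qed

text \<open>On \<open>[t - 1, t]\<close> some \<open>(R s)\<^sup>2\<close> is at most the tail of the integral, and the increment of
  \<open>R\<^sup>2\<close> from \<open>s\<close> to \<open>t\<close> is controlled by the tail since \<open>2 \<bar>R R'\<bar> \<le> \<bar>l\<bar> (R\<^sup>2 + R(\<cdot> - \<tau>)\<^sup>2)\<close>.\<close>

lemma square_integrable_imp_tendsto_0:
  assumes bound: "\<And>T. T \<ge> 0 \<Longrightarrow> integral {0..T} (\<lambda>s. (R s)\<^sup>2) \<le> C"
  shows "(R \<longlongrightarrow> 0) at_top"
proof -
  obtain Q where Q: "\<And>x. (Q has_real_derivative (R x)\<^sup>2) (at x)"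
    and QI: "\<And>a b. a \<le> b \<Longrightarrow> integral {a..b} (\<lambda>s. (R s)\<^sup>2) = Q b - Q a"
    using R_sq_primitive by blast
  have mono: "Q a \<le> Q b" if "a \<le> b" for a b
    by (rule DERIV_nonneg_imp_nondecreasing[OF that]) (use Q in \<open>blast intro: zero_le_power2\<close>)
  have bdd: "bdd_above (range Q)"
  proof (rule bdd_aboveI2)
    fix x show "Q x \<le> Q 0 + \<bar>C\<bar>"
      using bound[of x] QI[of 0 x] mono[of x 0] by (cases "x \<ge> 0") auto
  qed
  \<comment> \<open>\<open>q - Q t\<close> is the tail of the square integral beyond
    \<open>t\<close>.\<close>
  define q where "q = (SUP x. Q x)"
  have Qq: "Q x \<le> q" for x unfolding q_def by (rule cSUP_upper[OF _ bdd]) simp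
  have key: "(R t)\<^sup>2 \<le> (1 + 2 * \<bar>l\<bar>) * (q - Q (t - 1 - \<tau>))" if t: "t > \<tau> + 1" for t
  proof -
    have "\<exists>s>t - 1. s < t \<and> Q t - Q (t - 1) = (t - (t - 1)) * (R s)\<^sup>2"
      by (rule MVT2) (auto intro: Q)
    then obtain s where s: "t - 1 < s" "s < t" "(R s)\<^sup>2 = Q t - Q (t - 1)" by auto
    define g where "g = (\<lambda>t. (R t)\<^sup>2 - \<bar>l\<bar> * (Q t + Q (t - \<tau>)))"
    have "g t \<le> g s"
    proof (rule DERIV_nonpos_imp_nonincreasing[where f=g])
      fix x assume x: "s \<le> x" "x \<le> t"
      have "(g has_real_derivative 2 * R x * (- l * R (x - \<tau>)) - \<bar>l\<bar> * ((R x)\<^sup>2 + (R (x - \<tau>))\<^sup>2)) (at x)"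
        unfolding g_def using x s t
        by (auto intro!: derivative_eq_intros R_deriv Q DERIV_chain2[OF Q])
      moreover have "2 * R x * (- l * R (x - \<tau>)) - \<bar>l\<bar> * ((R x)\<^sup>2 + (R (x - \<tau>))\<^sup>2) \<le> 0"
      proof -
        have "2 * (\<bar>R x\<bar> * \<bar>R (x - \<tau>)\<bar>) \<le> (R x)\<^sup>2 + (R (x - \<tau>))\<^sup>2"
          using sum_squares_bound[of "\<bar>R x\<bar>" "\<bar>R (x - \<tau>)\<bar>"] by simp
        then have "\<bar>l\<bar> * (2 * (\<bar>R x\<bar> * \<bar>R (x - \<tau>)\<bar>)) \<le> \<bar>l\<bar> * ((R x)\<^sup>2 + (R (x - \<tau>))\<^sup>2)"
          by (rule mult_left_mono) simp
        moreover have "2 * R x * (- l * R (x - \<tau>)) \<le> \<bar>2 * R x * (- l * R (x - \<tau>))\<bar>"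
          by (rule abs_ge_self)
        moreover have "\<bar>2 * R x * (- l * R (x - \<tau>))\<bar> = \<bar>l\<bar> * (2 * (\<bar>R x\<bar> * \<bar>R (x - \<tau>)\<bar>))"
          by (simp only: abs_mult abs_minus_cancel abs_numeral mult.assoc mult.left_commute)
        ultimately show ?thesis by linarith
      qed
      ultimately show "\<exists>y. (g has_real_derivative y) (at x) \<and> y \<le> 0" by blast
    qed (use s in simp)
    then have "(R t)\<^sup>2 \<le> Q t - Q (t - 1) + \<bar>l\<bar> * (Q t - Q s + (Q (t - \<tau>) - Q (s - \<tau>)))"
      by (simp add: g_def s(3) algebra_simps)
    also have "\<dots> \<le> (q - Q (t - 1 - \<tau>)) + \<bar>l\<bar> * (2 * (q - Q (t - 1 - \<tau>)))"
    proof (intro add_mono mult_left_mono)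
      have "Q (t - 1 - \<tau>) \<le> Q (t - 1)" "Q (t - 1 - \<tau>) \<le> Q s" "Q (t - 1 - \<tau>) \<le> Q (s - \<tau>)"
        using s tau by (auto intro!: mono)
      moreover have "Q t \<le> q" "Q (t - \<tau>) \<le> q" by (rule Qq)+
      ultimately show "Q t - Q (t - 1) \<le> q - Q (t - 1 - \<tau>)"
        and "Q t - Q s + (Q (t - \<tau>) - Q (s - \<tau>)) \<le> 2 * (q - Q (t - 1 - \<tau>))"
        by (simp_all add: algebra_simps)
    qed simp
    finally show ?thesis by (simp add: algebra_simps)
  qed
  show ?thesis
  proof (rule tendstoI)
    fix e :: real assume e: "e > 0"
    define d where "d = e\<^sup>2 / (1 + 2 * \<bar>l\<bar>)"
    have "d > 0" using e by (simp add: d_def add_pos_nonneg)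
    then have "q - d < (SUP x. Q x)" by (simp add: q_def)
    then obtain x0 where x0: "q - d < Q x0"
      using less_cSUP_iff[OF _ bdd] by auto
    show "\<forall>\<^sub>F t in at_top. dist (R t) 0 < e"
      using eventually_gt_at_top[of "max (\<tau> + 1) (x0 + 1 + \<tau>)"]
    proof eventually_elim
      case (elim t)
      then have t: "t > \<tau> + 1" "x0 \<le> t - 1 - \<tau>" by auto
      have "q - Q (t - 1 - \<tau>) < d" using x0 mono[OF t(2)] by linarith
      then have "(1 + 2 * \<bar>l\<bar>) * (q - Q (t - 1 - \<tau>)) < (1 + 2 * \<bar>l\<bar>) * d"
        by (intro mult_strict_left_mono) auto
      also have "\<dots> = e\<^sup>2" by (simp add: d_def add_nonneg_eq_0_iff)
      finally have "(R t)\<^sup>2 < e\<^sup>2" using key[OF t(1)] by simp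
      then have "\<bar>R t\<bar>\<^sup>2 < e\<^sup>2" by simp
      then show ?case using e power2_less_imp_less[of "\<bar>R t\<bar>" e] by simp
    qed
  qed
qed

text \<open>In the proof, \<open>G\<close> pairs the solution segment with the eigenfunction of the root \<open>z\<close> and is
  conserved.\<close>

lemma unstable_lower_bound:
  fixes z :: complex
  assumes root: "z + of_real l * exp (- (z * of_real \<tau>)) = 0" and Re: "Re z \<ge> 0" and t: "t \<ge> \<tau>"
  shows "1 \<le> \<bar>R t\<bar> + \<bar>l\<bar> * integral {t - \<tau>..t} (\<lambda>s. \<bar>R s\<bar>)"
proof -
  \<comment> \<open>The weight of \<open>R s\<close> is the exponential at time
    \<open>s + \<tau>\<close>, the moment at which this value enters the equation.\<close>
  define k where "k = (\<lambda>s. exp (- (z * of_real (s + \<tau>))) * of_real (R s))"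
  have "continuous_on UNIV k"
    unfolding k_def by (intro continuous_intros cont)
  then obtain H where H: "\<And>x. (H has_vector_derivative k x) (at x)"
    and HI: "\<And>a b. a \<le> b \<Longrightarrow> integral {a..b} k = H b - H a"
    using continuous_primitive by blast
  have expd: "((\<lambda>t. exp (- (z * of_real t))) has_vector_derivative - z * exp (- (z * of_real t))) (at t within S)" for t S
    by (rule has_vector_derivative_real_field) (auto intro!: derivative_eq_intros)
  define G where "G = (\<lambda>t. exp (- (z * of_real t)) * of_real (R t) - of_real l * (H t - H (t - \<tau>)))"
  have cG: "continuous_on S G" for S
    unfolding G_def
    by (intro continuous_intros cont_on continuous_on_compose2[OF continuous_on_primitive[OF H, of UNIV]]) auto
  have dG: "(G has_vector_derivative 0) (at x)" if "x > \<tau>" for x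
  proof -
    have "(H has_vector_derivative k (x - \<tau>)) (at (x - \<tau>))" by (rule H)
    then have dH: "((\<lambda>x. H (x - \<tau>)) has_vector_derivative k (x - \<tau>)) (at x)"
    proof -
      have "((\<lambda>x. x - \<tau>) has_vector_derivative 1) (at x)"
        unfolding has_real_derivative_iff_has_vector_derivative[symmetric]
        by (auto intro!: derivative_eq_intros)
      from vector_diff_chain_at[OF this \<open>(H has_vector_derivative k (x - \<tau>)) (at (x - \<tau>))\<close>]
      show ?thesis by (simp add: o_def)
    qed
    have dR: "((\<lambda>t. complex_of_real (R t)) has_vector_derivative of_real (- l * R (x - \<tau>))) (at x)"
      by (rule has_vector_derivative_of_real) (use R_deriv[OF that] in \<open>simp add: has_real_derivative_iff_has_vector_derivative\<close>)
    have e1: "exp (- (z * of_real (x + \<tau>))) = exp (- (z * of_real x)) * exp (- (z * of_real \<tau>))"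
      by (simp add: exp_add[symmetric] algebra_simps)
    have "(G has_vector_derivative (exp (- (z * of_real x)) * of_real (- l * R (x - \<tau>))
       + (- z * exp (- (z * of_real x))) * of_real (R x)
       - of_real l * (k x - k (x - \<tau>)))) (at x)"
      unfolding G_def
      by (intro has_vector_derivative_diff has_vector_derivative_mult has_vector_derivative_mult_right expd dR dH H)
    also have "(exp (- (z * of_real x)) * of_real (- l * R (x - \<tau>))
       + (- z * exp (- (z * of_real x))) * of_real (R x)
       - of_real l * (k x - k (x - \<tau>)))
       = - (exp (- (z * of_real x)) * of_real (R x) * (z + of_real l * exp (- (z * of_real \<tau>))))"
      unfolding k_def e1 by (simp add: algebra_simps)
    finally show ?thesis by (simp add: root)
  qed
  have "G t = G \<tau>"
  proof -
    have "((\<lambda>_. 0) has_integral (G t - G \<tau>)) {\<tau>..t}"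
      by (rule fundamental_theorem_of_calculus_interior[OF t cG dG]) auto
    then show ?thesis using has_integral_unique[OF has_integral_0] by fastforce
  qed
  \<comment> \<open>On \<open>{0..\<tau>}\<close>, where \<open>R = 1\<close>, the root equation
    makes \<open>l k\<close> the derivative of \<open>exp (- z s)\<close>; its integral cancels the
    exponential at \<open>\<tau>\<close> and leaves the value at \<open>0\<close>.\<close>
  also have "G \<tau> = 1"
  proof -
    have "((\<lambda>s. - z * exp (- (z * of_real s))) has_integral
        exp (- (z * of_real \<tau>)) - exp (- (z * of_real 0))) {0..\<tau>}"
      by (rule fundamental_theorem_of_calculus) (use tau expd in auto)
    moreover have "- z * exp (- (z * of_real s)) = of_real l * k s" if "s \<in> {0..\<tau>}" for s
    proof -
      have "- z = of_real l * exp (- (z * of_real \<tau>))" using root by (simp add: neg_eq_iff_add_eq_0)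
      then show ?thesis
      proof -
        have "exp (- (z * of_real s)) * exp (- (z * of_real \<tau>)) = exp (- (z * of_real (s + \<tau>)))"
          by (simp add: exp_add[symmetric] distrib_left)
        then show ?thesis using that \<open>- z = _\<close> by (simp add: k_def R_initial mult.commute)
      qed
    qed
    ultimately have "((\<lambda>s. of_real l * k s) has_integral
        exp (- (z * of_real \<tau>)) - exp (- (z * of_real 0))) {0..\<tau>}"
      by (rule has_integral_eq[rotated])
    from integral_unique[OF this]
    have "of_real l * integral {0..\<tau>} k = exp (- (z * of_real \<tau>)) - 1"
      by simp
    then show ?thesis using HI[of 0 \<tau>] tau by (simp add: G_def R_initial)
  qed
  finally have G1: "G t = 1" .
  \<comment> \<open>On the window \<open>s + \<tau> \<ge> t\<close>, so with
    \<open>Re z \<ge> 0\<close> every exponential there has modulus at most \<open>b\<close>, and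
    \<open>b \<le> 1\<close>.\<close>
  define b where "b = exp (- (Re z * t))"
  have kb: "norm (k s) \<le> b * \<bar>R s\<bar>" if "s \<in> {t - \<tau>..t}" for s
  proof -
    have "Re z * t \<le> Re z * (s + \<tau>)" using Re that by (intro mult_left_mono) auto
    then show ?thesis by (auto simp: k_def b_def norm_mult intro!: mult_right_mono)
  qed
  have "1 = norm (G t)" by (simp add: G1)
  also have "\<dots> \<le> b * \<bar>R t\<bar> + \<bar>l\<bar> * norm (integral {t - \<tau>..t} k)"
    unfolding G_def using HI[of "t - \<tau>" t] tau
    by (intro order_trans[OF norm_triangle_ineq4]) (simp add: norm_mult b_def)
  finally have A: "1 \<le> b * \<bar>R t\<bar> + \<bar>l\<bar> * norm (integral {t - \<tau>..t} k)" .
  have "norm (integral {t - \<tau>..t} k) \<le> integral {t - \<tau>..t} (\<lambda>s. b * \<bar>R s\<bar>)"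
    by (rule Henstock_Kurzweil_Integration.integral_norm_bound_integral)
      (simp_all add: kb, auto intro!: integrable_continuous_interval continuous_intros cont_on simp: k_def)
  also have "\<dots> = b * integral {t - \<tau>..t} (\<lambda>s. \<bar>R s\<bar>)" by simp
  finally have "\<bar>l\<bar> * norm (integral {t - \<tau>..t} k) \<le> \<bar>l\<bar> * (b * integral {t - \<tau>..t} (\<lambda>s. \<bar>R s\<bar>))"
    by (rule mult_left_mono) simp
  with A have "1 \<le> b * (\<bar>R t\<bar> + \<bar>l\<bar> * integral {t - \<tau>..t} (\<lambda>s. \<bar>R s\<bar>))"
    by (simp add: algebra_simps)
  also have "\<dots> \<le> 1 * (\<bar>R t\<bar> + \<bar>l\<bar> * integral {t - \<tau>..t} (\<lambda>s. \<bar>R s\<bar>))"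
    by (intro mult_right_mono add_nonneg_nonneg mult_nonneg_nonneg
        Henstock_Kurzweil_Integration.integral_nonneg integrable_continuous_interval continuous_intros cont_on)
      (use Re t tau in \<open>auto simp: b_def\<close>)
  finally show ?thesis by simp
qed

text \<open>For \<open>l \<tau> \<ge> \<pi>/2\<close> the curve \<open>u = - v cot v\<close> of candidates \<open>z \<tau> = u + i v\<close> is followed over
  \<open>v \<in> [\<pi>/2, \<pi>)\<close>, where \<open>l \<tau> = v e\<^sup>u / sin v\<close> runs through \<open>[\<pi>/2, \<infinity>)\<close>.\<close>

lemma characteristic_root:
  assumes "l \<notin> {0<..<pi / (2 * \<tau>)}"
  obtains z :: complex where "z + of_real l * exp (- (z * of_real \<tau>)) = 0" "Re z \<ge> 0"
proof (cases "l \<le> 0")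
  case True
  have "\<exists>u. 0 \<le> u \<and> u \<le> - l \<and> u + l * exp (- (u * \<tau>)) = 0"
  proof (rule IVT')
    have "exp (l * \<tau>) \<le> 1" using True tau by (simp add: mult_nonpos_nonneg)
    then have "l * exp (l * \<tau>) \<ge> l * 1" using True by (intro mult_left_mono_neg) auto
    then show "0 \<le> - l + l * exp (- (- l * \<tau>))" by simp
  qed (use True in \<open>auto intro!: continuous_intros\<close>)
  then obtain u where u: "0 \<le> u" "u + l * exp (- (u * \<tau>)) = 0" by blast
  have "of_real u + of_real l * exp (- (of_real u * of_real \<tau>)) = (of_real (u + l * exp (- (u * \<tau>))) :: complex)"
    by (simp add: exp_of_real[symmetric])
  with u that[of "of_real u"] show thesis by simp
next
  case False
  with assms tau have lt: "l * \<tau> \<ge> pi / 2" by (simp add: field_simps)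
  define a :: "real \<Rightarrow> real" where "a = (\<lambda>v. v * exp (- (v * cos v / sin v)) / sin v)"
  \<comment> \<open>Chosen so that \<open>a (pi - d) \<ge> (pi / 2) / d = l * \<tau>\<close>, using
    \<open>sin d \<le> d\<close>, \<open>pi - d \<ge> pi / 2\<close> and a nonnegative
    exponent.\<close>
  define d where "d = (pi / 2) / (l * \<tau>)"
  have ltp: "l * \<tau> > 0" using lt pi_gt_zero by linarith
  have d0: "0 < d" using ltp by (simp add: d_def)
  have d1: "d \<le> 1" using lt ltp by (simp add: d_def)
  have dpi: "d \<le> pi / 2" using d1 pi_half_gt_zero pi_gt3 by linarith
  have "\<exists>v. pi / 2 \<le> v \<and> v \<le> pi - d \<and> a v = l * \<tau>"
  proof (rule IVT')
    show "a (pi / 2) \<le> l * \<tau>" using lt by (simp add: a_def)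
    have s: "sin (pi - d) > 0" "sin (pi - d) \<le> d" using d0 dpi sin_x_le_x[of d]
      by (auto intro!: sin_gt_zero) 
    have c: "cos (pi - d) \<le> 0" using d0 dpi by (auto intro!: cos_ge_zero)
    have "(pi - d) * cos (pi - d) / sin (pi - d) \<le> 0"
      using s c dpi pi_half_gt_zero by (intro divide_nonpos_pos mult_nonneg_nonpos) linarith+
    then have "1 \<le> exp (- ((pi - d) * cos (pi - d) / sin (pi - d)))"
      by (simp only: one_le_exp_iff neg_0_le_iff_le)
    moreover have "pi / 2 \<le> pi - d" "d \<le> pi" using dpi pi_half_gt_zero by linarith+
    ultimately have "(pi / 2) * 1 \<le> (pi - d) * exp (- ((pi - d) * cos (pi - d) / sin (pi - d)))"
      by (intro mult_mono) auto
    then have "(pi / 2) / d \<le> a (pi - d)"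
      unfolding a_def using s d0 \<open>d \<le> pi\<close> by (intro frac_le mult_nonneg_nonneg) auto
    then show "l * \<tau> \<le> a (pi - d)" using ltp d0 by (simp add: d_def field_simps)
    have "sin v \<noteq> 0" if "pi / 2 \<le> v" "v \<le> pi - d" for v
      using sin_gt_zero[of v] that d0 pi_half_gt_zero by linarith
    then show "continuous_on {pi / 2..pi - d} a"
      unfolding a_def by (intro continuous_intros) auto
  qed (use dpi in auto)
  then obtain v where v: "pi / 2 \<le> v" "v \<le> pi - d" "a v = l * \<tau>" by blast
  define u where "u = - (v * cos v / sin v)"
  have sv: "sin v > 0" using v d0 pi_half_gt_zero by (intro sin_gt_zero) linarith+
  have cv: "cos v \<le> 0" using v d0 cos_ge_zero[of "pi - v"] by (simp add: cos_diff)
  have "v \<ge> 0" using v pi_half_gt_zero by linarith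
  then have u0: "u \<ge> 0" unfolding u_def using sv cv
    by (simp add: divide_nonpos_pos mult_nonneg_nonpos)
  have lt_eq: "l * \<tau> = v * exp u / sin v" using v(3) by (simp add: a_def u_def)
  have r1: "l * \<tau> * exp (- u) * cos v = - u"
    unfolding lt_eq by (simp add: u_def exp_minus exp_add[symmetric] field_simps)
  have r2: "l * \<tau> * exp (- u) * sin v = v"
    unfolding lt_eq using sv by (simp add: exp_minus field_simps)
  define z where "z = Complex (u / \<tau>) (v / \<tau>)"
  have ez: "exp (- (z * of_real \<tau>)) = of_real (exp (- u)) * cis (- v)"
    using tau by (subst exp_eq_polar) (simp add: z_def)
  have "\<tau> * Re (z + of_real l * exp (- (z * of_real \<tau>))) = 0"
    unfolding ez using r1 tau by (simp add: z_def algebra_simps)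
  moreover have "\<tau> * Im (z + of_real l * exp (- (z * of_real \<tau>))) = 0"
    unfolding ez using r2 tau by (simp add: z_def algebra_simps)
  ultimately have "z + of_real l * exp (- (z * of_real \<tau>)) = 0"
    using tau by (simp add: complex_eq_iff)
  then show thesis using that[of z] u0 tau by (simp add: z_def)
qed

text \<open>A decaying \<open>R\<close> makes the right-hand side of
  \<open>unstable_lower_bound\<close> small on late windows, whereas it never drops below
  \<open>1\<close>.\<close>

lemma square_integrable_imp_stable:
  assumes bound: "\<And>T. T \<ge> 0 \<Longrightarrow> integral {0..T} (\<lambda>s. (R s)\<^sup>2) \<le> C"
  shows "l \<in> {0<..<pi / (2 * \<tau>)}"
proof (rule ccontr)
  assume "l \<notin> {0<..<pi / (2 * \<tau>)}"
  then obtain z :: complex where z: "z + of_real l * exp (- (z * of_real \<tau>)) = 0" "Re z \<ge> 0"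
    using characteristic_root by blast
  \<comment> \<open>If \<open>\<bar>R\<bar> \<le> e\<close> on a whole window, the right-hand side
    of the lower bound is at most \<open>1 / 2\<close>.\<close>
  define e where "e = 1 / (2 * (1 + \<bar>l\<bar> * \<tau>))"
  have pos: "1 + \<bar>l\<bar> * \<tau> > 0" using tau by (simp add: add_pos_nonneg)
  then have "e > 0" by (simp add: e_def)
  then have "\<forall>\<^sub>F t in at_top. dist (R t) 0 < e"
    using square_integrable_imp_tendsto_0[OF bound] by (auto dest: tendstoD)
  then obtain T where T: "\<And>t. t \<ge> T \<Longrightarrow> \<bar>R t\<bar> < e" by (auto simp: eventually_at_top_linorder)
  define t where "t = \<bar>T\<bar> + \<tau>"
  have "norm (integral {t - \<tau>..t} (\<lambda>s. \<bar>R s\<bar>)) \<le> e * (t - (t - \<tau>))"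
    by (rule integral_bound) (use tau T in \<open>auto intro!: continuous_intros cont_on less_imp_le simp: t_def\<close>)
  then have "integral {t - \<tau>..t} (\<lambda>s. \<bar>R s\<bar>) \<le> e * \<tau>" by simp
  then have "\<bar>l\<bar> * integral {t - \<tau>..t} (\<lambda>s. \<bar>R s\<bar>) \<le> \<bar>l\<bar> * (e * \<tau>)"
    by (rule mult_left_mono) simp
  moreover have "\<bar>R t\<bar> \<le> e" using T[of t] tau by (auto simp: t_def intro!: less_imp_le)
  moreover have "1 \<le> \<bar>R t\<bar> + \<bar>l\<bar> * integral {t - \<tau>..t} (\<lambda>s. \<bar>R s\<bar>)"
    by (rule unstable_lower_bound[OF z]) (simp add: t_def)
  ultimately have "1 \<le> e * (1 + \<bar>l\<bar> * \<tau>)" by (simp add: algebra_simps)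
  also have "\<dots> = 1 / 2" using pos by (simp add: e_def divide_simps)
  finally show False by simp
qed


end

section \<open>A Lyapunov function in the stable range\<close>

text \<open>The segment of \<open>y = R'\<close> on \<open>[t - \<tau>/2, t + \<tau>/2]\<close> is split into its even and odd parts
  about the centre \<open>t\<close>. With \<open>p = P / cos (l m)\<close> and \<open>q = Q / sin (l m)\<close> the flow satisfies
  \<open>\<partial>\<^sub>t (p\<^sup>2 + q\<^sup>2) / 2 = \<partial>\<^sub>m (p q)\<close>, so that half the integral of \<open>p\<^sup>2 + q\<^sup>2\<close> together with a
  boundary term is a Lyapunov function whose derivative along the flow is \<open>- R(t - \<tau>/2)\<^sup>2\<close>.\<close>

locale stable_fundamental_solution = fundamental_solution +
  fixes y :: "real \<Rightarrow> real" and Yc Ys X :: "real \<Rightarrow> real" and h C S :: real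
  assumes l_stable: "l \<in> {0<..<pi / (2 * \<tau>)}"
    and h_def: "h = \<tau> / 2" and C_def: "C = cos (l * h)" and S_def: "S = sin (l * h)"
    and y_def: "y = (\<lambda>u. - l * R (u - \<tau>))"
    and Yc: "\<And>u. (Yc has_real_derivative cos (l * u) * y u) (at u)"
    and Ys: "\<And>u. (Ys has_real_derivative sin (l * u) * y u) (at u)"
    and X: "\<And>u. (X has_real_derivative y u) (at u)"
    and X_eq: "\<And>u. u \<ge> \<tau> \<Longrightarrow> X u = R u"
begin

text \<open>\<open>P\<close> and \<open>Q\<close> are the integrals of
  \<open>cos (l * (u - t)) * y u\<close> and \<open>sin (l * (u - t)) * y u\<close> over
  \<open>{t - m..t + m}\<close>, that is, the even and odd parts of the segment. Expanding by the
  addition formulas moves \<open>t\<close> and \<open>m\<close> out of the integrals, so both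
  partial derivatives are elementary.\<close>

definition P where "P m t = cos (l * t) * (Yc (t + m) - Yc (t - m)) + sin (l * t) * (Ys (t + m) - Ys (t - m))"
definition Q where "Q m t = cos (l * t) * (Ys (t + m) - Ys (t - m)) - sin (l * t) * (Yc (t + m) - Yc (t - m))"
definition E where "E m t = ((P m t)\<^sup>2 / (cos (l * m))\<^sup>2 + (Q m t)\<^sup>2 / (sin (l * m))\<^sup>2) / 2"
text \<open>The \<open>t\<close>-derivative of \<open>E\<close>, kept as an expression of its own
  because it is also the \<open>m\<close>-derivative of \<open>W\<close>.\<close>

definition Et where "Et m t = P m t * (l * Q m t + cos (l * m) * (y (t + m) - y (t - m))) / (cos (l * m))\<^sup>2
    + Q m t * (- l * P m t + sin (l * m) * (y (t + m) + y (t - m))) / (sin (l * m))\<^sup>2"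
definition W where "W m t = P m t * Q m t / (sin (l * m) * cos (l * m))"
text \<open>The multiples of \<open>X (t - h)\<close> cancel the terms with \<open>y (t - h)\<close>
  in the \<open>t\<close>-derivatives of \<open>P h\<close> and \<open>Q h\<close>. Only
  \<open>y (t + h) = - l * R (t - h)\<close> is left.\<close>

definition Pp where "Pp t = P h t + C * X (t - h)"
definition Qp where "Qp t = Q h t - S * X (t - h)"
text \<open>The weights \<open>1 / C\<close> and \<open>1 / S\<close> make the terms mixing
  \<open>R (t - h)\<close> with \<open>P h\<close> or \<open>Q h\<close> cancel in the derivative;
  the denominator normalises the coefficient of \<open>(R (t - h))^2\<close> to
  \<open>-1\<close>.\<close>

definition \<kappa> where "\<kappa> t = ((Pp t)\<^sup>2 / C + (Qp t)\<^sup>2 / S) / (2 * l * (C - S))"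

lemma l_pos: "l > 0" and h_pos: "h > 0" and lh: "l * h < pi / 4"
  using l_stable tau by (auto simp: h_def field_simps)

text \<open>The stability bound enters here: \<open>l * h\<close> lies below \<open>pi / 4\<close>,
  where sine and cosine cross. This gives \<open>\<kappa>\<close> its sign.\<close>

lemma S_pos: "S > 0" and C_gt_S: "C > S"
proof -
  have "l * h > 0" using l_pos h_pos by simp
  then show "S > 0" unfolding S_def using lh by (intro sin_gt_zero) auto
  have "sin (l * h) < sin (pi / 4)" by (rule sin_monotone_2pi) (use \<open>l * h > 0\<close> lh in auto)
  moreover have "cos (pi / 4) < cos (l * h)" by (rule cos_monotone_0_pi) (use \<open>l * h > 0\<close> lh in auto)
  ultimately show "C > S" by (simp add: C_def S_def cos_45 sin_45)
qed

lemma C_pos: "C > 0" using S_pos C_gt_S by simp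

lemma cos_ge_C: "0 \<le> m \<Longrightarrow> m \<le> h \<Longrightarrow> cos (l * m) \<ge> C"
proof -
  assume m: "0 \<le> m" "m \<le> h"
  then have "0 \<le> l * m" "l * m \<le> l * h" using l_pos by auto
  moreover have "l * h \<le> pi" using lh pi_gt_zero by linarith
  ultimately show ?thesis unfolding C_def by (intro cos_monotone_0_pi_le)
qed

lemma sin_pos: "0 < m \<Longrightarrow> m \<le> h \<Longrightarrow> sin (l * m) > 0"
proof -
  assume m: "0 < m" "m \<le> h"
  have "l * m \<le> l * h" using m l_pos by simp
  then have "l * m < pi" using lh pi_gt_zero by linarith
  moreover have "l * m > 0" using m l_pos by simp
  ultimately show ?thesis by (rule sin_gt_zero[rotated])
qed

lemma y_cont: "continuous_on A y"
  unfolding y_def by (intro continuous_intros)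

lemma prim_cont: "continuous_on A Yc" "continuous_on A Ys" "continuous_on A X"
  using Yc Ys X by (meson DERIV_isCont continuous_at_imp_continuous_on)+

lemmas [continuous_intros] = continuous_on_compose2[OF y_cont[of UNIV] _ subset_UNIV]
  continuous_on_compose2[OF prim_cont(1)[of UNIV] _ subset_UNIV]
  continuous_on_compose2[OF prim_cont(2)[of UNIV] _ subset_UNIV]
  continuous_on_compose2[OF prim_cont(3)[of UNIV] _ subset_UNIV]

lemma cos_shift: "cos (l * t) * cos (l * (t + m)) + sin (l * t) * sin (l * (t + m)) = cos (l * m)"
    "cos (l * t) * sin (l * (t + m)) - sin (l * t) * cos (l * (t + m)) = sin (l * m)"
    "cos (l * t) * cos (l * (t - m)) + sin (l * t) * sin (l * (t - m)) = cos (l * m)"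
    "cos (l * t) * sin (l * (t - m)) - sin (l * t) * cos (l * (t - m)) = - sin (l * m)"
  using cos_diff[of "l * t" "l * (t + m)"] sin_diff[of "l * (t + m)" "l * t"]
    cos_diff[of "l * t" "l * (t - m)"] sin_diff[of "l * (t - m)" "l * t"]
  by (simp_all add: right_diff_distrib distrib_left mult.commute)

text \<open>Moving the centre rotates the phase, which sends \<open>P\<close> to \<open>l Q\<close>
  and \<open>Q\<close> to \<open>- l P\<close>; the remaining term comes from the two ends of the
  window.\<close>

lemma P_t: "((\<lambda>t. P m t) has_real_derivative l * Q m t + cos (l * m) * (y (t + m) - y (t - m))) (at t)"
proof -
  have "((\<lambda>t. P m t) has_real_derivative
      l * Q m t + (cos (l * t) * cos (l * (t + m)) + sin (l * t) * sin (l * (t + m))) * y (t + m)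
        - (cos (l * t) * cos (l * (t - m)) + sin (l * t) * sin (l * (t - m))) * y (t - m)) (at t)"
    unfolding P_def Q_def
    by (auto intro!: derivative_eq_intros DERIV_chain2[OF Yc] DERIV_chain2[OF Ys] simp: algebra_simps)
  then show ?thesis unfolding cos_shift by (simp add: right_diff_distrib add_diff_eq)
qed

lemma Q_t: "((\<lambda>t. Q m t) has_real_derivative - l * P m t + sin (l * m) * (y (t + m) + y (t - m))) (at t)"
proof -
  have "((\<lambda>t. Q m t) has_real_derivative
      - l * P m t + (cos (l * t) * sin (l * (t + m)) - sin (l * t) * cos (l * (t + m))) * y (t + m)
        - (cos (l * t) * sin (l * (t - m)) - sin (l * t) * cos (l * (t - m))) * y (t - m)) (at t)"
    unfolding P_def Q_def
    by (auto intro!: derivative_eq_intros DERIV_chain2[OF Yc] DERIV_chain2[OF Ys] simp: algebra_simps)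
  then show ?thesis unfolding cos_shift by (simp add: algebra_simps)
qed

lemma P_m: "((\<lambda>m. P m t) has_real_derivative cos (l * m) * (y (t + m) + y (t - m))) (at m)"
proof -
  have "((\<lambda>m. P m t) has_real_derivative
      (cos (l * t) * cos (l * (t + m)) + sin (l * t) * sin (l * (t + m))) * y (t + m)
        + (cos (l * t) * cos (l * (t - m)) + sin (l * t) * sin (l * (t - m))) * y (t - m)) (at m)"
    unfolding P_def
    by (auto intro!: derivative_eq_intros DERIV_chain2[OF Yc] DERIV_chain2[OF Ys] simp: algebra_simps)
  then show ?thesis unfolding cos_shift by (simp add: algebra_simps)
qed

lemma Q_m: "((\<lambda>m. Q m t) has_real_derivative sin (l * m) * (y (t + m) - y (t - m))) (at m)"
proof -
  have "((\<lambda>m. Q m t) has_real_derivative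
      (cos (l * t) * sin (l * (t + m)) - sin (l * t) * cos (l * (t + m))) * y (t + m)
        + (cos (l * t) * sin (l * (t - m)) - sin (l * t) * cos (l * (t - m))) * y (t - m)) (at m)"
    unfolding Q_def
    by (auto intro!: derivative_eq_intros DERIV_chain2[OF Yc] DERIV_chain2[OF Ys] simp: algebra_simps)
  then show ?thesis unfolding cos_shift by (simp add: algebra_simps)
qed

lemma P_0 [simp]: "P 0 t = 0" and Q_0 [simp]: "Q 0 t = 0"
  by (simp_all add: P_def Q_def)

lemma P_bound:
  assumes m: "0 \<le> m" "m \<le> h" and B: "\<And>u. u \<in> {t - h..t + h} \<Longrightarrow> \<bar>y u\<bar> \<le> B"
  shows "\<bar>P m t\<bar> \<le> 2 * B * m"
proof -
  have "norm (P m t - P 0 t) \<le> 2 * B * norm (m - 0)"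
  proof (rule field_differentiable_bound[where f="\<lambda>m. P m t" and S="{0..m}"])
    fix q assume q: "q \<in> {0..m}"
    show "((\<lambda>m. P m t) has_field_derivative cos (l * q) * (y (t + q) + y (t - q))) (at q within {0..m})"
      by (rule has_field_derivative_at_within[OF P_m])
    have "\<bar>cos (l * q)\<bar> * \<bar>y (t + q) + y (t - q)\<bar> \<le> 1 * (B + B)"
      using B[of "t + q"] B[of "t - q"] q m by (intro mult_mono) auto
    then show "norm (cos (l * q) * (y (t + q) + y (t - q))) \<le> 2 * B" by (simp add: abs_mult)
  qed (use m in auto)
  then show ?thesis using m by simp
qed

text \<open>The \<open>m\<close>-derivative of \<open>Q\<close> carries the factor
  \<open>sin (l * m)\<close>, which is increasing. The bound therefore gains this factor over the
  one for \<open>P\<close>, and \<open>Q / sin (l * m)\<close> stays bounded at the singular end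
  \<open>m = 0\<close>.\<close>

lemma Q_bound:
  assumes m: "0 \<le> m" "m \<le> h" and B: "\<And>u. u \<in> {t - h..t + h} \<Longrightarrow> \<bar>y u\<bar> \<le> B"
  shows "\<bar>Q m t\<bar> \<le> 2 * B * m * sin (l * m)"
proof -
  have sm: "\<bar>sin (l * q)\<bar> \<le> sin (l * m)" if "q \<in> {0..m}" for q
  proof -
    have "l * q \<le> l * m" "l * m \<le> l * h" "0 \<le> l * q" using that m l_pos by auto
    then have "sin (l * q) \<le> sin (l * m)" "0 \<le> sin (l * q)"
      using lh by (auto intro!: sin_monotone_2pi_le sin_ge_zero)
    then show ?thesis by simp
  qed
  have "norm (Q m t - Q 0 t) \<le> (2 * B * sin (l * m)) * norm (m - 0)"
  proof (rule field_differentiable_bound[where f="\<lambda>m. Q m t" and S="{0..m}"])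
    fix q assume q: "q \<in> {0..m}"
    show "((\<lambda>m. Q m t) has_field_derivative sin (l * q) * (y (t + q) - y (t - q))) (at q within {0..m})"
      by (rule has_field_derivative_at_within[OF Q_m])
    have "\<bar>sin (l * q)\<bar> * \<bar>y (t + q) - y (t - q)\<bar> \<le> sin (l * m) * (B + B)"
      using B[of "t + q"] B[of "t - q"] q m sm[OF q] by (intro mult_mono) auto
    then show "norm (sin (l * q) * (y (t + q) - y (t - q))) \<le> 2 * B * sin (l * m)"
      by (simp add: abs_mult mult_ac)
  qed (use m in auto)
  then show ?thesis using m by (simp add: mult_ac)
qed

lemma E_nonneg: "E m t \<ge> 0"
  by (simp add: E_def)

lemma E_bound:
  assumes m: "0 < m" "m \<le> h" and B: "\<And>u. u \<in> {t - h..t + h} \<Longrightarrow> \<bar>y u\<bar> \<le> B"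
  shows "E m t \<le> 2 * h\<^sup>2 * (1 / C\<^sup>2 + 1) * B\<^sup>2"
proof -
  have s: "sin (l * m) > 0" and c: "cos (l * m) \<ge> C" using sin_pos cos_ge_C m by auto
  have B0: "B \<ge> 0" using B[of t] h_pos by fastforce
  have "(P m t)\<^sup>2 \<le> (2 * B * h)\<^sup>2"
    using m B0 h_pos by (intro abs_le_square_iff[THEN iffD1])
      (auto intro!: order_trans[OF P_bound[OF _ m(2) B]] mult_left_mono)
  then have a: "(P m t)\<^sup>2 / (cos (l * m))\<^sup>2 \<le> (2 * B * h)\<^sup>2 / C\<^sup>2"
    using c C_pos by (intro frac_le) (auto intro!: power_mono)
  have "(Q m t)\<^sup>2 \<le> (2 * B * h * sin (l * m))\<^sup>2"
    using m B0 s h_pos by (intro abs_le_square_iff[THEN iffD1])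
      (auto intro!: order_trans[OF Q_bound[OF _ m(2) B]] mult_left_mono mult_right_mono)
  then have b: "(Q m t)\<^sup>2 / (sin (l * m))\<^sup>2 \<le> (2 * B * h)\<^sup>2"
    using s by (simp add: divide_le_eq power_mult_distrib)
  have "E m t \<le> ((2 * B * h)\<^sup>2 / C\<^sup>2 + (2 * B * h)\<^sup>2) / 2"
    unfolding E_def by (intro divide_right_mono add_mono a b) simp
  also have "\<dots> = 2 * h\<^sup>2 * (1 / C\<^sup>2 + 1) * B\<^sup>2" by (simp add: power_mult_distrib field_simps)
  finally show ?thesis .
qed

text \<open>The order \<open>m^2\<close> makes the flux through the inner cut-off vanish in the
  limit.\<close>

lemma W_bound:
  assumes m: "0 < m" "m \<le> h" and B: "\<And>u. u \<in> {t - h..t + h} \<Longrightarrow> \<bar>y u\<bar> \<le> B"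
  shows "\<bar>W m t\<bar> \<le> 4 * B\<^sup>2 / C * m\<^sup>2"
proof -
  have s: "sin (l * m) > 0" and c: "cos (l * m) \<ge> C" using sin_pos cos_ge_C m by auto
  have B0: "B \<ge> 0" using B[of t] h_pos by fastforce
  have "\<bar>P m t\<bar> * \<bar>Q m t\<bar> \<le> (2 * B * m) * (2 * B * m * sin (l * m))"
    using P_bound[OF _ m(2) B] Q_bound[OF _ m(2) B] m B0 by (intro mult_mono) auto
  then have "\<bar>P m t\<bar> * \<bar>Q m t\<bar> / (sin (l * m) * cos (l * m))
      \<le> (2 * B * m) * (2 * B * m * sin (l * m)) / (sin (l * m) * C)"
    using s c C_pos B0 m by (intro frac_le mult_left_mono) auto
  also have "\<dots> = 4 * B\<^sup>2 / C * m\<^sup>2" using s by (simp add: field_simps power2_eq_square)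
  finally show ?thesis using s c C_pos by (simp add: W_def abs_mult)
qed

lemma E_t:
  shows "((\<lambda>t. E m t) has_real_derivative Et m t) (at t)"
proof -
  have "((\<lambda>t. E m t) has_real_derivative
    (real 2 * ((l * Q m t + cos (l * m) * (y (t + m) - y (t - m))) * P m t ^ (2 - Suc 0)) / (cos (l * m))\<^sup>2
    + real 2 * ((- l * P m t + sin (l * m) * (y (t + m) + y (t - m))) * Q m t ^ (2 - Suc 0)) / (sin (l * m))\<^sup>2) / 2) (at t)"
    unfolding E_def by (intro DERIV_cdivide DERIV_add DERIV_power P_t Q_t)
  then show ?thesis by (simp add: Et_def add_divide_distrib mult.commute)
qed

lemma W_m:
  assumes m: "0 < m" "m \<le> h"
  shows "((\<lambda>m. W m t) has_real_derivative Et m t) (at m)"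
proof -
  let ?c = "cos (l * m)" and ?s = "sin (l * m)"
  have s: "?s \<noteq> 0" and c: "?c \<noteq> 0" using sin_pos[of m] cos_ge_C[of m] C_pos m by auto
  have "((\<lambda>m. W m t) has_real_derivative
    ((?c * (y (t + m) + y (t - m)) * Q m t + P m t * (?s * (y (t + m) - y (t - m)))) * (?s * ?c)
      - P m t * Q m t * (l * ?c * ?c - ?s * (l * ?s))) / (?s * ?c)\<^sup>2) (at m)"
    unfolding W_def using s c
    by (auto intro!: derivative_eq_intros P_m Q_m simp: power2_eq_square algebra_simps)
  also have "((?c * (y (t + m) + y (t - m)) * Q m t + P m t * (?s * (y (t + m) - y (t - m)))) * (?s * ?c)
      - P m t * Q m t * (l * ?c * ?c - ?s * (l * ?s))) / (?s * ?c)\<^sup>2 = Et m t"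
    unfolding Et_def using s c by (simp add: divide_simps) (simp add: power2_eq_square algebra_simps)
  finally show ?thesis .
qed

lemma cont_joint:
  assumes e: "0 < e"
  shows "continuous_on (A \<times> {e..h}) (\<lambda>(t, m). Et m t)"
proof -
  have "sin (l * m) \<noteq> 0" "cos (l * m) \<noteq> 0" if "m \<in> {e..h}" for m
    using sin_pos[of m] cos_ge_C[of m] C_pos that e by auto
  then show ?thesis
    unfolding Et_def P_def Q_def split_beta
    by (intro continuous_intros) auto
qed

text \<open>By the conservation law the differentiated integrand is a total derivative in
  \<open>m\<close>, so only the fluxes through the two ends remain.\<close>

lemma E_int_t:
  assumes e: "0 < e" "e \<le> h"
  shows "((\<lambda>t. integral {e..h} (\<lambda>m. E m t)) has_real_derivative W h t - W e t) (at t)"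
proof -
  have "((\<lambda>t. integral (cbox e h) (\<lambda>m. E m t)) has_real_derivative
       integral (cbox e h) (\<lambda>m. Et m t)) (at t within UNIV)"
  proof (rule leibniz_rule_field_derivative)
    show "(\<lambda>m. E m t) integrable_on cbox e h" for t
    proof -
      have "sin (l * m) \<noteq> 0" "cos (l * m) \<noteq> 0" if "m \<in> {e..h}" for m
        using sin_pos[of m] cos_ge_C[of m] C_pos that e by auto
      then show ?thesis
        unfolding E_def P_def Q_def cbox_interval
        by (intro integrable_continuous_interval continuous_intros) auto
    qed
  qed (use cont_joint[OF e(1)] E_t in \<open>auto\<close>)
  moreover have "integral {e..h} (\<lambda>m. Et m t) = W h t - W e t"
    by (rule integral_unique, rule fundamental_theorem_of_calculus[OF e(2)])
      (use e in \<open>simp add: has_field_derivative_at_within[OF W_m]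
         flip: has_real_derivative_iff_has_vector_derivative\<close>)
  ultimately show ?thesis by simp
qed

text \<open>The term \<open>- W h t\<close> absorbs the outer flux in \<open>E_int_t\<close>. The
  bound on \<open>t\<close> means \<open>t - h \<ge> \<tau>\<close>, where \<open>X\<close> agrees
  with \<open>R\<close>.\<close>

lemma \<kappa>_t:
  assumes t: "t \<ge> 3 * h"
  shows "(\<kappa> has_real_derivative - (R (t - h))\<^sup>2 - W h t) (at t)"
proof -
  define x where "x = R (t - h)"
  have x: "X (t - h) = x" unfolding x_def using t by (intro X_eq) (simp add: h_def)
  have yx: "y (t + h) = - l * x" by (simp add: y_def x_def h_def algebra_simps)
  have dP: "(Pp has_real_derivative l * Q h t + C * y (t + h)) (at t)"
    unfolding Pp_def[abs_def]
    by (auto intro!: derivative_eq_intros P_t DERIV_chain2[OF X] simp: C_def algebra_simps)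
  have dQ: "(Qp has_real_derivative - l * P h t + S * y (t + h)) (at t)"
    unfolding Qp_def[abs_def]
    by (auto intro!: derivative_eq_intros Q_t DERIV_chain2[OF X] simp: S_def algebra_simps)
  have nz: "C \<noteq> 0" "S \<noteq> 0" "l \<noteq> 0" "C - S \<noteq> 0" using C_pos S_pos l_pos C_gt_S by auto
  have "(\<kappa> has_real_derivative (2 * Pp t * (l * Q h t + C * y (t + h)) / C
      + 2 * Qp t * (- l * P h t + S * y (t + h)) / S) / (2 * l * (C - S))) (at t)"
  proof -
    have "(\<kappa> has_real_derivative (real 2 * ((l * Q h t + C * y (t + h)) * Pp t ^ (2 - Suc 0)) / C
      + real 2 * ((- l * P h t + S * y (t + h)) * Qp t ^ (2 - Suc 0)) / S) / (2 * l * (C - S))) (at t)"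
      unfolding \<kappa>_def[abs_def] by (intro DERIV_cdivide DERIV_add DERIV_power dP dQ)
    then show ?thesis by (simp add: mult_ac)
  qed
  also have "(2 * Pp t * (l * Q h t + C * y (t + h)) / C
      + 2 * Qp t * (- l * P h t + S * y (t + h)) / S) / (2 * l * (C - S)) = - x\<^sup>2 - W h t"
  proof -
    define p q where "p = P h t" and "q = Q h t"
    \<comment> \<open>The products \<open>p * x\<close> and \<open>q * x\<close> cancel between the
      two squares. Up to the factor \<open>2 * l\<close>, what remains is
      \<open>p * q * (1 / C - 1 / S) - (C - S) * x^2\<close>.\<close>
    have "l * S * C * (2 * (p + C * x) * (l * q + C * (- l * x)) / C
      + 2 * (q - S * x) * (- l * p + S * (- l * x)) / S) =
      l * S * C * ((- x\<^sup>2 - p * q / (S * C)) * (2 * l * (C - S)))"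
      using nz by (simp add: field_simps power2_eq_square)
    then have "(2 * (p + C * x) * (l * q + C * (- l * x)) / C
      + 2 * (q - S * x) * (- l * p + S * (- l * x)) / S) = (- x\<^sup>2 - p * q / (S * C)) * (2 * l * (C - S))"
      using nz by simp
    then show ?thesis
      unfolding Pp_def Qp_def W_def x yx p_def[symmetric] q_def[symmetric] C_def[symmetric] S_def[symmetric]
      using nz by (simp add: divide_eq_eq)
  qed
  finally show ?thesis by (simp add: x_def)
qed

end

section \<open>Initial value of the Lyapunov functional and passage to the limit\<close>

context stable_fundamental_solution
begin

lemma y_bounded: obtains B where "\<And>u. u \<in> {a..b} \<Longrightarrow> \<bar>y u\<bar> \<le> B"
proof -
  have "compact (y ` {a..b})"
    by (intro compact_continuous_image y_cont) simp
  then obtain B where "\<forall>x\<in>y ` {a..b}. norm x \<le> B"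
    using compact_imp_bounded bounded_iff by metis
  then show thesis by (intro that[of B]) auto
qed

lemma initial_window:
  assumes m: "0 \<le> m" "m \<le> h"
  shows "P m (3 * h) = - 2 * sin (l * m)" "Q m (3 * h) = 0"
proof -
  have y: "y (3 * h + q) = - l" "y (3 * h - q) = - l" if "q \<in> {0..m}" for q
    using that m by (auto simp: y_def R_initial h_def)
  have "norm ((P m (3 * h) + 2 * sin (l * m)) - (P 0 (3 * h) + 2 * sin (l * 0))) \<le> 0 * norm (m - 0)"
  proof (rule field_differentiable_bound[where f="\<lambda>m. P m (3 * h) + 2 * sin (l * m)" and S="{0..m}"])
    fix q assume q: "q \<in> {0..m}"
    have "((\<lambda>m. P m (3 * h) + 2 * sin (l * m)) has_real_derivative
       cos (l * q) * (y (3 * h + q) + y (3 * h - q)) + 2 * (cos (l * q) * l)) (at q within {0..m})"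
      by (auto intro!: derivative_eq_intros has_field_derivative_at_within[OF P_m])
    then show "((\<lambda>m. P m (3 * h) + 2 * sin (l * m)) has_field_derivative 0) (at q within {0..m})"
      by (simp add: y[OF q])
  qed (use m in auto)
  then show "P m (3 * h) = - 2 * sin (l * m)" by simp
  have "norm (Q m (3 * h) - Q 0 (3 * h)) \<le> 0 * norm (m - 0)"
  proof (rule field_differentiable_bound[where f="\<lambda>m. Q m (3 * h)" and S="{0..m}"])
    fix q assume q: "q \<in> {0..m}"
    show "((\<lambda>m. Q m (3 * h)) has_field_derivative 0) (at q within {0..m})"
      using has_field_derivative_at_within[OF Q_m, of "3 * h" q "{0..m}"] by (simp add: y[OF q])
  qed (use m in auto)
  then show "Q m (3 * h) = 0" by simp
qed

lemma \<kappa>_initial: "\<kappa> (3 * h) = ((C - 2 * S)\<^sup>2 / C + S) / (2 * l * (C - S))"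
proof -
  have "X (2 * h) = 1" by (subst X_eq) (auto simp: h_def R_initial)
  then show ?thesis
    unfolding \<kappa>_def Pp_def Qp_def using initial_window[of h] h_pos S_pos
    by (simp add: S_def[symmetric] power2_eq_square)
qed

text \<open>A primitive of \<open>tan (l * m)^2\<close>; on the initial window \<open>E\<close> is
  twice this square.\<close>

definition tan_excess where "tan_excess m = sin (l * m) / (cos (l * m) * l) - m"

lemma E_initial_integral:
  assumes e: "0 < e" "e \<le> h"
  shows "integral {e..h} (\<lambda>m. E m (3 * h)) = 2 * tan_excess h - 2 * tan_excess e"
proof (rule integral_unique, rule fundamental_theorem_of_calculus[OF e(2)])
  fix m assume "m \<in> {e..h}"
  then have m: "0 < m" "m \<le> h" using e by auto
  have s: "sin (l * m) \<noteq> 0" and c: "cos (l * m) \<noteq> 0"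
    using sin_pos[of m] cos_ge_C[of m] C_pos m by auto
  have "((\<lambda>m. 2 * tan_excess m) has_real_derivative
      2 * ((cos (l * m) * l * (cos (l * m) * l) - sin (l * m) * (- (sin (l * m) * l) * l)) / (cos (l * m) * l)\<^sup>2 - 1)) (at m)"
    unfolding tan_excess_def using c l_pos
    by (auto intro!: derivative_eq_intros simp: power2_eq_square algebra_simps)
  also have "2 * ((cos (l * m) * l * (cos (l * m) * l) - sin (l * m) * (- (sin (l * m) * l) * l)) / (cos (l * m) * l)\<^sup>2 - 1)
      = E m (3 * h)"
    unfolding E_def initial_window[OF less_imp_le[OF m(1)] m(2)] using s c l_pos
    by (simp add: field_simps power2_eq_square)
  finally show "((\<lambda>m. 2 * tan_excess m) has_vector_derivative E m (3 * h)) (at m within {e..h})"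
    by (simp add: has_field_derivative_at_within flip: has_real_derivative_iff_has_vector_derivative)
qed

text \<open>The summand \<open>\<tau>\<close> is the integral of \<open>R^2\<close> over
  \<open>{0..\<tau>}\<close>, before the Lyapunov identity starts. The closed form is a half-angle
  computation: \<open>1 + sin (l * \<tau>) = (C + S)^2\<close> and
  \<open>cos (l * \<tau>) = (C - S) * (C + S)\<close>.\<close>

lemma total_initial: "\<kappa> (3 * h) + 2 * tan_excess h + \<tau> = sigma_I_sq \<tau> l"
proof -
  have t: "\<tau> = 2 * h" by (simp add: h_def)
  have CS: "C\<^sup>2 + S\<^sup>2 = 1" by (simp add: C_def S_def)
  have sn: "sin (l * \<tau>) = 2 * S * C" and cs: "cos (l * \<tau>) = C\<^sup>2 - S\<^sup>2"
    using sin_double[of "l * h"] cos_double[of "l * h"] by (simp_all add: C_def S_def t mult_ac)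
  have nz: "C \<noteq> 0" "l \<noteq> 0" "C - S \<noteq> 0" "C + S \<noteq> 0" using C_pos S_pos l_pos C_gt_S by auto
  have "sigma_I_sq \<tau> l = (C + S)\<^sup>2 / (2 * l * ((C - S) * (C + S)))"
    unfolding sigma_I_sq_def sn cs CS[symmetric] by (simp add: power2_eq_square algebra_simps)
  also have "\<dots> = (C + S) / (2 * l * (C - S))" using nz by (simp add: power2_eq_square)
  also have "\<dots> = ((C - 2 * S)\<^sup>2 / C + S) / (2 * l * (C - S)) + 2 * (S / (C * l))"
  proof -
    have "((C - 2 * S)\<^sup>2 / C + S) / (2 * l * (C - S)) + 2 * (S / (C * l))
       = ((C - 2 * S)\<^sup>2 + S * C + 4 * S * (C - S)) / (C * (2 * l * (C - S)))"
      using nz by (simp add: divide_simps)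
    also have "(C - 2 * S)\<^sup>2 + S * C + 4 * S * (C - S) = C * (C + S)"
      by (simp add: power2_eq_square algebra_simps)
    finally show ?thesis using nz by simp
  qed
  finally show ?thesis
    by (simp add: \<kappa>_initial tan_excess_def C_def[symmetric] S_def[symmetric] t)
qed

lemma tan_excess_tendsto: "(tan_excess \<longlongrightarrow> 0) (at_right 0)"
proof -
  have "(tan_excess \<longlongrightarrow> sin (l * 0) / (cos (l * 0) * l) - 0) (at_right 0)"
    unfolding tan_excess_def using l_pos by (intro tendsto_intros) auto
  then show ?thesis by simp
qed

lemma \<kappa>_nonneg: "\<kappa> t \<ge> 0"
  using C_pos S_pos l_pos C_gt_S by (simp add: \<kappa>_def)

text \<open>The Lyapunov identity between \<open>3 h\<close> and \<open>T\<close>, integrating over \<open>m \<in> [e, h]\<close> because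
  \<open>Q / sin (l m)\<close> is singular at \<open>m = 0\<close>; the boundary term at \<open>e\<close> vanishes as \<open>e \<rightarrow> 0\<close>.\<close>

lemma energy_identity:
  assumes T: "T \<ge> 3 * h" and B: "\<And>u. u \<in> {T - h..T + h} \<Longrightarrow> \<bar>y u\<bar> \<le> B"
  shows "sigma_I_sq \<tau> l - \<kappa> T - integral {0..T - h} (\<lambda>s. (R s)\<^sup>2) \<in> {0..h * (2 * h\<^sup>2 * (1 / C\<^sup>2 + 1) * B\<^sup>2)}"
proof -
  define J where "J = integral {3 * h..T} (\<lambda>t. (R (t - h))\<^sup>2)"
  \<comment> \<open>\<open>B0\<close> covers all windows with centre between \<open>3 * h\<close>
    and \<open>T\<close> and controls the accumulated inner flux through \<open>c\<close>; the
    hypothesis \<open>B\<close> sees only the final window, as the limit in \<open>T\<close>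
    demands.\<close>
  obtain B0 where B0: "\<And>u. u \<in> {2 * h..T + h} \<Longrightarrow> \<bar>y u\<bar> \<le> B0"
    using y_bounded by blast
  define c where "c = 4 * B0\<^sup>2 / C * (T - 3 * h)"
  define D where "D = h * (2 * h\<^sup>2 * (1 / C\<^sup>2 + 1) * B\<^sup>2)"
  have D0: "D \<ge> 0" using h_pos by (simp add: D_def)
  define L where "L = \<kappa> (3 * h) + 2 * tan_excess h - \<kappa> T - J"
  have key: "L - 2 * tan_excess e + c * e\<^sup>2 \<ge> 0 \<and> L - 2 * tan_excess e - c * e\<^sup>2 \<le> D" if e: "0 < e" "e < h" for e
  proof -
    have "((\<lambda>t. - (R (t - h))\<^sup>2 - W e t) has_integral
      ((\<kappa> T + integral {e..h} (\<lambda>m. E m T)) - (\<kappa> (3 * h) + integral {e..h} (\<lambda>m. E m (3 * h))))) {3 * h..T}"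
    proof (rule fundamental_theorem_of_calculus[OF T])
      fix t assume t: "t \<in> {3 * h..T}"
      have "((\<lambda>t. \<kappa> t + integral {e..h} (\<lambda>m. E m t)) has_real_derivative
         - (R (t - h))\<^sup>2 - W h t + (W h t - W e t)) (at t)"
        using t e by (intro DERIV_add \<kappa>_t E_int_t) auto
      then show "((\<lambda>t. \<kappa> t + integral {e..h} (\<lambda>m. E m t)) has_vector_derivative
         - (R (t - h))\<^sup>2 - W e t) (at t within {3 * h..T})"
        by (simp add: has_field_derivative_at_within flip: has_real_derivative_iff_has_vector_derivative)
    qed
    note V = this
    have Wint: "W e integrable_on {3 * h..T}"
      unfolding W_def[abs_def] P_def Q_def
      by (intro integrable_continuous_interval continuous_intros)
         (use sin_pos[of e] cos_ge_C[of e] C_pos e in auto)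
    have "((\<lambda>t. (R (t - h))\<^sup>2) has_integral J) {3 * h..T}"
      unfolding J_def
      by (intro integrable_integral integrable_continuous_interval continuous_intros)
    then have "((\<lambda>t. - (R (t - h))\<^sup>2 - W e t) has_integral (- J - integral {3 * h..T} (W e))) {3 * h..T}"
      by (intro has_integral_diff has_integral_neg integrable_integral Wint)
    from has_integral_unique[OF V this] E_initial_integral[OF e(1) less_imp_le[OF e(2)]]
    have eq: "\<kappa> T + integral {e..h} (\<lambda>m. E m T) - (\<kappa> (3 * h) + (2 * tan_excess h - 2 * tan_excess e))
        = - J - integral {3 * h..T} (W e)"
      by simp
    have Ec: "continuous_on {e..h} (\<lambda>m. E m T)"
    proof -
      have "sin (l * m) \<noteq> 0" "cos (l * m) \<noteq> 0" if "m \<in> {e..h}" for m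
        using sin_pos[of m] cos_ge_C[of m] C_pos that e by auto
      then show ?thesis
        unfolding E_def P_def Q_def by (intro continuous_intros) auto
    qed
    have "norm (integral {3 * h..T} (W e)) \<le> (4 * B0\<^sup>2 / C * e\<^sup>2) * (T - 3 * h)"
    proof (rule integral_bound[OF T])
      show "continuous_on {3 * h..T} (W e)"
        unfolding W_def[abs_def] P_def Q_def
        by (intro continuous_intros) (use sin_pos[of e] cos_ge_C[of e] C_pos e in auto)
      show "norm (W e t) \<le> 4 * B0\<^sup>2 / C * e\<^sup>2" if "t \<in> {3 * h..T}" for t
        unfolding real_norm_def by (rule W_bound) (use e that B0 in auto)
    qed
    then have Wb: "\<bar>integral {3 * h..T} (W e)\<bar> \<le> c * e\<^sup>2" by (simp add: c_def mult_ac)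
    have E0: "integral {e..h} (\<lambda>m. E m T) \<ge> 0"
      by (intro Henstock_Kurzweil_Integration.integral_nonneg integrable_continuous_interval Ec E_nonneg)
    have "norm (integral {e..h} (\<lambda>m. E m T)) \<le> (2 * h\<^sup>2 * (1 / C\<^sup>2 + 1) * B\<^sup>2) * (h - e)"
    proof (rule integral_bound[OF less_imp_le[OF e(2)] Ec])
      show "norm (E m T) \<le> 2 * h\<^sup>2 * (1 / C\<^sup>2 + 1) * B\<^sup>2" if "m \<in> {e..h}" for m
        using E_bound[OF _ _ B, of m] E_nonneg[of m T] that e by simp
    qed
    also have "\<dots> \<le> (2 * h\<^sup>2 * (1 / C\<^sup>2 + 1) * B\<^sup>2) * h"
      using e by (intro mult_left_mono) auto
    finally have "integral {e..h} (\<lambda>m. E m T) \<le> D" using E0 by (simp add: D_def mult_ac)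
    with E0 Wb eq show ?thesis unfolding L_def by linarith
  qed
  have ev: "\<forall>\<^sub>F e in at_right 0. 0 < e \<and> e < h"
    using eventually_at_right[of 0 h] h_pos by (auto simp: eventually_at_right_field)
  have l1: "((\<lambda>e. L - 2 * tan_excess e + c * e\<^sup>2) \<longlongrightarrow> L - 2 * 0 + c * 0\<^sup>2) (at_right 0)"
    and l2: "((\<lambda>e. L - 2 * tan_excess e - c * e\<^sup>2) \<longlongrightarrow> L - 2 * 0 - c * 0\<^sup>2) (at_right 0)"
    by (intro tendsto_intros tan_excess_tendsto)+
  have "L - 2 * 0 + c * 0\<^sup>2 \<ge> 0"
    by (rule tendsto_lowerbound[OF l1]) (use ev key in \<open>auto elim!: eventually_mono\<close>)
  moreover have "L - 2 * 0 - c * 0\<^sup>2 \<le> D"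
    by (rule tendsto_upperbound[OF l2]) (use ev key in \<open>auto elim!: eventually_mono\<close>)
  moreover have "L = sigma_I_sq \<tau> l - \<kappa> T - integral {0..T - h} (\<lambda>s. (R s)\<^sup>2)"
  proof -
    have "J = integral {\<tau>..T - h} (\<lambda>s. (R s)\<^sup>2)"
      unfolding J_def using integral_shift[of "3 * h" "-h" T "\<lambda>s. (R s)\<^sup>2"]
      by (simp add: o_def h_def continuous_intros)
    moreover have "integral {0..\<tau>} (\<lambda>s. (R s)\<^sup>2) + integral {\<tau>..T - h} (\<lambda>s. (R s)\<^sup>2)
        = integral {0..T - h} (\<lambda>s. (R s)\<^sup>2)"
      by (intro Henstock_Kurzweil_Integration.integral_combine integrable_continuous_interval continuous_intros)
        (use T tau in \<open>auto simp: h_def\<close>)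
    moreover have "integral {0..\<tau>} (\<lambda>s. (R s)\<^sup>2) = integral {0..\<tau>} (\<lambda>s. 1)"
      by (intro integral_cong) (simp add: R_initial)
    ultimately show ?thesis using total_initial tau by (simp add: L_def)
  qed
  ultimately show ?thesis by (simp add: D_def)
qed

text \<open>The lower half of the energy identity together with \<open>\<kappa> \<ge> 0\<close>
  bounds all square integrals by \<open>sigma_I_sq \<tau> l\<close>.\<close>

lemma R_tendsto: "(R \<longlongrightarrow> 0) at_top"
proof (rule square_integrable_imp_tendsto_0)
  fix T :: real assume T: "T \<ge> 0"
  define T' where "T' = T + 3 * h"
  obtain B where B: "\<And>u. u \<in> {T' - h..T' + h} \<Longrightarrow> \<bar>y u\<bar> \<le> B"
    using y_bounded by blast
  have "integral {0..T} (\<lambda>s. (R s)\<^sup>2) \<le> integral {0..T' - h} (\<lambda>s. (R s)\<^sup>2)"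
    using h_pos T by (intro integral_subset_le integrable_continuous_interval continuous_intros)
      (auto simp: T'_def)
  also have "\<dots> \<le> sigma_I_sq \<tau> l"
  proof -
    have "T' \<ge> 3 * h" using T by (simp add: T'_def)
    from energy_identity[OF this B] \<kappa>_nonneg[of T'] show ?thesis by simp
  qed
  finally show "integral {0..T} (\<lambda>s. (R s)\<^sup>2) \<le> sigma_I_sq \<tau> l" .
qed

lemma R_square_integral: "((\<lambda>T. integral {0..T} (\<lambda>s. (R s)\<^sup>2)) \<longlongrightarrow> sigma_I_sq \<tau> l) at_top"
proof -
  \<comment> \<open>The supremum over the moving window is the bound \<open>B\<close> for the energy
    identity, now depending on \<open>T\<close> and tending to \<open>0\<close>.\<close>
  define r where "r = (\<lambda>t. SUP u\<in>{t - h..t + h}. \<bar>y u\<bar>)"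
  have bdd: "bdd_above ((\<lambda>u. \<bar>y u\<bar>) ` {t - h..t + h})" for t
    by (intro bounded_imp_bdd_above compact_imp_bounded compact_continuous_image continuous_intros) auto
  have r: "\<bar>y u\<bar> \<le> r t" if "u \<in> {t - h..t + h}" for u t
    unfolding r_def by (rule cSUP_upper[OF that bdd])
  have ne: "{t - h..t + h} \<noteq> {}" for t using h_pos by simp
  have y0: "(y \<longlongrightarrow> 0) at_top"
  proof -
    have "filterlim (\<lambda>u. u - \<tau>) at_top at_top"
      using filterlim_tendsto_add_at_top[OF tendsto_const[of "-\<tau>"] filterlim_ident] by simp
    then have "((\<lambda>u. - l * R (u - \<tau>)) \<longlongrightarrow> - l * 0) at_top"
      by (intro tendsto_intros filterlim_compose[OF R_tendsto])
    then show ?thesis by (simp add: y_def)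
  qed
  have r_lim: "(r \<longlongrightarrow> 0) at_top"
  proof (rule tendstoI)
    fix e :: real assume e: "e > 0"
    then have "\<forall>\<^sub>F u in at_top. dist (y u) 0 < e / 2"
      using y0 tendstoD half_gt_zero by blast
    then obtain N where N: "\<And>u. u \<ge> N \<Longrightarrow> \<bar>y u\<bar> < e / 2" by (auto simp: eventually_at_top_linorder)
    show "\<forall>\<^sub>F t in at_top. dist (r t) 0 < e"
      using eventually_ge_at_top[of "N + h"]
    proof eventually_elim
      case (elim t)
      have "r t \<le> e / 2"
        unfolding r_def by (rule cSUP_least[OF ne]) (use N elim in \<open>auto intro!: less_imp_le\<close>)
      moreover have "0 \<le> r t" using r[of t t] h_pos by auto
      ultimately show ?case using e by simp
    qed
  qed
  have sh: "filterlim (\<lambda>t. t - h) at_top at_top"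
    using filterlim_tendsto_add_at_top[OF tendsto_const[of "-h"] filterlim_ident] by simp
  have X0: "((\<lambda>t. X (t - h)) \<longlongrightarrow> 0) at_top"
  proof (rule Lim_transform_eventually[OF filterlim_compose[OF R_tendsto sh]])
    show "\<forall>\<^sub>F t in at_top. R (t - h) = X (t - h)"
      using eventually_ge_at_top[of "3 * h"] by eventually_elim (simp add: X_eq h_def)
  qed
  have r_lim': "((\<lambda>t. 2 * r t * h) \<longlongrightarrow> 2 * 0 * h) at_top" by (intro tendsto_intros r_lim)
  have P0: "((\<lambda>t. P h t) \<longlongrightarrow> 0) at_top"
    by (rule Lim_null_comparison[OF _ r_lim'[simplified]])
      (use P_bound[OF less_imp_le[OF h_pos] order_refl r] in simp)
  have r_lim'': "((\<lambda>t. 2 * r t * h * sin (l * h)) \<longlongrightarrow> 2 * 0 * h * sin (l * h)) at_top"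
    by (intro tendsto_intros r_lim)
  have Q0: "((\<lambda>t. Q h t) \<longlongrightarrow> 0) at_top"
    by (rule Lim_null_comparison[OF _ r_lim''[simplified]])
      (use Q_bound[OF less_imp_le[OF h_pos] order_refl r] in simp)
  have "(\<kappa> \<longlongrightarrow> ((0 + C * 0)\<^sup>2 / C + (0 - S * 0)\<^sup>2 / S) / (2 * l * (C - S))) at_top"
    unfolding \<kappa>_def[abs_def] Pp_def Qp_def using C_pos S_pos l_pos C_gt_S
    by (intro tendsto_intros P0 Q0 X0) auto
  then have k0: "(\<kappa> \<longlongrightarrow> 0) at_top" by simp
  define D where "D = h * (2 * h\<^sup>2 * (1 / C\<^sup>2 + 1))"
  have up: "((\<lambda>T. D * (r T)\<^sup>2 + \<kappa> T) \<longlongrightarrow> D * 0\<^sup>2 + 0) at_top"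
    by (intro tendsto_intros r_lim k0)
  have "((\<lambda>T. sigma_I_sq \<tau> l - integral {0..T - h} (\<lambda>s. (R s)\<^sup>2)) \<longlongrightarrow> 0) at_top"
  proof (rule Lim_null_comparison[OF _ up[simplified]])
    show "\<forall>\<^sub>F T in at_top. norm (sigma_I_sq \<tau> l - integral {0..T - h} (\<lambda>s. (R s)\<^sup>2)) \<le> D * (r T)\<^sup>2 + \<kappa> T"
      using eventually_ge_at_top[of "3 * h"]
    proof eventually_elim
      case (elim T)
      show ?case using energy_identity[OF elim r[of _ T]] \<kappa>_nonneg[of T] by (auto simp: D_def mult_ac)
    qed
  qed
  then have "((\<lambda>T. integral {0..T - h} (\<lambda>s. (R s)\<^sup>2)) \<longlongrightarrow> sigma_I_sq \<tau> l) at_top"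
    using tendsto_diff[OF tendsto_const[of "sigma_I_sq \<tau> l"], of _ 0 at_top] by fastforce
  moreover have "filterlim (\<lambda>t. t + h) at_top at_top"
    using filterlim_tendsto_add_at_top[OF tendsto_const[of h] filterlim_ident] by (simp add: add.commute)
  ultimately have "((\<lambda>T. integral {0..(T + h) - h} (\<lambda>s. (R s)\<^sup>2)) \<longlongrightarrow> sigma_I_sq \<tau> l) at_top"
    by (rule filterlim_compose)
  then show ?thesis by simp
qed

end

theorem (in fundamental_solution) stable_limits:
  assumes "l \<in> {0<..<pi / (2 * \<tau>)}"
  shows "(R \<longlongrightarrow> 0) at_top"
    and "((\<lambda>T. integral {0..T} (\<lambda>s. (R s)\<^sup>2)) \<longlongrightarrow> sigma_I_sq \<tau> l) at_top"
proof -
  define y where "y = (\<lambda>u. - l * R (u - \<tau>))"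
  have yc: "continuous_on UNIV y" unfolding y_def by (intro continuous_intros)
  have prim: "\<exists>F. \<forall>u. (F has_real_derivative f u) (at u)" if "continuous_on UNIV f" for f :: "real \<Rightarrow> real"
    using continuous_primitive[OF that] by (metis has_real_derivative_iff_has_vector_derivative)
  obtain Yc where Yc: "\<And>u. (Yc has_real_derivative cos (l * u) * y u) (at u)"
  proof -
    have "continuous_on UNIV (\<lambda>u. cos (l * u) * y u)" by (intro continuous_intros yc)
    from prim[OF this] that show thesis by blast
  qed
  obtain Ys where Ys: "\<And>u. (Ys has_real_derivative sin (l * u) * y u) (at u)"
  proof -
    have "continuous_on UNIV (\<lambda>u. sin (l * u) * y u)" by (intro continuous_intros yc)
    from prim[OF this] that show thesis by blast
  qed
  obtain F where F: "\<And>x. (F has_vector_derivative R x) (at x)"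
    and FI: "\<And>a b. a \<le> b \<Longrightarrow> integral {a..b} R = F b - F a"
    using continuous_primitive[OF cont] by blast
  \<comment> \<open>\<open>X\<close> continues the formula for \<open>R\<close> below
    \<open>\<tau>\<close>, so it is differentiable also at \<open>\<tau>\<close>.\<close>
  define X where "X = (\<lambda>t. 1 - l * (F (t - \<tau>) - F 0))"
  have X: "(X has_real_derivative y u) (at u)" for u
    unfolding X_def y_def by (auto intro!: derivative_eq_intros primitive_field_derivative[OF F])
  have XR: "X u = R u" if "u \<ge> \<tau>" for u
    using R_eq[OF that] FI[of 0 "u - \<tau>"] that by (simp add: X_def)
  interpret stable_fundamental_solution \<tau> l R y Yc Ys X "\<tau> / 2" "cos (l * (\<tau> / 2))" "sin (l * (\<tau> / 2))"
    by (standard; (rule assms Yc Ys X XR y_def refl)?)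
  show "(R \<longlongrightarrow> 0) at_top" "((\<lambda>T. integral {0..T} (\<lambda>s. (R s)\<^sup>2)) \<longlongrightarrow> sigma_I_sq \<tau> l) at_top"
    by (rule R_tendsto R_square_integral)+
qed

section \<open>Free and forced response\<close>

context fundamental_solution
begin

text \<open>The fundamental solution with its jump at \<open>0\<close>.\<close>

definition causal_kernel :: "real \<Rightarrow> real" where "causal_kernel u = (if 0 \<le> u then R u else 0)"

text \<open>The \<open>min\<close> is needed for \<open>t < \<tau>\<close>: by then only the history
  up to \<open>t - \<tau>\<close> has acted.\<close>

definition free_response :: "(real \<Rightarrow> real) \<Rightarrow> real \<Rightarrow> real" where
  "free_response z t = R t * z 0 - l * integral {-\<tau>..min 0 (t - \<tau>)} (\<lambda>s. R (t - \<tau> - s) * z s)"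

definition forced_response :: "(real \<Rightarrow> real) \<Rightarrow> real \<Rightarrow> real" where
  "forced_response B t = B t - l * integral {0..t - \<tau>} (\<lambda>s. R (t - \<tau> - s) * B s)"

text \<open>A Riemann sum for the Wiener integral of \<open>causal_kernel (t - s)\<close> against
  \<open>B\<close>, with mesh \<open>1 / n\<close>. The kernel is taken at the right end of each
  cell, where the step path jumps. It vanishes beyond \<open>t\<close>, so any
  \<open>N \<ge> t\<close> will do, and one \<open>N\<close> can serve several times at
  once.\<close>

definition discrete_response :: "nat \<Rightarrow> nat \<Rightarrow> (real \<Rightarrow> real) \<Rightarrow> real \<Rightarrow> real" where
  "discrete_response N n B t =
     (\<Sum>k<N * n. causal_kernel (t - real (Suc k) / real n) * (B (real (Suc k) / real n) - B (real k / real n)))"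

lemma R_abs_bounded: obtains M where "\<And>u. u \<in> {a..b} \<Longrightarrow> \<bar>R u\<bar> \<le> M" "M > 0"
proof -
  have "compact (R ` {a..b})"
    by (intro compact_continuous_image cont_on) simp
  then obtain B where "\<forall>x\<in>R ` {a..b}. norm x \<le> B"
    using compact_imp_bounded bounded_iff by metis
  then show thesis by (intro that[of "max B 1"]) (auto simp: le_max_iff_disj)
qed

lemma free_response_tendsto_0:
  assumes R0: "(R \<longlongrightarrow> 0) at_top" and z: "continuous_on {-\<tau>..0} z"
  shows "(free_response z \<longlongrightarrow> 0) at_top"
proof -
  have "compact (z ` {-\<tau>..0})"
    by (intro compact_continuous_image z) simp
  then obtain Z where Z: "\<And>x. x \<in> {-\<tau>..0} \<Longrightarrow> \<bar>z x\<bar> \<le> Z"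
    using compact_imp_bounded bounded_iff by (metis image_eqI real_norm_def)
  have Z0: "Z \<ge> 0" using Z[of 0] tau by auto
  \<comment> \<open>The summand \<open>1\<close> makes \<open>D\<close> positive and the final
    estimate strict.\<close>
  define D where "D = Z + \<bar>l\<bar> * \<tau> * Z + 1"
  have D: "D > 0" using Z0 tau by (simp add: D_def add_nonneg_pos)
  show ?thesis
  proof (rule tendstoI)
    fix e :: real assume e: "e > 0"
    then have "\<forall>\<^sub>F t in at_top. dist (R t) 0 < e / D"
      using R0 D tendstoD[of R 0 at_top "e / D"] by simp
    then obtain T where T: "\<And>t. t \<ge> T \<Longrightarrow> \<bar>R t\<bar> < e / D" by (auto simp: eventually_at_top_linorder)
    show "\<forall>\<^sub>F t in at_top. dist (free_response z t) 0 < e"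
      using eventually_ge_at_top[of "\<bar>T\<bar> + \<tau>"]
    proof eventually_elim
      case (elim t)
      have m: "min 0 (t - \<tau>) = 0" using elim by simp
      have "norm (integral {-\<tau>..0} (\<lambda>s. R (t - \<tau> - s) * z s)) \<le> (e / D * Z) * (0 - (-\<tau>))"
      proof (rule integral_bound)
        show "continuous_on {-\<tau>..0} (\<lambda>s. R (t - \<tau> - s) * z s)"
          by (intro continuous_intros z)
        fix s assume s: "s \<in> {-\<tau>..0}"
        have "\<bar>R (t - \<tau> - s)\<bar> \<le> e / D" using T[of "t - \<tau> - s"] elim s by force
        then show "norm (R (t - \<tau> - s) * z s) \<le> e / D * Z"
          unfolding real_norm_def abs_mult using Z[OF s] e D by (intro mult_mono) auto
      qed (use tau in simp)
      then have "\<bar>l\<bar> * \<bar>integral {-\<tau>..0} (\<lambda>s. R (t - \<tau> - s) * z s)\<bar> \<le> \<bar>l\<bar> * (e / D * Z * \<tau>)"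
        by (intro mult_left_mono) auto
      moreover have "\<bar>R t\<bar> * \<bar>z 0\<bar> \<le> e / D * Z"
      proof (intro mult_mono)
        have "\<bar>R t\<bar> < e / D" using elim tau by (intro T) linarith
        then show "\<bar>R t\<bar> \<le> e / D" by simp
      qed (use Z[of 0] tau e D in auto)
      ultimately have "\<bar>free_response z t\<bar> \<le> e / D * Z + \<bar>l\<bar> * (e / D * Z * \<tau>)"
        unfolding free_response_def m
        by (intro order_trans[OF abs_triangle_ineq4]) (simp add: abs_mult)
      also have "\<dots> = e / D * (Z + \<bar>l\<bar> * \<tau> * Z)"
        by (simp only: distrib_left mult_ac)
      also have "\<dots> = e / D * (D - 1)" by (simp add: D_def)
      also have "\<dots> < e" using e D by (simp add: field_simps)
      finally show ?case by simp
    qed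
  qed
qed

text \<open>This is the integral equation of \<open>R\<close>, reflected in time: the forced
  response to a unit step at \<open>\<sigma>\<close> is
  \<open>causal_kernel (t - \<sigma>)\<close>.\<close>

lemma causal_kernel_step_integral:
  assumes s: "\<sigma> \<ge> 0" and t: "t \<ge> 0" and l: "l \<noteq> 0"
  shows "((\<lambda>s. R (t - \<tau> - s) * (if \<sigma> \<le> s then 1 else 0)) has_integral
      ((if \<sigma> \<le> t then 1 else 0) - causal_kernel (t - \<sigma>)) / l) {0..t - \<tau>}"
proof -
  let ?b = "t - \<tau>"
  have eq: "(\<lambda>s. R (?b - s) * (if \<sigma> \<le> s then 1 else 0)) = (\<lambda>s. if s \<in> {\<sigma>..} then R (?b - s) else 0)"
    by auto
  have int: "(\<lambda>s. R (?b - s)) integrable_on {a..b}" for a b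
    by (intro integrable_continuous_interval continuous_intros)
  have S: "{\<sigma>..} \<inter> {0..?b} = {\<sigma>..?b}" using s by auto
  have "((\<lambda>s. R (?b - s)) has_integral ((if \<sigma> \<le> t then 1 else 0) - causal_kernel (t - \<sigma>)) / l) {\<sigma>..?b}"
  proof (cases "\<sigma> \<le> ?b")
    case True
    have "(R has_integral integral {0..?b - \<sigma>} R) {0..?b - \<sigma>}"
      by (rule integrable_integral) (rule R_int)
    then have "((\<lambda>s. R (- s)) has_integral integral {0..?b - \<sigma>} R) {-(?b - \<sigma>)..- 0}"
      by (subst has_integral_reflect_real)
    then have "((\<lambda>s. R (- (s + - ?b))) has_integral integral {0..?b - \<sigma>} R) {-(?b - \<sigma>) - - ?b..- 0 - - ?b}"
      using has_integral_affinity'[of "\<lambda>s. R (- s)" _ "-(?b - \<sigma>)" "- 0" 1 "- ?b"] by simp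
    moreover have "(1 - R (t - \<sigma>)) / l = integral {0..?b - \<sigma>} R"
      using R_eq[of "t - \<sigma>"] True l by (simp add: field_simps)
    ultimately show ?thesis using True tau by (simp add: causal_kernel_def algebra_simps)
  next
    case False
    have "(if \<sigma> \<le> t then 1 else 0) = causal_kernel (t - \<sigma>)"
      using False R_initial[of "t - \<sigma>"] by (auto simp: causal_kernel_def)
    then show ?thesis using False by (simp add: has_integral_null)
  qed
  then show ?thesis
    unfolding eq S[symmetric] by (subst has_integral_restrict_Int)
qed

text \<open>Exactly the first \<open>\<lfloor>n s\<rfloor>\<close> cells have ended by time
  \<open>s\<close>, and their increments telescope.\<close>

lemma step_path_eq:
  assumes s: "s \<ge> 0" "s \<le> real N" and n: "n > 0" and B0: "B 0 = 0"
  shows "(\<Sum>k<N * n. (if real (Suc k) / real n \<le> s then 1 else 0) * (B (real (Suc k) / real n) - B (real k / real n)))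
     = (B (real (nat \<lfloor>real n * s\<rfloor>) / real n) :: real)"
proof -
  let ?m = "nat \<lfloor>real n * s\<rfloor>"
  have iff: "real (Suc k) / real n \<le> s \<longleftrightarrow> k < ?m" for k
  proof -
    have "real (Suc k) / real n \<le> s \<longleftrightarrow> real (Suc k) \<le> real n * s"
      using n by (simp add: pos_divide_le_eq mult.commute)
    also have "\<dots> \<longleftrightarrow> Suc k \<le> ?m" using s by (simp add: le_nat_floor le_nat_iff le_floor_iff)
    finally show ?thesis by (simp add: Suc_le_eq)
  qed
  have "real n * s \<le> real (N * n)" using s n by (simp add: mult.commute mult_left_mono)
  then have "?m \<le> N * n" by (metis floor_mono floor_of_nat nat_int nat_mono)
  then have "{..<?m} \<subseteq> {..<N * n}" by auto
  then have "(\<Sum>k<N * n. (if real (Suc k) / real n \<le> s then 1 else 0) * (B (real (Suc k) / real n) - B (real k / real n)))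
     = (\<Sum>k<?m. B (real (Suc k) / real n) - B (real k / real n))"
    unfolding iff by (intro sum.mono_neutral_cong_right) auto
  also have "\<dots> = B (real ?m / real n) - B (real 0 / real n)"
    by (rule sum_lessThan_telescope)
  finally show ?thesis using B0 by simp
qed

lemma floor_grid_dist:
  assumes "n > 0" "s \<ge> (0::real)"
  shows "\<bar>real (nat \<lfloor>real n * s\<rfloor>) / real n - s\<bar> \<le> 1 / real n" "real (nat \<lfloor>real n * s\<rfloor>) / real n \<le> s"
proof -
  have "real (nat \<lfloor>real n * s\<rfloor>) \<le> real n * s" "real n * s \<le> real (nat \<lfloor>real n * s\<rfloor>) + 1"
    using assms by (auto intro: of_nat_floor)
  then have a: "real (nat \<lfloor>real n * s\<rfloor>) / real n \<le> s" "s \<le> (real (nat \<lfloor>real n * s\<rfloor>) + 1) / real n"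
    using assms by (simp_all add: field_simps)
  then show "\<bar>real (nat \<lfloor>real n * s\<rfloor>) / real n - s\<bar> \<le> 1 / real n" "real (nat \<lfloor>real n * s\<rfloor>) / real n \<le> s"
    by (auto simp: add_divide_distrib)
qed

text \<open>The discrete response is the forced response to the piecewise constant interpolation of \<open>B\<close>.\<close>

lemma discrete_response_tendsto:
  assumes B: "continuous_on {0..} B" and B0: "B 0 = 0" and t: "t \<ge> 0" "t \<le> real N"
  shows "(\<lambda>n. discrete_response N n B t) \<longlonglongrightarrow> forced_response B t"
proof -
  define Bn where "Bn = (\<lambda>n s. B (real (nat \<lfloor>real n * s\<rfloor>) / real n))"
  obtain M where M: "\<And>u. u \<in> {0..t} \<Longrightarrow> \<bar>R u\<bar> \<le> M" "M > 0" using R_abs_bounded by blast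
  have RBn: "((\<lambda>s. R (t - \<tau> - s) * Bn n s) has_integral (Bn n t - discrete_response N n B t) / l) {0..t - \<tau>}"
    if n: "n > 0" and l: "l \<noteq> 0" for n
  proof -
    define d where "d = (\<lambda>k. B (real (Suc k) / real n) - B (real k / real n))"
    define \<sigma> where "\<sigma> = (\<lambda>k. real (Suc k) / real n)"
    have sg: "\<sigma> k \<ge> 0" for k by (simp add: \<sigma>_def)
    have "((\<lambda>s. \<Sum>k<N * n. R (t - \<tau> - s) * (if \<sigma> k \<le> s then 1 else 0) * d k) has_integral
       (\<Sum>k<N * n. ((if \<sigma> k \<le> t then 1 else 0) - causal_kernel (t - \<sigma> k)) / l * d k)) {0..t - \<tau>}"
      by (intro has_integral_sum has_integral_mult_left causal_kernel_step_integral[OF sg t(1) l]) auto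
    also have "(\<Sum>k<N * n. ((if \<sigma> k \<le> t then 1 else 0) - causal_kernel (t - \<sigma> k)) / l * d k)
      = (Bn n t - discrete_response N n B t) / l"
    proof -
      have "Bn n t = (\<Sum>k<N * n. (if \<sigma> k \<le> t then 1 else 0) * d k)"
        using step_path_eq[where B=B, OF t n B0] by (simp only: Bn_def \<sigma>_def d_def)
      moreover have dr: "discrete_response N n B t = (\<Sum>k<N * n. causal_kernel (t - \<sigma> k) * d k)"
        by (simp only: discrete_response_def \<sigma>_def d_def)
      ultimately show ?thesis
        unfolding dr by (simp add: sum_divide_distrib diff_divide_distrib left_diff_distrib sum_subtractf)
    qed
    finally show ?thesis
    proof (rule has_integral_eq[rotated])
      fix s assume s: "s \<in> {0..t - \<tau>}"
      then have "s \<ge> 0" "s \<le> real N" using t tau by auto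
      from step_path_eq[where B=B, OF this n B0]
      have e: "Bn n s = (\<Sum>k<N * n. (if \<sigma> k \<le> s then 1 else 0) * d k)"
        by (simp only: Bn_def \<sigma>_def d_def)
      show "(\<Sum>k<N * n. R (t - \<tau> - s) * (if \<sigma> k \<le> s then 1 else 0) * d k) = R (t - \<tau> - s) * Bn n s"
        unfolding e by (simp add: sum_distrib_left mult.assoc)
    qed
  qed
  have RB: "((\<lambda>s. R (t - \<tau> - s) * B s) has_integral integral {0..t - \<tau>} (\<lambda>s. R (t - \<tau> - s) * B s)) {0..t - \<tau>}"
    by (intro integrable_integral integrable_continuous_interval continuous_intros
        continuous_on_subset[OF B]) auto
  have uc: "uniformly_continuous_on {0..t} B"
    by (intro compact_uniformly_continuous continuous_on_subset[OF B]) auto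
  show ?thesis
  proof (rule LIMSEQ_I)
    fix e :: real assume e: "e > 0"
    define D where "D = 1 + \<bar>l\<bar> * (M * t)"
    have D: "D > 0" unfolding D_def using M t by (simp add: add_pos_nonneg)
    define e' where "e' = e / (2 * D)"
    have e': "e' > 0" using e D by (simp add: e'_def)
    obtain d where d: "d > 0" "\<And>x y. x \<in> {0..t} \<Longrightarrow> y \<in> {0..t} \<Longrightarrow> dist y x < d \<Longrightarrow> dist (B y) (B x) < e'"
      using uc e' unfolding uniformly_continuous_on_def by metis
    obtain n0 :: nat where n0: "n0 > 0" "1 / real n0 < d"
      using d(1) by (metis nat_approx_posE zero_less_Suc)
    show "\<exists>n0. \<forall>n\<ge>n0. norm (discrete_response N n B t - forced_response B t) < e"
    proof (intro exI allI impI)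
      fix n assume n: "n \<ge> n0"
      then have np: "n > 0" using n0 by simp
      have "1 / real n \<le> 1 / real n0" using n n0 by (simp add: frac_le)
      then have nd: "1 / real n < d" using n0 by simp
      have close: "\<bar>Bn n s - B s\<bar> \<le> e'" if "s \<in> {0..t}" for s
      proof -
        let ?x = "real (nat \<lfloor>real n * s\<rfloor>) / real n"
        have "\<bar>?x - s\<bar> \<le> 1 / real n" "?x \<le> s" using floor_grid_dist[OF np, of s] that by auto
        then have "dist ?x s < d" "?x \<in> {0..t}" using nd that by (auto simp: dist_real_def)
        then have "dist (B ?x) (B s) < e'" using d(2)[OF that] by blast
        then show ?thesis by (simp add: Bn_def dist_real_def)
      qed
      have "discrete_response N n B t - forced_response B t = (Bn n t - B t) -
          l * ((Bn n t - discrete_response N n B t) / l - integral {0..t - \<tau>} (\<lambda>s. R (t - \<tau> - s) * B s))"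
        if "l \<noteq> 0" using that by (simp add: forced_response_def right_diff_distrib diff_divide_distrib)
      moreover have "\<bar>l * ((Bn n t - discrete_response N n B t) / l - integral {0..t - \<tau>} (\<lambda>s. R (t - \<tau> - s) * B s))\<bar>
           \<le> \<bar>l\<bar> * (M * e' * t)" if "l \<noteq> 0"
      proof -
        have "((\<lambda>s. R (t - \<tau> - s) * Bn n s - R (t - \<tau> - s) * B s) has_integral
          ((Bn n t - discrete_response N n B t) / l - integral {0..t - \<tau>} (\<lambda>s. R (t - \<tau> - s) * B s))) (cbox 0 (t - \<tau>))"
          using has_integral_diff[OF RBn[OF np that] RB] by simp
        then have "norm ((Bn n t - discrete_response N n B t) / l - integral {0..t - \<tau>} (\<lambda>s. R (t - \<tau> - s) * B s))
             \<le> (M * e') * measure lborel (cbox 0 (t - \<tau>))"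
        proof (rule has_integral_bound[rotated])
          fix s assume "s \<in> cbox 0 (t - \<tau>)"
          then have s: "s \<in> {0..t}" "t - \<tau> - s \<in> {0..t}" using tau by auto
          have "\<bar>R (t - \<tau> - s)\<bar> * \<bar>Bn n s - B s\<bar> \<le> M * e'"
            using M(2) by (intro mult_mono M close s) auto
          then show "norm (R (t - \<tau> - s) * Bn n s - R (t - \<tau> - s) * B s) \<le> M * e'"
            by (simp add: abs_mult flip: right_diff_distrib)
        qed (use M e' in simp)
        also have "\<dots> \<le> M * e' * t"
          using M e' t tau by (intro mult_left_mono) (auto simp: content_real_if)
        finally show ?thesis by (simp add: abs_mult mult_left_mono)
      qed
      \<comment> \<open>\<open>RBn\<close> divides by \<open>l\<close>, so \<open>l = 0\<close> is
        separate: there \<open>R = 1\<close> and the response is the path itself.\<close>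
      moreover have "discrete_response N n B t - forced_response B t = Bn n t - B t" if "l = 0"
      proof -
        have "R u = 1" for u using that R_initial[of u] R_eq[of u] by (cases "u \<le> \<tau>") auto
        then have "causal_kernel (t - u) = (if u \<le> t then 1 else 0)" for u by (simp add: causal_kernel_def)
        then show ?thesis
          unfolding discrete_response_def forced_response_def Bn_def
          using step_path_eq[where B=B, OF t np B0] that by simp
      qed
      moreover have "\<bar>Bn n t - B t\<bar> \<le> e'" using close[of t] t by simp
      moreover have "0 \<le> \<bar>l\<bar> * (M * e' * t)" using M e' t by simp
      ultimately have "\<bar>discrete_response N n B t - forced_response B t\<bar> \<le> e' + \<bar>l\<bar> * (M * e' * t)"
        using abs_triangle_ineq4[of "Bn n t - B t"] by (cases "l = 0") (smt (verit, best))+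
      also have "\<dots> = e' * D" by (simp add: D_def algebra_simps)
      also have "\<dots> < e" using e D by (simp add: e'_def)
      finally show "norm (discrete_response N n B t - forced_response B t) < e" by simp
    qed
  qed
qed

text \<open>Each summand is compared with the increment of a primitive over its cell by the mean
  value theorem; uniform continuity bounds the error by \<open>e'\<close> times the mesh.\<close>

lemma causal_kernel_square_sum_tendsto:
  assumes t: "t \<ge> 0" "t \<le> real N"
  shows "(\<lambda>n. \<Sum>k<N * n. (causal_kernel (t - real (Suc k) / real n))\<^sup>2 / real n) \<longlonglongrightarrow> integral {0..t} (\<lambda>s. (R s)\<^sup>2)"
proof -
  obtain Q where Q: "\<And>x. (Q has_real_derivative (R x)\<^sup>2) (at x)"
    and QI: "\<And>a b. a \<le> b \<Longrightarrow> integral {a..b} (\<lambda>s. (R s)\<^sup>2) = Q b - Q a"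
    using R_sq_primitive by blast
  define F where "F = (\<lambda>s. - Q (t - s))"
  have F: "(F has_real_derivative (R (t - s))\<^sup>2) (at s)" for s
    unfolding F_def by (auto intro!: derivative_eq_intros DERIV_chain2[OF Q])
  have uc: "uniformly_continuous_on {0..t} (\<lambda>s. (R (t - s))\<^sup>2)"
    by (intro compact_uniformly_continuous continuous_intros) auto
  define m where "m = (\<lambda>n. nat \<lfloor>real n * t\<rfloor>)"
  have sum_eq: "(\<Sum>k<N * n. (causal_kernel (t - real (Suc k) / real n))\<^sup>2 / real n) = (\<Sum>k<m n. (R (t - real (Suc k) / real n))\<^sup>2 / real n)"
    if n: "n > 0" for n
  proof -
    have iff: "real (Suc k) / real n \<le> t \<longleftrightarrow> k < m n" for k
    proof -
      have "real (Suc k) / real n \<le> t \<longleftrightarrow> real (Suc k) \<le> real n * t"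
        using n by (simp add: pos_divide_le_eq mult.commute)
      also have "\<dots> \<longleftrightarrow> Suc k \<le> m n" using t by (simp add: m_def le_nat_floor le_nat_iff le_floor_iff)
      finally show ?thesis by (simp add: Suc_le_eq)
    qed
    have "real n * t \<le> real (N * n)" using t n by (simp add: mult.commute mult_left_mono)
    then have "m n \<le> N * n" unfolding m_def by (metis floor_mono floor_of_nat nat_int nat_mono)
    then have "{..<m n} \<subseteq> {..<N * n}" by auto
    then show ?thesis
      by (intro sum.mono_neutral_cong_right) (use iff in \<open>auto simp: causal_kernel_def\<close>)
  qed
  \<comment> \<open>The complete cells end at \<open>m n / n\<close>, slightly before
    \<open>t\<close>; the missing piece disappears by continuity of \<open>F\<close>.\<close>
  have lim1: "(\<lambda>n. F (real (m n) / real n) - F 0) \<longlonglongrightarrow> F t - F 0"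
  proof (intro tendsto_intros isCont_tendsto_compose[of _ F] DERIV_isCont[OF F])
    have "(\<lambda>n. real (m n) / real n - t) \<longlonglongrightarrow> 0"
      by (rule Lim_null_comparison[OF _ lim_1_over_n])
        (use floor_grid_dist[OF _ t(1)] in \<open>auto simp: m_def eventually_sequentially intro!: exI[of _ 1]\<close>)
    then show "(\<lambda>n. real (m n) / real n) \<longlonglongrightarrow> t" by (simp add: LIM_zero_iff)
  qed
  have lim2: "(\<lambda>n. (\<Sum>k<N * n. (causal_kernel (t - real (Suc k) / real n))\<^sup>2 / real n) - (F (real (m n) / real n) - F 0)) \<longlonglongrightarrow> 0"
  proof (rule LIMSEQ_I)
    fix e :: real assume e: "e > 0"
    define e' where "e' = e / (t + 1)"
    have e': "e' > 0" using e t by (simp add: e'_def)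
    obtain d where d: "d > 0" "\<And>x y. x \<in> {0..t} \<Longrightarrow> y \<in> {0..t} \<Longrightarrow> dist y x < d \<Longrightarrow> dist ((R (t - y))\<^sup>2) ((R (t - x))\<^sup>2) < e'"
      using uc e' unfolding uniformly_continuous_on_def by metis
    obtain n0 :: nat where n0: "n0 > 0" "1 / real n0 < d"
      using d(1) by (metis nat_approx_posE zero_less_Suc)
    show "\<exists>n0. \<forall>n\<ge>n0. norm ((\<Sum>k<N * n. (causal_kernel (t - real (Suc k) / real n))\<^sup>2 / real n) - (F (real (m n) / real n) - F 0) - 0) < e"
    proof (intro exI allI impI)
      fix n assume n: "n \<ge> n0"
      then have np: "n > 0" using n0 by simp
      have "1 / real n \<le> 1 / real n0" using n n0 by (simp add: frac_le)
      then have nd: "1 / real n < d" using n0 by simp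
      have mt: "real (m n) / real n \<le> t" using floor_grid_dist(2)[OF np t(1)] by (simp add: m_def)
      have step: "\<bar>(R (t - real (Suc k) / real n))\<^sup>2 / real n - (F (real (Suc k) / real n) - F (real k / real n))\<bar> \<le> e' / real n"
        if k: "k < m n" for k
      proof -
        have lt: "real k / real n < real (Suc k) / real n" using np by (simp add: divide_strict_right_mono)
        obtain x where x: "real k / real n < x" "x < real (Suc k) / real n"
          "F (real (Suc k) / real n) - F (real k / real n) = (real (Suc k) / real n - real k / real n) * (R (t - x))\<^sup>2"
          using MVT2[OF lt F] by blast
        have st: "real (Suc k) / real n - real k / real n = 1 / real n" by (simp add: add_divide_distrib)
        have "real (Suc k) / real n \<le> real (m n) / real n" using k by (intro divide_right_mono) auto
        with mt have le: "real (Suc k) / real n \<le> t" by simp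
        have x0: "0 \<le> x" using x(1) by (meson divide_nonneg_nonneg less_eq_real_def of_nat_0_le_iff order_trans)
        have "dist ((R (t - real (Suc k) / real n))\<^sup>2) ((R (t - x))\<^sup>2) < e'"
          by (rule d(2)) (use x x0 le st nd in \<open>auto simp: dist_real_def\<close>)
        then have "\<bar>(R (t - real (Suc k) / real n))\<^sup>2 - (R (t - x))\<^sup>2\<bar> / real n \<le> e' / real n"
          by (intro divide_right_mono) (auto simp: dist_real_def)
        then show ?thesis unfolding x(3) st by (simp add: diff_divide_distrib[symmetric] abs_divide)
      qed
      have "F (real (m n) / real n) - F 0 = (\<Sum>k<m n. F (real (Suc k) / real n) - F (real k / real n))"
        using sum_lessThan_telescope[of "\<lambda>k. F (real k / real n)" "m n"] by simp
      then have "norm ((\<Sum>k<N * n. (causal_kernel (t - real (Suc k) / real n))\<^sup>2 / real n) - (F (real (m n) / real n) - F 0) - 0)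
         = \<bar>\<Sum>k<m n. (R (t - real (Suc k) / real n))\<^sup>2 / real n - (F (real (Suc k) / real n) - F (real k / real n))\<bar>"
        unfolding sum_eq[OF np] by (simp add: sum_subtractf)
      also have "\<dots> \<le> (\<Sum>k<m n. e' / real n)"
        by (intro order_trans[OF sum_abs] sum_mono) (use step in auto)
      also have "\<dots> = e' * (real (m n) / real n)" by simp
      also have "\<dots> \<le> e' * t" using e' mt by (intro mult_left_mono) auto
      also have "\<dots> < e" using e t by (simp add: e'_def field_simps)
      finally show "norm ((\<Sum>k<N * n. (causal_kernel (t - real (Suc k) / real n))\<^sup>2 / real n) - (F (real (m n) / real n) - F 0) - 0) < e" .
    qed
  qed
  have "F t - F 0 = integral {0..t} (\<lambda>s. (R s)\<^sup>2)" using QI[of 0 t] t by (simp add: F_def)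
  with tendsto_add[OF lim2 lim1] show ?thesis by simp
qed

end

section \<open>Limits of Gaussian random variables\<close>

lemma (in prob_space) char_distr_eq:
  assumes "X \<in> borel_measurable M"
  shows "char (distr M borel X) u = (\<integral>\<omega>. iexp (u * X \<omega>) \<partial>M)"
  using assms by (simp add: char_def integral_distr)

lemma (in prob_space) char_normal:
  assumes D: "distributed M lborel X (normal_density 0 \<sigma>)" and s: "\<sigma> > 0"
  shows "char (distr M borel (\<lambda>\<omega>. c * X \<omega>)) u = complex_of_real (exp (- (u\<^sup>2 * (c\<^sup>2 * \<sigma>\<^sup>2) / 2)))"
proof -
  have std: "distributed M lborel (\<lambda>\<omega>. X \<omega> / \<sigma>) std_normal_density"
    using normal_standard_normal_convert[OF s, of X 0] D by simp
  have X: "X \<in> borel_measurable M" using distributed_measurable[OF D] by simp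
  have "distr M borel (\<lambda>\<omega>. X \<omega> / \<sigma>) = distr M lborel (\<lambda>\<omega>. X \<omega> / \<sigma>)"
    by (rule distr_cong) auto
  also have "\<dots> = std_normal_distribution" using distributed_distr_eq_density[OF std] by simp
  finally have "char (distr M borel (\<lambda>\<omega>. X \<omega> / \<sigma>)) (u * c * \<sigma>) = complex_of_real (exp (- ((u * c * \<sigma>)\<^sup>2) / 2))"
    by (simp add: char_std_normal_distribution)
  moreover have "char (distr M borel (\<lambda>\<omega>. X \<omega> / \<sigma>)) (u * c * \<sigma>) = char (distr M borel (\<lambda>\<omega>. c * X \<omega>)) u"
    using X s by (simp add: char_distr_eq mult.assoc)
  ultimately show ?thesis by (simp add: power_mult_distrib mult_ac)
qed

text \<open>The case \<open>v = 0\<close> is a point mass without density and is recognised by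
  comparison with the constant variable.\<close>

lemma (in prob_space) normal_of_char:
  assumes X: "X \<in> borel_measurable M" and v: "v \<ge> 0"
    and ch: "\<And>u. char (distr M borel X) u = complex_of_real (exp (- (u\<^sup>2 * v / 2)))"
  shows "v > 0 \<Longrightarrow> distributed M lborel X (normal_density 0 (sqrt v))"
    and "v = 0 \<Longrightarrow> AE \<omega> in M. X \<omega> = 0"
proof -
  assume v: "v > 0"
  have "char (distr M borel (\<lambda>\<omega>. X \<omega> / sqrt v)) u = char std_normal_distribution u" for u
  proof -
    have "char (distr M borel (\<lambda>\<omega>. X \<omega> / sqrt v)) u = char (distr M borel X) (u / sqrt v)"
      using X by (simp add: char_distr_eq)
    then show ?thesis using v by (simp add: ch char_std_normal_distribution power_divide)
  qed
  then have "distr M borel (\<lambda>\<omega>. X \<omega> / sqrt v) = std_normal_distribution"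
    using X by (intro Levy_uniqueness real_dist_normal_dist real_distribution_distr) auto
  moreover have "distr M borel (\<lambda>\<omega>. X \<omega> / sqrt v) = distr M lborel (\<lambda>\<omega>. X \<omega> / sqrt v)"
    by (rule distr_cong) auto
  ultimately have "distributed M lborel (\<lambda>\<omega>. X \<omega> / sqrt v) std_normal_density"
    using X by (simp add: distributed_def)
  then show "distributed M lborel X (normal_density 0 (sqrt v))"
    using normal_standard_normal_convert[of "sqrt v" X 0] v by simp
next
  assume v: "v = 0"
  have "distr M borel X = distr M borel (\<lambda>_. 0)"
  proof (rule Levy_uniqueness)
    show "char (distr M borel X) = char (distr M borel (\<lambda>_. 0))"
      by (rule ext) (simp add: ch v char_distr_eq prob_space del: distr_const)
  qed (use X in \<open>auto simp del: distr_const\<close>)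
  then have eq: "distr M borel X = return borel 0" by simp
  have "AE x in distr M borel X. x = 0"
    unfolding eq by (subst AE_return) auto
  then show "AE \<omega> in M. X \<omega> = 0" using X by (simp add: AE_distr_iff)
qed

lemma (in prob_space) gaussian_of_char:
  assumes X: "X \<in> borel_measurable M" and v: "v \<ge> 0"
    and ch: "\<And>u. char (distr M borel X) u = complex_of_real (exp (- (u\<^sup>2 * v / 2)))"
    and Y: "Y \<in> borel_measurable M" and YX: "AE \<omega> in M. Y \<omega> = d + X \<omega>"
  shows "gaussian_rv M Y" and "integrable M (\<lambda>\<omega>. (Y \<omega>)\<^sup>2)" and "(\<integral>\<omega>. (Y \<omega>)\<^sup>2 \<partial>M) = d\<^sup>2 + v"
proof -
  have "gaussian_rv M Y \<and> integrable M (\<lambda>\<omega>. (Y \<omega>)\<^sup>2) \<and> (\<integral>\<omega>. (Y \<omega>)\<^sup>2 \<partial>M) = d\<^sup>2 + v"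
  proof (cases "v = 0")
    case True
    then have Yd: "AE \<omega> in M. Y \<omega> = d" using normal_of_char(2)[OF X v ch] YX by auto
    then have Y2: "AE \<omega> in M. (Y \<omega>)\<^sup>2 = d\<^sup>2" by auto
    have "integrable M (\<lambda>\<omega>. (Y \<omega>)\<^sup>2) \<longleftrightarrow> integrable M (\<lambda>\<omega>. d\<^sup>2)"
      using Y by (intro integrable_cong_AE Y2) auto
    moreover have "(\<integral>\<omega>. (Y \<omega>)\<^sup>2 \<partial>M) = (\<integral>\<omega>. d\<^sup>2 \<partial>M)"
      using Y by (intro integral_cong_AE Y2) auto
    ultimately show ?thesis using Y Yd True prob_space by (auto simp: gaussian_rv_def)
  next
    case False
    then have v: "v > 0" using v by simp
    have D: "distributed M lborel X (normal_density 0 (sqrt v))"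
      by (rule normal_of_char(1)[OF X _ ch]) (use v in auto)
    have "distributed M lborel (\<lambda>\<omega>. d + 1 * X \<omega>) (normal_density (d + 1 * 0) (\<bar>1\<bar> * sqrt v))"
      by (rule normal_density_affine[OF D]) (use v in auto)
    then have DX: "distributed M lborel (\<lambda>\<omega>. d + X \<omega>) (normal_density d (sqrt v))" by simp
    have "distr M lborel Y = distr M lborel (\<lambda>\<omega>. d + X \<omega>)"
      using X Y by (intro distr_cong_AE YX) auto
    then have DY: "distributed M lborel Y (normal_density d (sqrt v))"
      using DX Y by (simp add: distributed_def)
    have sv: "sqrt v > 0" using v by simp
    have g: "gaussian_rv M Y" using Y DY sv unfolding gaussian_rv_def by blast
    have i1: "integrable M Y"
      using integrable_normal_moment_nz_1[OF sv, of d] distributed_integrable[OF DY, of "\<lambda>x. x"] by simp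
    have i2: "integrable M (\<lambda>\<omega>. (Y \<omega> - d)\<^sup>2)"
      using integrable_normal_moment[OF sv, of d 2] distributed_integrable[OF DY, of "\<lambda>x. (x - d)\<^sup>2"] by simp
    have e1: "expectation Y = d" by (rule normal_distributed_expectation[OF sv DY])
    have e2: "expectation (\<lambda>\<omega>. (Y \<omega> - d)\<^sup>2) = v"
      using normal_distributed_variance[OF sv DY] v by (simp add: e1)
    have eq: "(\<lambda>\<omega>. (Y \<omega>)\<^sup>2) = (\<lambda>\<omega>. (Y \<omega> - d)\<^sup>2 + 2 * d * Y \<omega> - d\<^sup>2)"
      by (auto simp: power2_eq_square algebra_simps)
    have "integrable M (\<lambda>\<omega>. (Y \<omega>)\<^sup>2)" unfolding eq using i1 i2 by auto
    moreover have "expectation (\<lambda>\<omega>. (Y \<omega>)\<^sup>2) = d\<^sup>2 + v"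
      unfolding eq using i1 i2 e1 e2 prob_space by (simp add: power2_eq_square)
    ultimately show ?thesis using g by simp
  qed
  then show "gaussian_rv M Y" "integrable M (\<lambda>\<omega>. (Y \<omega>)\<^sup>2)" "(\<integral>\<omega>. (Y \<omega>)\<^sup>2 \<partial>M) = d\<^sup>2 + v"
    by auto
qed

text \<open>Convergence of the variances need not be assumed: it is read off the limiting characteristic
  function at a point where that function is close to \<open>1\<close>.\<close>

lemma (in prob_space) gaussian_limit:
  assumes X: "\<And>n. X n \<in> borel_measurable M" and v: "\<And>n. v n \<ge> (0::real)"
    and ch: "\<And>n u. char (distr M borel (X n)) u = complex_of_real (exp (- (u\<^sup>2 * v n / 2)))"
    and Y: "Y \<in> borel_measurable M" and lim: "AE \<omega> in M. (\<lambda>n. X n \<omega>) \<longlonglongrightarrow> Y \<omega>"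
  obtains V where "V \<ge> 0" "v \<longlonglongrightarrow> V"
    "\<And>u. char (distr M borel Y) u = complex_of_real (exp (- (u\<^sup>2 * V / 2)))"
proof -
  define \<phi> where "\<phi> = char (distr M borel Y)"
  have conv: "(\<lambda>n. complex_of_real (exp (- (u\<^sup>2 * v n / 2)))) \<longlonglongrightarrow> \<phi> u" for u
  proof -
    have "(\<lambda>n. \<integral>\<omega>. iexp (u * X n \<omega>) \<partial>M) \<longlonglongrightarrow> (\<integral>\<omega>. iexp (u * Y \<omega>) \<partial>M)"
    proof (rule integral_dominated_convergence[where w="\<lambda>_. 1"])
      show "AE \<omega> in M. (\<lambda>n. iexp (u * X n \<omega>)) \<longlonglongrightarrow> iexp (u * Y \<omega>)"
        using lim by eventually_elim (intro tendsto_intros)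
    qed (use X Y in auto)
    then show ?thesis
      unfolding \<phi>_def char_distr_eq[OF Y] ch[symmetric] char_distr_eq[OF X] .
  qed
  interpret D: real_distribution "distr M borel Y" using Y by simp
  have "isCont \<phi> 0" unfolding \<phi>_def by (rule D.isCont_char)
  moreover have "\<phi> 0 = 1" unfolding \<phi>_def by (rule D.char_zero)
  ultimately obtain d where d: "d > 0" "\<And>u. dist u 0 < d \<Longrightarrow> dist (\<phi> u) 1 < 1"
    unfolding continuous_at_eps_delta by (metis dist_norm zero_less_one)
  define u where "u = d / 2"
  have u: "u > 0" using d by (simp add: u_def)
  define a where "a = Re (\<phi> u)"
  have "\<bar>Re (\<phi> u - 1)\<bar> < 1"
    using d(2)[of u] d(1) abs_Re_le_cmod[of "\<phi> u - 1"] by (simp add: u_def dist_norm)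
  then have a: "a > 0" by (simp add: a_def)
  have "(\<lambda>n. exp (- (u\<^sup>2 * v n / 2))) \<longlonglongrightarrow> a"
    using tendsto_Re[OF conv[of u]] by (simp add: a_def)
  then have "(\<lambda>n. ln (exp (- (u\<^sup>2 * v n / 2)))) \<longlonglongrightarrow> ln a"
    using a by (intro tendsto_ln) auto
  then have "(\<lambda>n. (- 2 / u\<^sup>2) * (- (u\<^sup>2 * v n / 2))) \<longlonglongrightarrow> (- 2 / u\<^sup>2) * ln a"
    by (intro tendsto_intros) simp
  then have vlim: "v \<longlonglongrightarrow> (- 2 / u\<^sup>2) * ln a" using u by simp
  show thesis
  proof (rule that[OF _ vlim])
    show "0 \<le> - 2 / u\<^sup>2 * ln a" by (rule LIMSEQ_le_const[OF vlim]) (use v in auto)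
    fix u'
    have "(\<lambda>n. complex_of_real (exp (- (u'\<^sup>2 * v n / 2)))) \<longlonglongrightarrow> complex_of_real (exp (- (u'\<^sup>2 * (- 2 / u\<^sup>2 * ln a) / 2)))"
      by (intro tendsto_intros vlim) auto
    with conv[of u'] show "char (distr M borel Y) u' = complex_of_real (exp (- (u'\<^sup>2 * (- 2 / u\<^sup>2 * ln a) / 2)))"
      unfolding \<phi>_def by (rule LIMSEQ_unique)
  qed
qed

lemma standard_BM_char_increments:
  assumes w: "standard_BM M w" and n: "n > 0"
  shows "char (distr M borel (\<lambda>\<omega>. \<Sum>k<L. c k * (w (real (Suc k) / real n) \<omega> - w (real k / real n) \<omega>))) u
    = complex_of_real (exp (- (u\<^sup>2 * (\<Sum>k<L. (c k)\<^sup>2 / real n) / 2)))"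
proof -
  interpret prob_space M using w by (simp add: standard_BM_def)
  have inc: "incseq (\<lambda>k. real k / real n)" by (auto intro!: incseq_SucI divide_right_mono)
  have "indep_vars (\<lambda>_. borel) (\<lambda>k \<omega>. w (real (Suc k) / real n) \<omega> - w (real k / real n) \<omega>) {..<L}"
    using w inc unfolding standard_BM_def by (auto dest!: spec[of _ L] spec[of _ "\<lambda>k. real k / real n"])
  then have ind: "indep_vars (\<lambda>_. borel) (\<lambda>k \<omega>. c k * (w (real (Suc k) / real n) \<omega> - w (real k / real n) \<omega>)) {..<L}"
    by (rule indep_vars_compose2[where Y="\<lambda>k x. c k * x"]) auto
  have D: "distributed M lborel (\<lambda>\<omega>. w (real (Suc k) / real n) \<omega> - w (real k / real n) \<omega>) (normal_density 0 (sqrt (1 / real n)))" for k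
  proof -
    have "real k / real n < real (Suc k) / real n" "0 \<le> real k / real n"
      using n by (auto simp: divide_strict_right_mono)
    moreover have "real (Suc k) / real n - real k / real n = 1 / real n"
      by (simp add: diff_divide_distrib[symmetric])
    ultimately show ?thesis using w unfolding standard_BM_def by metis
  qed
  have "char (distr M borel (\<lambda>\<omega>. c k * (w (real (Suc k) / real n) \<omega> - w (real k / real n) \<omega>))) u
      = complex_of_real (exp (- (u\<^sup>2 * ((c k)\<^sup>2 / real n) / 2)))" for k
    using char_normal[OF D[of k], of "c k" u] n by (simp add: field_simps)
  then show ?thesis
    unfolding char_distr_sum[OF ind]
    by (simp add: exp_sum[symmetric] sum_negf sum_distrib_left sum_divide_distrib flip: of_real_prod)
qed

text \<open>Each inner sum is a measurable function of one component path in the product space, so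
  independence of whole paths passes to these sums and the characteristic functions
  multiply.\<close>

lemma standard_BM_vec_char_increments:
  fixes w :: "real \<Rightarrow> 'a \<Rightarrow> real ^ 'n"
  assumes w: "standard_BM_vec M w" and n: "n > 0"
  shows "char (distr M borel (\<lambda>\<omega>. \<Sum>i\<in>UNIV. \<Sum>k<L. c i k * (w (real (Suc k) / real n) \<omega> $ i - w (real k / real n) \<omega> $ i))) u
    = complex_of_real (exp (- (u\<^sup>2 * (\<Sum>i\<in>UNIV. \<Sum>k<L. (c i k)\<^sup>2 / real n) / 2)))"
proof -
  have wi: "standard_BM M (\<lambda>t \<omega>. w t \<omega> $ i)" for i using w by (simp add: standard_BM_vec_def)
  interpret prob_space M using wi by (auto simp: standard_BM_def)
  let ?Y = "\<lambda>i p. \<Sum>k<L. c i k * (p (real (Suc k) / real n) - p (real k / real n))"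
  have "indep_vars (\<lambda>_. borel) (\<lambda>i \<omega>. ?Y i (\<lambda>t\<in>{0..}. w t \<omega> $ i)) UNIV"
  proof (rule indep_vars_compose2[where Y="?Y"])
    show "indep_vars (\<lambda>_. Pi\<^sub>M {0..} (\<lambda>_. borel)) (\<lambda>i \<omega>. \<lambda>t\<in>{0..}. w t \<omega> $ i) UNIV"
      using w by (simp add: standard_BM_vec_def)
    fix i
    show "?Y i \<in> measurable (Pi\<^sub>M {0..} (\<lambda>_. borel)) borel"
      by (intro borel_measurable_sum borel_measurable_times borel_measurable_diff
          measurable_component_singleton borel_measurable_const) auto
  qed
  then have ind: "indep_vars (\<lambda>_. borel) (\<lambda>i \<omega>. \<Sum>k<L. c i k * (w (real (Suc k) / real n) \<omega> $ i - w (real k / real n) \<omega> $ i)) UNIV"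
    by simp
  show ?thesis
    unfolding char_distr_sum[OF ind] standard_BM_char_increments[OF wi n]
    by (simp add: exp_sum[symmetric] sum_negf sum_distrib_left sum_divide_distrib flip: of_real_prod)
qed

section \<open>Orthonormal eigenbases of symmetric matrices\<close>

lemma inner_matrix_symmetric:
  fixes K :: "real ^ 'n ^ 'n"
  assumes "transpose K = K"
  shows "x \<bullet> (K *v y) = (K *v x) \<bullet> y"
  by (metis assms dot_lmul_matrix matrix_vector_mul_linear transpose_matrix_vector vector_transpose_matrix)

text \<open>A maximiser of the Rayleigh quotient on the orthogonal complement of the eigenvectors found so
  far is again an eigenvector.\<close>

lemma symmetric_orthogonal_eigenvector:
  fixes K :: "real ^ 'n ^ 'n"
  assumes sym: "transpose K = K" and E: "\<And>e. e \<in> E \<Longrightarrow> \<exists>\<mu>. K *v e = \<mu> *\<^sub>R e"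
    and fin: "finite E" and card: "card E < CARD('n)"
  obtains v \<mu> where "norm v = 1" "\<And>e. e \<in> E \<Longrightarrow> e \<bullet> v = 0" "K *v v = \<mu> *\<^sub>R v"
proof -
  define S where "S = {x :: real ^ 'n. \<forall>e\<in>E. e \<bullet> x = 0}"
  have sub: "subspace S" by (auto simp: S_def subspace_def inner_add_right)
  have closedS: "closed S" by (rule closed_subspace[OF sub])
  have inv: "K *v x \<in> S" if "x \<in> S" for x
    using that E unfolding S_def by (auto simp: inner_matrix_symmetric[OF sym]) (metis inner_scaleR_left mult_zero_right)
  \<comment> \<open>Fewer vectors than the dimension leave a nonzero vector orthogonal to all of
    \<open>E\<close>, so the sphere over which the maximum is taken is not empty.\<close>
  have "dim (span E) < DIM(real ^ 'n)"
    using card dim_le_card'[OF fin] by simp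
  then obtain a where a: "a \<noteq> 0" "\<And>x. x \<in> span E \<Longrightarrow> orthogonal a x"
    using orthogonal_to_subspace_exists by (metis dim_span)
  have aS: "a \<in> S" using a(2) by (auto simp: S_def orthogonal_def inner_commute span_base)
  have comp: "compact (S \<inter> sphere 0 1)" using closedS by (simp add: closed_Int_compact)
  have "(1 / norm a) *\<^sub>R a \<in> S \<inter> sphere 0 1"
    using a aS sub by (simp add: subspace_scale)
  then have ne: "S \<inter> sphere 0 1 \<noteq> {}" by blast
  have "continuous_on (S \<inter> sphere 0 1) (\<lambda>x. x \<bullet> (K *v x))"
    by (intro continuous_intros linear_continuous_on_compose[OF continuous_on_id]) (simp add: matrix_vector_mul_linear)
  from continuous_attains_sup[OF comp ne this]
  obtain v where v: "v \<in> S" "norm v = 1" and max: "\<And>x. x \<in> S \<Longrightarrow> norm x = 1 \<Longrightarrow> x \<bullet> (K *v x) \<le> v \<bullet> (K *v v)"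
    by auto
  define \<mu> where "\<mu> = v \<bullet> (K *v v)"
  define q where "q = (\<lambda>x. \<mu> * (x \<bullet> x) - x \<bullet> (K *v x))"
  have q0: "q x \<ge> 0" if "x \<in> S" for x
  proof (cases "x = 0")
    case False
    have "((1 / norm x) *\<^sub>R x) \<bullet> (K *v ((1 / norm x) *\<^sub>R x)) \<le> \<mu>"
      unfolding \<mu>_def by (rule max) (use that False sub in \<open>auto simp: subspace_scale\<close>)
    then have "(x \<bullet> (K *v x)) / (norm x * norm x) \<le> \<mu>"
      by (simp add: matrix_vector_mult_scaleR)
    then show ?thesis using False by (simp add: q_def pos_divide_le_eq dot_square_norm power2_eq_square)
  qed (simp add: q_def)
  define y where "y = \<mu> *\<^sub>R v - K *v v"
  have y: "y \<in> S" unfolding y_def using v inv sub by (simp add: subspace_diff subspace_scale)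
  have qv: "q (v + s *\<^sub>R y) = 2 * s * (y \<bullet> y) + s\<^sup>2 * q y" for s
  proof -
    have "q (v + s *\<^sub>R y) = q v + 2 * s * (y \<bullet> (\<mu> *\<^sub>R v - K *v v)) + s\<^sup>2 * q y"
      using inner_matrix_symmetric[OF sym, of v y]
      by (simp add: q_def inner_add_left inner_add_right matrix_vector_right_distrib matrix_vector_mult_scaleR
          inner_diff_right inner_commute power2_eq_square algebra_simps)
    moreover have "q v = 0" using v by (simp add: q_def \<mu>_def dot_square_norm)
    ultimately show ?thesis by (simp add: y_def)
  qed
  have "y \<bullet> y = 0"
  proof (rule ccontr)
    assume "y \<bullet> y \<noteq> 0"
    then have yy: "y \<bullet> y > 0" by (simp add: order_less_le)
    \<comment> \<open>\<open>q\<close> is nonnegative on \<open>S\<close>, yet along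
      \<open>v + s *\<^sub>R y\<close> its linear term in \<open>s\<close> has the positive
      coefficient \<open>2 * (y \<bullet> y)\<close>; a suitable negative \<open>s\<close> makes it
      negative. The added \<open>1\<close> guards against \<open>q y = 0\<close>.\<close>
    define s where "s = - (y \<bullet> y) / (q y + 1)"
    have qy: "q y \<ge> 0" by (rule q0[OF y])
    have "v + s *\<^sub>R y \<in> S" using v y sub by (simp add: subspace_add subspace_scale)
    then have "2 * s * (y \<bullet> y) + s\<^sup>2 * q y \<ge> 0" using q0 qv by metis
    moreover have "2 * s * (y \<bullet> y) + s\<^sup>2 * q y = - ((y \<bullet> y)\<^sup>2 / (q y + 1)\<^sup>2) * (q y + 2)"
    proof -
      have *: "2 * (- A / d) * A + (- A / d)\<^sup>2 * (d - 1) = - (A\<^sup>2 / d\<^sup>2) * (d + 1)"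
        if "d \<noteq> 0" for A d :: real
        using that by (simp add: field_simps power2_eq_square)
      show ?thesis using *[of "q y + 1" "y \<bullet> y"] qy by (simp add: s_def)
    qed
    moreover have "(y \<bullet> y)\<^sup>2 / (q y + 1)\<^sup>2 * (q y + 2) > 0"
      using yy qy by (intro mult_pos_pos divide_pos_pos) auto
    ultimately show False by linarith
  qed
  then have "K *v v = \<mu> *\<^sub>R v" by (simp add: y_def)
  with v that show thesis by (auto simp: S_def)
qed

text \<open>Growing the set from a prescribed eigenvector \<open>e0\<close> allows the all-ones
  direction to be a member of the basis.\<close>

lemma symmetric_eigenbasis_set:
  fixes K :: "real ^ 'n ^ 'n"
  assumes sym: "transpose K = K" and e0: "norm e0 = 1" "K *v e0 = \<mu>0 *\<^sub>R e0"
    and k: "1 \<le> k" "k \<le> CARD('n)"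
  shows "\<exists>E. finite E \<and> card E = k \<and> e0 \<in> E \<and> (\<forall>e\<in>E. norm e = 1 \<and> (\<exists>\<mu>. K *v e = \<mu> *\<^sub>R e)) \<and>
     (\<forall>e\<in>E. \<forall>f\<in>E. e \<noteq> f \<longrightarrow> e \<bullet> f = 0)"
  using k
proof (induct k rule: dec_induct)
  case base
  show ?case by (rule exI[of _ "{e0}"]) (use e0 in auto)
next
  case (step k)
  then obtain E where E: "finite E" "card E = k" "e0 \<in> E" "\<forall>e\<in>E. norm e = 1 \<and> (\<exists>\<mu>. K *v e = \<mu> *\<^sub>R e)"
     "\<forall>e\<in>E. \<forall>f\<in>E. e \<noteq> f \<longrightarrow> e \<bullet> f = 0" by auto
  obtain v \<mu> where v: "norm v = 1" "\<And>e. e \<in> E \<Longrightarrow> e \<bullet> v = 0" "K *v v = \<mu> *\<^sub>R v"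
    using symmetric_orthogonal_eigenvector[OF sym, of E] E step by (metis Suc_le_lessD)
  have "v \<notin> E" using v(1,2) by (metis norm_eq_zero inner_eq_zero_iff zero_neq_one)
  then show ?case
    by (intro exI[of _ "insert v E"]) (use E v in \<open>auto simp: inner_commute\<close>)
qed

lemma symmetric_eigenbasis:
  fixes K :: "real ^ 'n ^ 'n"
  assumes sym: "transpose K = K" and e0: "norm e0 = 1" "K *v e0 = \<mu>0 *\<^sub>R e0"
  obtains b :: "'n \<Rightarrow> real ^ 'n" and \<mu> i0 where "\<And>i j. b i \<bullet> b j = (if i = j then 1 else 0)"
    "\<And>i. K *v b i = \<mu> i *\<^sub>R b i" "b i0 = e0"
proof -
  obtain E where E: "finite E" "card E = CARD('n)" "e0 \<in> E" "\<forall>e\<in>E. norm e = 1 \<and> (\<exists>\<mu>. K *v e = \<mu> *\<^sub>R e)"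
     "\<forall>e\<in>E. \<forall>f\<in>E. e \<noteq> f \<longrightarrow> e \<bullet> f = 0"
    using symmetric_eigenbasis_set[OF sym e0, of "CARD('n)"] by (auto simp: Suc_leI)
  obtain b where b: "bij_betw b (UNIV :: 'n set) E"
    using finite_same_card_bij[of "UNIV :: 'n set" E] E by auto
  have bE: "b i \<in> E" for i using b by (auto simp: bij_betw_def)
  have "\<forall>i. \<exists>m. K *v b i = m *\<^sub>R b i" using E(4) bE by blast
  from choice[OF this] obtain \<mu> where "\<And>i. K *v b i = \<mu> i *\<^sub>R b i" by blast
  moreover have "e0 \<in> b ` UNIV" using b E(3) by (simp add: bij_betw_def)
  then obtain i0 where "b i0 = e0" by auto
  moreover have "b i \<bullet> b j = (if i = j then 1 else 0)" for i j
  proof (cases "i = j")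
    case False
    then have "b i \<noteq> b j" using b by (auto simp: bij_betw_def inj_def)
    then show ?thesis using E(5) bE False by simp
  qed (use E(4) bE in \<open>simp add: dot_square_norm\<close>)
  ultimately show thesis using that by blast
qed

context
  fixes b :: "'n \<Rightarrow> real ^ 'n"
  assumes orth: "\<And>i j. b i \<bullet> b j = (if i = j then 1 else 0)"
begin

lemma orthogonal_matrix_of_basis: "orthogonal_matrix (\<chi> i j. b j $ i)"
proof -
  have "(\<Sum>k\<in>UNIV. b i $ k * b j $ k) = (if i = j then 1 else 0)" for i j
    using orth[of i j] by (simp add: inner_vec_def)
  then show ?thesis
    unfolding orthogonal_matrix
    by (simp add: vec_eq_iff matrix_matrix_mult_def transpose_def mat_def)
qed

text \<open>Completeness comes from squareness: the matrix with the orthonormal columns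
  \<open>b j\<close> is inverted by its transpose on both sides.\<close>

lemma orthonormal_expansion: "x = (\<Sum>i\<in>UNIV. (b i \<bullet> x) *\<^sub>R b i)"
proof -
  let ?B = "(\<chi> i j. b j $ i) :: real ^ 'n ^ 'n"
  have "x = (?B ** transpose ?B) *v x"
    using orthogonal_matrix_of_basis by (simp add: orthogonal_matrix_def)
  also have "\<dots> = ?B *v (transpose ?B *v x)"
    by (rule matrix_vector_mul_assoc[symmetric])
  also have "transpose ?B *v x = (\<chi> i. b i \<bullet> x)"
    by (simp add: vec_eq_iff matrix_vector_mult_def transpose_def inner_vec_def)
  also have "?B *v (\<chi> i. b i \<bullet> x) = (\<Sum>i\<in>UNIV. (b i \<bullet> x) *\<^sub>R b i)"
    by (simp add: vec_eq_iff matrix_vector_mult_def mult.commute)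
  finally show ?thesis .
qed

lemma inner_orthonormal: "a \<bullet> x = (\<Sum>i\<in>UNIV. (a \<bullet> b i) * (b i \<bullet> x))"
  by (subst orthonormal_expansion[of x]) (simp add: inner_sum_right mult.commute)

lemma norm_orthonormal: "(norm x)\<^sup>2 = (\<Sum>i\<in>UNIV. (b i \<bullet> x)\<^sup>2)"
  using inner_orthonormal[of x x] by (simp add: dot_square_norm inner_commute power2_eq_square)

lemma char_poly_eigenbasis:
  assumes eig: "\<And>i. K *v b i = \<mu> i *\<^sub>R b i"
  shows "det (mat z - K) = (\<Prod>i\<in>UNIV. z - \<mu> i)"
proof -
  let ?B = "(\<chi> i j. b j $ i) :: real ^ 'n ^ 'n"
  let ?D = "(\<chi> i j. if i = j then z - \<mu> i else 0) :: real ^ 'n ^ 'n"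
  have e: "(mat z - K) *v b j = (z - \<mu> j) *\<^sub>R b j" for j
    by (simp add: matrix_vector_mult_diff_rdistrib eig scaleR_left_diff_distrib)
      (simp add: vec_eq_iff matrix_vector_mult_def mat_def if_distrib[where f="\<lambda>x. x * _"] cong: if_cong)
  have "((mat z - K) ** ?B) $ i $ j = ((mat z - K) *v b j) $ i" for i j
    by (simp add: matrix_matrix_mult_def matrix_vector_mult_def)
  then have "(mat z - K) ** ?B = ?B ** ?D"
    by (simp add: e vec_eq_iff) (simp add: matrix_matrix_mult_def if_distrib[where f="\<lambda>x. _ * x"] cong: if_cong)
  then have "det ((mat z - K) ** ?B) = det (?B ** ?D)" by (rule arg_cong)
  then have "det (mat z - K) * det ?B = det ?B * det ?D" by (simp only: det_mul)
  moreover have "det ?B \<noteq> 0"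
    using det_orthogonal_matrix[OF orthogonal_matrix_of_basis] by auto
  moreover have "det ?D = (\<Prod>i\<in>UNIV. z - \<mu> i)" by (subst det_diagonal) auto
  ultimately show ?thesis by simp
qed

end

text \<open>Equal values everywhere force equal polynomials, and \<open>proots\<close> reads the
  factors off with multiplicity.\<close>

lemma linear_factors_eq_imp_mset_eq:
  fixes f :: "'a \<Rightarrow> real" and g :: "'b \<Rightarrow> real"
  assumes "finite A" "finite B" "\<And>z. (\<Prod>i\<in>A. z - f i) = (\<Prod>i\<in>B. z - g i)"
  shows "image_mset f (mset_set A) = image_mset g (mset_set B)"
proof -
  have roots: "proots (\<Prod>i\<in>A. [:- f i, 1:]) = image_mset f (mset_set A)" if "finite A" for A and f :: "'c \<Rightarrow> real"
    using that
  proof (induct A rule: finite_induct)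
    case (insert x F)
    have "proots ([:- f x, 1:] * (\<Prod>i\<in>F. [:- f i, 1:])) = proots [:- f x, 1:] + proots (\<Prod>i\<in>F. [:- f i, 1:])"
      using insert(1) by (intro proots_mult) (auto simp: prod_zero_iff)
    with insert show ?case by (simp del: mult_pCons_left)
  qed simp
  have "poly (\<Prod>i\<in>A. [:- f i, 1:]) = poly (\<Prod>i\<in>B. [:- g i, 1:])"
    using assms(3) by (auto simp: poly_prod fun_eq_iff)
  then have "(\<Prod>i\<in>A. [:- f i, 1:]) = (\<Prod>i\<in>B. [:- g i, 1:])"
    by (simp add: poly_eq_poly_eq_iff)
  then show ?thesis using roots assms by metis
qed

text \<open>The characteristic polynomial determines the eigenvalues only as a multiset, and
  \<open>0\<close> may be repeated. Cancelling one copy of \<open>0\<close> on each side,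
  \<open>eig 1\<close> and the eigenvalue of the all-ones direction, matches the rest.\<close>

lemma eigenvalue_list_eigenbasis:
  fixes K :: "real ^ 'n ^ 'n"
  assumes sym: "transpose K = K" and one: "K *v 1 = 0"
    and eig: "eigenvalue_list K eig" and eig1: "eig 1 = 0"
  obtains b :: "'n \<Rightarrow> real ^ 'n" and \<mu> i0 c where "\<And>i j. b i \<bullet> b j = (if i = j then 1 else 0)"
    "\<And>i. K *v b i = \<mu> i *\<^sub>R b i" "b i0 = c *\<^sub>R 1" "c \<noteq> 0"
    "eig ` {2..CARD('n)} = \<mu> ` (- {i0})"
    "\<And>f :: real \<Rightarrow> real. (\<Sum>j=2..CARD('n). f (eig j)) = (\<Sum>i\<in>-{i0}. f (\<mu> i))"
proof -
  define c where "c = 1 / norm (1 :: real ^ 'n)"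
  have c: "c \<noteq> 0" by (simp add: c_def)
  obtain b :: "'n \<Rightarrow> real ^ 'n" and \<mu> i0 where b: "\<And>i j. b i \<bullet> b j = (if i = j then 1 else 0)"
    "\<And>i. K *v b i = \<mu> i *\<^sub>R b i" "b i0 = c *\<^sub>R 1"
    using symmetric_eigenbasis[OF sym, of "c *\<^sub>R 1" 0] c
    by (auto simp: c_def matrix_vector_mult_scaleR one)
  have "\<mu> i0 *\<^sub>R b i0 = 0" using b(2)[of i0] by (simp add: b(3) matrix_vector_mult_scaleR one)
  moreover have "b i0 \<noteq> 0" using b(1)[of i0 i0] by auto
  ultimately have m0: "\<mu> i0 = 0" by simp
  have "image_mset eig (mset_set {1..CARD('n)}) = image_mset \<mu> (mset_set UNIV)"
    using eig char_poly_eigenbasis[OF b(1) b(2)]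
    by (intro linear_factors_eq_imp_mset_eq) (auto simp: eigenvalue_list_def)
  moreover have "{1..CARD('n)} = insert 1 {2..CARD('n)}" by auto
  then have "mset_set {1..CARD('n)} = add_mset 1 (mset_set {2..CARD('n)})" by simp
  moreover have "mset_set UNIV = add_mset i0 (mset_set (- {i0}))"
  proof -
    have "UNIV = insert i0 (- {i0})" by auto
    then show ?thesis using mset_set.insert[of "- {i0}" i0] by simp
  qed
  ultimately have ms: "image_mset eig (mset_set {2..CARD('n)}) = image_mset \<mu> (mset_set (- {i0}))"
    using eig1 m0 by simp
  show thesis
  proof (rule that[OF b c])
    have "set_mset (image_mset eig (mset_set {2..CARD('n)})) = set_mset (image_mset \<mu> (mset_set (- {i0})))"
      by (simp only: ms)
    then show "eig ` {2..CARD('n)} = \<mu> ` (- {i0})" by simp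
    fix f :: "real \<Rightarrow> real"
    have "sum_mset (image_mset f (image_mset eig (mset_set {2..CARD('n)})))
        = sum_mset (image_mset f (image_mset \<mu> (mset_set (- {i0}))))" by (simp only: ms)
    then show "(\<Sum>j=2..CARD('n). f (eig j)) = (\<Sum>i\<in>-{i0}. f (\<mu> i))"
      by (simp add: sum_unfold_sum_mset image_mset.compositionality comp_def)
  qed
qed

section \<open>Second moments and Gaussianity of solutions\<close>

context fundamental_solution
begin

text \<open>Only the law of increments on uniform grids and path continuity are required of
  \<open>W\<close>, so the lemma serves a scalar Brownian motion and the projections
  \<open>b i \<bullet> w\<close> alike.\<close>

lemma forced_response_char:
  assumes M: "prob_space M" and W: "\<And>t. t \<ge> 0 \<Longrightarrow> W t \<in> borel_measurable M"
    and Wc: "AE \<omega> in M. continuous_on {0..} (\<lambda>t. W t \<omega>)"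
    and ch: "\<And>n L (c :: nat \<Rightarrow> real) u. n > 0 \<Longrightarrow>
      char (distr M borel (\<lambda>\<omega>. \<Sum>k<L. c k * (W (real (Suc k) / real n) \<omega> - W (real k / real n) \<omega>))) u
        = complex_of_real (exp (- (u\<^sup>2 * (\<Sum>k<L. (c k)\<^sup>2 / real n) / 2)))"
    and t: "t \<ge> 0" and Y: "Y \<in> borel_measurable M"
    and YW: "AE \<omega> in M. Y \<omega> = forced_response (\<lambda>s. W s \<omega> - W 0 \<omega>) t"
  shows "char (distr M borel Y) u = complex_of_real (exp (- (u\<^sup>2 * integral {0..t} (\<lambda>s. (R s)\<^sup>2) / 2)))"
proof -
  interpret prob_space M by (rule M)
  obtain N :: nat where N: "t \<le> real N" using real_arch_simple by blast
  \<comment> \<open>\<open>Suc n\<close> avoids the mesh \<open>1 / 0\<close>.\<close>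
  define X where "X = (\<lambda>n \<omega>. discrete_response N (Suc n) (\<lambda>s. W s \<omega> - W 0 \<omega>) t)"
  define v where "v = (\<lambda>n. \<Sum>k<N * Suc n. (causal_kernel (t - real (Suc k) / real (Suc n)))\<^sup>2 / real (Suc n))"
  have Xeq: "X n = (\<lambda>\<omega>. \<Sum>k<N * Suc n. causal_kernel (t - real (Suc k) / real (Suc n)) *
      (W (real (Suc k) / real (Suc n)) \<omega> - W (real k / real (Suc n)) \<omega>))" for n
    by (simp add: X_def discrete_response_def)
  obtain V where V: "V \<ge> 0" "v \<longlonglongrightarrow> V"
    "\<And>u. char (distr M borel Y) u = complex_of_real (exp (- (u\<^sup>2 * V / 2)))"
  proof (rule gaussian_limit[of X v Y])
    show "X n \<in> borel_measurable M" for n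
      unfolding Xeq by (intro borel_measurable_sum borel_measurable_times borel_measurable_diff W) auto
    show "v n \<ge> 0" for n unfolding v_def by (intro sum_nonneg) auto
    show "char (distr M borel (X n)) u = complex_of_real (exp (- (u\<^sup>2 * v n / 2)))" for n u
      unfolding Xeq v_def by (rule ch) simp
    show "AE \<omega> in M. (\<lambda>n. X n \<omega>) \<longlonglongrightarrow> Y \<omega>"
      using Wc YW
    proof eventually_elim
      case (elim \<omega>)
      have "(\<lambda>n. discrete_response N n (\<lambda>s. W s \<omega> - W 0 \<omega>) t) \<longlonglongrightarrow> forced_response (\<lambda>s. W s \<omega> - W 0 \<omega>) t"
        by (rule discrete_response_tendsto) (use elim t N in \<open>auto intro!: continuous_intros\<close>)
      then show ?case unfolding X_def elim(2) by (rule LIMSEQ_Suc)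
    qed
  qed (use Y in auto)
  have "v \<longlonglongrightarrow> integral {0..t} (\<lambda>s. (R s)\<^sup>2)"
    unfolding v_def using LIMSEQ_Suc[OF causal_kernel_square_sum_tendsto[OF t N]] .
  then have "V = integral {0..t} (\<lambda>s. (R s)\<^sup>2)" using V(2) LIMSEQ_unique by blast
  then show ?thesis using V(3) by simp
qed

lemma square_integral_nonneg: "integral {0..t} (\<lambda>s. (R s)\<^sup>2) \<ge> 0"
  by (intro Henstock_Kurzweil_Integration.integral_nonneg integrable_continuous_interval continuous_intros) auto

lemma square_integral_mono: "s \<le> t \<Longrightarrow> integral {0..s} (\<lambda>s. (R s)\<^sup>2) \<le> integral {0..t} (\<lambda>s. (R s)\<^sup>2)"
  by (intro integral_subset_le integrable_continuous_interval continuous_intros) auto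

lemma free_response_cong:
  assumes "\<And>s. s \<in> {-\<tau>..0} \<Longrightarrow> z s = z' s"
  shows "free_response z t = free_response z' t"
proof -
  have "integral {-\<tau>..min 0 (t - \<tau>)} (\<lambda>s. R (t - \<tau> - s) * z s) = integral {-\<tau>..min 0 (t - \<tau>)} (\<lambda>s. R (t - \<tau> - s) * z' s)"
    by (intro integral_cong) (simp add: assms)
  then show ?thesis using assms[of 0] tau by (simp add: free_response_def)
qed

lemma free_response_0 [simp]: "free_response (\<lambda>_. 0) t = 0"
  by (simp add: free_response_def)

lemma scalar_second_moment:
  assumes w: "standard_BM M w" and y: "sdde_solution M \<tau> (\<lambda>v. l * v) w (\<lambda>_. 0) y" and t: "t \<ge> 0"
  shows "integrable M (\<lambda>\<omega>. (y t \<omega>)\<^sup>2)" "(\<integral>\<omega>. (y t \<omega>)\<^sup>2 \<partial>M) = integral {0..t} (\<lambda>s. (R s)\<^sup>2)"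
proof -
  interpret prob_space M using w by (simp add: standard_BM_def)
  have wm: "w t \<in> borel_measurable M" if "t \<ge> 0" for t using w that by (simp add: standard_BM_def)
  have wc: "AE \<omega> in M. continuous_on {0..} (\<lambda>t. w t \<omega>)" using w by (simp add: standard_BM_def)
  have ym: "y t \<in> borel_measurable M" using y t tau by (simp add: sdde_solution_def)
  have yw: "AE \<omega> in M. y t \<omega> = forced_response (\<lambda>s. w s \<omega> - w 0 \<omega>) t"
  proof -
    have "AE \<omega> in M. continuous_on {-\<tau>..} (\<lambda>t. y t \<omega>) \<and> (\<forall>t\<in>{-\<tau>..0}. y t \<omega> = 0) \<and>
      (\<forall>t\<ge>0. y t \<omega> = 0 - integral {0..t} (\<lambda>s. l * y (s - \<tau>) \<omega>) + (w t \<omega> - w 0 \<omega>))"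
      using y by (simp add: sdde_solution_def)
    then show ?thesis using wc
    proof eventually_elim
      case (elim \<omega>)
      have h: "y s \<omega> = 0" if "s \<in> {-\<tau>..0}" for s using elim(1) that by blast
      then have y0: "y 0 \<omega> = 0" using tau by simp
      have "y t \<omega> = free_response (\<lambda>t. y t \<omega>) t + forced_response (\<lambda>s. w s \<omega> - w 0 \<omega>) t"
        unfolding free_response_def forced_response_def
        by (rule variation_of_constants[OF _ _ _ t]) (use elim y0 in \<open>auto intro!: continuous_intros\<close>)
      also have "free_response (\<lambda>t. y t \<omega>) t = free_response (\<lambda>_. 0) t"
        by (rule free_response_cong) (rule h)
      finally show ?case by simp
    qed
  qed
  have "AE \<omega> in M. y t \<omega> = 0 + y t \<omega>" by simp
  note G = gaussian_of_char[OF ym square_integral_nonneg forced_response_char[OF prob_space_axioms wm wc _ t ym yw] ym this]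
  show "integrable M (\<lambda>\<omega>. (y t \<omega>)\<^sup>2)" "(\<integral>\<omega>. (y t \<omega>)\<^sup>2 \<partial>M) = integral {0..t} (\<lambda>s. (R s)\<^sup>2)"
    using G standard_BM_char_increments[OF w] by auto
qed

theorem scalar_steady_state:
  assumes "standard_BM M w" "sdde_solution M \<tau> (\<lambda>v. l * v) w (\<lambda>_. 0) y"
    and "l \<in> {0<..<pi / (2 * \<tau>)}"
  shows "has_steady_state_variance M y (sigma_I_sq \<tau> l)"
proof -
  have "((\<lambda>t. \<integral>\<omega>. (norm (y t \<omega>))\<^sup>2 \<partial>M) \<longlongrightarrow> sigma_I_sq \<tau> l) at_top"
    by (rule Lim_transform_eventually[OF stable_limits(2)[OF assms(3)]])
      (use eventually_ge_at_top[of 0] in eventually_elim, simp add: scalar_second_moment[OF assms(1,2)])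
  then show ?thesis
    using scalar_second_moment[OF assms(1,2)] by (simp add: has_steady_state_variance_def)
qed

end

section \<open>Modal decomposition of the network error\<close>

lemma centering_mult: "centering *v v = v - ((1 \<bullet> v) / real CARD('n)) *\<^sub>R (1 :: real ^ 'n)"
  by (simp add: centering_def vec_eq_iff matrix_vector_mult_def mat_def left_diff_distrib sum_subtractf
      inner_vec_def sum_divide_distrib if_distrib[where f="\<lambda>x. x * _"] cong: if_cong)

locale diagonalised_network =
  fixes M :: "'a measure" and \<tau> :: real and K :: "real ^ 'n ^ 'n" and w :: "real \<Rightarrow> 'a \<Rightarrow> real ^ 'n"
    and b :: "'n \<Rightarrow> real ^ 'n" and \<mu> :: "'n \<Rightarrow> real" and i0 :: 'n and c :: real and R :: "'n \<Rightarrow> real \<Rightarrow> real"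
  assumes sym: "transpose K = K" and w: "standard_BM_vec M w"
    and orth: "\<And>i j. b i \<bullet> b j = (if i = j then 1 else 0)"
    and eig: "\<And>i. K *v b i = \<mu> i *\<^sub>R b i"
    and b0: "b i0 = c *\<^sub>R 1" and c: "c \<noteq> 0"
    and fund: "\<And>i. fundamental_solution \<tau> (\<mu> i) (R i)"
begin

sublocale prob_space M
  using w by (auto simp: standard_BM_vec_def standard_BM_def)

sublocale F: fundamental_solution \<tau> "\<mu> i" "R i" for i
  by (rule fund)

lemma tau: "\<tau> > 0" using F.tau .

text \<open>Subtracting \<open>w 0\<close> makes the driving path start at \<open>0\<close> for
  every outcome, not just almost surely.\<close>

definition B where "B i t \<omega> = b i \<bullet> (w t \<omega> - w 0 \<omega>)"

lemma w_meas: "t \<ge> 0 \<Longrightarrow> (\<lambda>\<omega>. w t \<omega> $ i) \<in> borel_measurable M"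
  using w by (simp add: standard_BM_vec_def standard_BM_def)

lemma bw_meas: "t \<ge> 0 \<Longrightarrow> (\<lambda>\<omega>. b i \<bullet> w t \<omega>) \<in> borel_measurable M"
  unfolding inner_vec_def inner_real_def
  by (intro borel_measurable_sum borel_measurable_times borel_measurable_const w_meas)

lemma B_meas: "t \<ge> 0 \<Longrightarrow> B i t \<in> borel_measurable M"
  unfolding B_def[abs_def] inner_diff_right by (intro borel_measurable_diff bw_meas) auto

lemma w_cont: "AE \<omega> in M. continuous_on {0..} (\<lambda>t. w t \<omega>)"
proof -
  have "AE \<omega> in M. \<forall>i\<in>UNIV. continuous_on {0..} (\<lambda>t. w t \<omega> $ i)"
    using w by (intro AE_finite_allI) (auto simp: standard_BM_vec_def standard_BM_def)
  then show ?thesis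
  proof eventually_elim
    case (elim \<omega>)
    then have "continuous_on {0..} (\<lambda>t. \<chi> i. w t \<omega> $ i)" by (intro continuous_on_vec_lambda) auto
    then show ?case by simp
  qed
qed

lemma one_eq: "1 = (1 / c) *\<^sub>R b i0" using c by (simp add: b0)

lemma inner_b_one: "i \<noteq> i0 \<Longrightarrow> b i \<bullet> 1 = 0" by (simp add: one_eq orth)

lemma inner_b_centering: "i \<noteq> i0 \<Longrightarrow> b i \<bullet> (centering *v v) = b i \<bullet> v"
  by (simp add: centering_mult inner_diff_right inner_b_one)

lemma inner_b0_centering: "b i0 \<bullet> (centering *v v) = 0"
  by (simp add: centering_mult inner_diff_right b0) (simp add: inner_vec_def)

text \<open>The components of \<open>b i\<close> have squares summing to \<open>1\<close>, so
  projecting onto \<open>b i\<close> preserves the variance of the increments.\<close>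

lemma char_increments:
  assumes n: "n > 0"
  shows "char (distr M borel (\<lambda>\<omega>. \<Sum>k<L. a k * (b i \<bullet> w (real (Suc k) / real n) \<omega> - b i \<bullet> w (real k / real n) \<omega>))) u
        = complex_of_real (exp (- (u\<^sup>2 * (\<Sum>k<L. (a k)\<^sup>2 / real n) / 2)))"
proof -
  have "(\<Sum>k<L. a k * (b i \<bullet> w (real (Suc k) / real n) \<omega> - b i \<bullet> w (real k / real n) \<omega>))
      = (\<Sum>j\<in>UNIV. \<Sum>k<L. (a k * b i $ j) * (w (real (Suc k) / real n) \<omega> $ j - w (real k / real n) \<omega> $ j))" for \<omega>
    by (subst sum.swap) (simp add: inner_vec_def sum_distrib_left right_diff_distrib mult.assoc flip: sum_subtractf)
  moreover have "(\<Sum>j\<in>UNIV. \<Sum>k<L. (a k * b i $ j)\<^sup>2 / real n) = (\<Sum>k<L. (a k)\<^sup>2 / real n)"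
  proof -
    have "(\<Sum>j\<in>UNIV. (b i $ j)\<^sup>2) = 1" using orth[of i i] by (simp add: inner_vec_def power2_eq_square)
    then have "(\<Sum>j\<in>UNIV. (a k * b i $ j)\<^sup>2 / real n) = (a k)\<^sup>2 / real n" for k
      by (simp add: power_mult_distrib flip: sum_divide_distrib sum_distrib_left)
    then show ?thesis by (subst sum.swap) simp
  qed
  ultimately show ?thesis using standard_BM_vec_char_increments[OF w n, of "\<lambda>j k. a k * b i $ j" L u] by simp
qed

text \<open>One null set serves all times and modes. For \<open>i \<noteq> i0\<close> the centring
  is invisible because \<open>b i\<close> is orthogonal to the all-ones vector; the mode
  \<open>i0\<close> is removed by the constraint on \<open>x\<close>.\<close>

lemma modes:
  assumes x: "network_error M \<tau> K w \<phi> x"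
  shows "AE \<omega> in M. (\<forall>t\<in>{-\<tau>..0}. x t \<omega> = \<phi> t) \<and> (\<forall>t\<ge>0. b i0 \<bullet> x t \<omega> = 0 \<and>
    (\<forall>i\<in>-{i0}. b i \<bullet> x t \<omega> = F.free_response i (\<lambda>s. b i \<bullet> \<phi> s) t + F.forced_response i (\<lambda>s. B i s \<omega>) t))"
proof -
  have "AE \<omega> in M. continuous_on {-\<tau>..} (\<lambda>t. x t \<omega>) \<and> (\<forall>t\<in>{-\<tau>..0}. x t \<omega> = \<phi> t) \<and>
        (\<forall>t\<ge>0. x t \<omega> = \<phi> 0 - integral {0..t} (\<lambda>s. K *v x (s - \<tau>) \<omega>) + (centering *v w t \<omega> - centering *v w 0 \<omega>))"
    and "AE \<omega> in M. \<forall>t\<ge>-\<tau>. 1 \<bullet> x t \<omega> = 0"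
    using x by (auto simp: network_error_def sdde_solution_def)
  then show ?thesis using w_cont
  proof eventually_elim
    case (elim \<omega>)
    have xc: "continuous_on {-\<tau>..} (\<lambda>t. x t \<omega>)" and h: "\<And>t. t \<in> {-\<tau>..0} \<Longrightarrow> x t \<omega> = \<phi> t" using elim(1) by auto
    have xeq: "x t \<omega> = \<phi> 0 - integral {0..t} (\<lambda>s. K *v x (s - \<tau>) \<omega>) + (centering *v w t \<omega> - centering *v w 0 \<omega>)"
      if "t \<ge> 0" for t using elim(1) that by blast
    have "b i \<bullet> x t \<omega> = F.free_response i (\<lambda>s. b i \<bullet> \<phi> s) t + F.forced_response i (\<lambda>s. B i s \<omega>) t"
      if i: "i \<noteq> i0" and t: "t \<ge> 0" for i t
    proof -
      have "b i \<bullet> x t \<omega> = F.free_response i (\<lambda>t. b i \<bullet> x t \<omega>) t + F.forced_response i (\<lambda>s. B i s \<omega>) t"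
        unfolding F.free_response_def F.forced_response_def
      proof (rule F.variation_of_constants[OF _ _ _ t])
        show "continuous_on {-\<tau>..} (\<lambda>t. b i \<bullet> x t \<omega>)" by (intro continuous_intros xc)
        show "continuous_on {0..} (\<lambda>s. B i s \<omega>)" unfolding B_def by (intro continuous_intros elim(3))
        fix t :: real assume t: "t \<ge> 0"
        have "continuous_on {0..t} (\<lambda>s. K *v x (s - \<tau>) \<omega>)"
          by (intro linear_continuous_on_compose[OF _ matrix_vector_mul_linear]
              continuous_on_compose2[OF xc] continuous_intros) auto
        then have "(\<lambda>s. K *v x (s - \<tau>) \<omega>) integrable_on {0..t}" by (rule integrable_continuous_interval)
        then have "b i \<bullet> integral {0..t} (\<lambda>s. K *v x (s - \<tau>) \<omega>) = integral {0..t} (\<lambda>s. b i \<bullet> (K *v x (s - \<tau>) \<omega>))"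
          using integral_linear[OF _ bounded_linear_inner_right, of "\<lambda>s. K *v x (s - \<tau>) \<omega>" "{0..t}" "b i"]
          by (simp add: o_def)
        also have "\<dots> = \<mu> i * integral {0..t} (\<lambda>s. b i \<bullet> x (s - \<tau>) \<omega>)"
          by (simp add: inner_matrix_symmetric[OF sym] eig)
        finally have I: "b i \<bullet> integral {0..t} (\<lambda>s. K *v x (s - \<tau>) \<omega>) = \<mu> i * integral {0..t} (\<lambda>s. b i \<bullet> x (s - \<tau>) \<omega>)" .
        have x0: "x 0 \<omega> = \<phi> 0" using h tau by simp
        show "b i \<bullet> x t \<omega> = b i \<bullet> x 0 \<omega> - \<mu> i * integral {0..t} (\<lambda>s. b i \<bullet> x (s - \<tau>) \<omega>) + B i t \<omega>"
          by (subst xeq[OF t]) (simp add: inner_add_right inner_diff_right I inner_b_centering[OF i] B_def x0)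
      qed
      also have "F.free_response i (\<lambda>t. b i \<bullet> x t \<omega>) t = F.free_response i (\<lambda>s. b i \<bullet> \<phi> s) t"
        by (rule F.free_response_cong) (simp add: h)
      finally show ?thesis .
    qed
    moreover have "b i0 \<bullet> x t \<omega> = 0" if "t \<ge> 0" for t using elim(2) that tau by (simp add: b0)
    ultimately show ?case using h by auto
  qed
qed

lemma solution_meas:
  "network_error M \<tau> K w \<phi> x \<Longrightarrow> t \<ge> - \<tau> \<Longrightarrow> x t \<in> borel_measurable M"
  by (simp add: network_error_def sdde_solution_def)

lemma mode_second_moment:
  assumes x: "network_error M \<tau> K w \<phi> x" and t: "t \<ge> 0" and i: "i \<noteq> i0"
  shows "integrable M (\<lambda>\<omega>. (b i \<bullet> x t \<omega>)\<^sup>2)"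
    "(\<integral>\<omega>. (b i \<bullet> x t \<omega>)\<^sup>2 \<partial>M) = (F.free_response i (\<lambda>s. b i \<bullet> \<phi> s) t)\<^sup>2 + integral {0..t} (\<lambda>s. (R i s)\<^sup>2)"
proof -
  define d where "d = F.free_response i (\<lambda>s. b i \<bullet> \<phi> s) t"
  have xm: "(\<lambda>\<omega>. b i \<bullet> x t \<omega>) \<in> borel_measurable M"
    using solution_meas[OF x, of t] t tau by simp
  then have ym: "(\<lambda>\<omega>. b i \<bullet> x t \<omega> - d) \<in> borel_measurable M" by simp
  have eq: "AE \<omega> in M. b i \<bullet> x t \<omega> - d = F.forced_response i (\<lambda>s. b i \<bullet> w s \<omega> - b i \<bullet> w 0 \<omega>) t"
    using modes[OF x] by eventually_elim (use t i in \<open>simp add: d_def B_def inner_diff_right\<close>)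
  have wc: "AE \<omega> in M. continuous_on {0..} (\<lambda>t. b i \<bullet> w t \<omega>)"
    using w_cont by eventually_elim (intro continuous_intros)
  have ch: "char (distr M borel (\<lambda>\<omega>. b i \<bullet> x t \<omega> - d)) u = complex_of_real (exp (- (u\<^sup>2 * integral {0..t} (\<lambda>s. (R i s)\<^sup>2) / 2)))" for u
    by (rule F.forced_response_char[OF prob_space_axioms bw_meas wc char_increments t ym eq])
  show "integrable M (\<lambda>\<omega>. (b i \<bullet> x t \<omega>)\<^sup>2)"
    "(\<integral>\<omega>. (b i \<bullet> x t \<omega>)\<^sup>2 \<partial>M) = (F.free_response i (\<lambda>s. b i \<bullet> \<phi> s) t)\<^sup>2 + integral {0..t} (\<lambda>s. (R i s)\<^sup>2)"
    using gaussian_of_char(2,3)[OF ym F.square_integral_nonneg ch xm, of d] by (auto simp: d_def)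
qed

lemma second_moment:
  assumes x: "network_error M \<tau> K w \<phi> x" and t: "t \<ge> 0"
  shows "integrable M (\<lambda>\<omega>. (norm (x t \<omega>))\<^sup>2)"
    "(\<integral>\<omega>. (norm (x t \<omega>))\<^sup>2 \<partial>M) =
      (\<Sum>i\<in>-{i0}. (F.free_response i (\<lambda>s. b i \<bullet> \<phi> s) t)\<^sup>2 + integral {0..t} (\<lambda>s. (R i s)\<^sup>2))"
proof -
  have ae: "AE \<omega> in M. (norm (x t \<omega>))\<^sup>2 = (\<Sum>i\<in>-{i0}. (b i \<bullet> x t \<omega>)\<^sup>2)"
    using modes[OF x]
  proof eventually_elim
    case (elim \<omega>)
    have "(norm (x t \<omega>))\<^sup>2 = (\<Sum>i\<in>insert i0 (-{i0}). (b i \<bullet> x t \<omega>)\<^sup>2)"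
      unfolding norm_orthonormal[OF orth, of "x t \<omega>"] by (intro sum.cong) auto
    then show ?case using elim t by simp
  qed
  have xm: "(\<lambda>\<omega>. (norm (x t \<omega>))\<^sup>2) \<in> borel_measurable M" "(\<lambda>\<omega>. \<Sum>i\<in>-{i0}. (b i \<bullet> x t \<omega>)\<^sup>2) \<in> borel_measurable M"
    using solution_meas[OF x, of t] t tau by simp_all
  have int: "integrable M (\<lambda>\<omega>. \<Sum>i\<in>-{i0}. (b i \<bullet> x t \<omega>)\<^sup>2)"
    by (intro Bochner_Integration.integrable_sum mode_second_moment[OF x t]) auto
  then show "integrable M (\<lambda>\<omega>. (norm (x t \<omega>))\<^sup>2)"
    using integrable_cong_AE[OF xm ae] by simp
  have "(\<integral>\<omega>. (norm (x t \<omega>))\<^sup>2 \<partial>M) = (\<integral>\<omega>. (\<Sum>i\<in>-{i0}. (b i \<bullet> x t \<omega>)\<^sup>2) \<partial>M)"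
    by (rule integral_cong_AE[OF xm ae])
  also have "\<dots> = (\<Sum>i\<in>-{i0}. \<integral>\<omega>. (b i \<bullet> x t \<omega>)\<^sup>2 \<partial>M)"
    by (intro Bochner_Integration.integral_sum mode_second_moment[OF x t]) auto
  also have "\<dots> = (\<Sum>i\<in>-{i0}. (F.free_response i (\<lambda>s. b i \<bullet> \<phi> s) t)\<^sup>2 + integral {0..t} (\<lambda>s. (R i s)\<^sup>2))"
    by (intro sum.cong mode_second_moment[OF x t]) auto
  finally show "(\<integral>\<omega>. (norm (x t \<omega>))\<^sup>2 \<partial>M) =
      (\<Sum>i\<in>-{i0}. (F.free_response i (\<lambda>s. b i \<bullet> \<phi> s) t)\<^sup>2 + integral {0..t} (\<lambda>s. (R i s)\<^sup>2))" .
qed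

lemma steady_state:
  assumes x: "network_error M \<tau> K w \<phi> x" and \<phi>: "admissible_history \<tau> \<phi>"
    and stable: "\<And>i. i \<noteq> i0 \<Longrightarrow> \<mu> i \<in> {0<..<pi / (2 * \<tau>)}"
  shows "has_steady_state_variance M x (\<Sum>i\<in>-{i0}. sigma_I_sq \<tau> (\<mu> i))"
proof -
  have "((\<lambda>t. \<Sum>i\<in>-{i0}. (F.free_response i (\<lambda>s. b i \<bullet> \<phi> s) t)\<^sup>2 + integral {0..t} (\<lambda>s. (R i s)\<^sup>2))
     \<longlongrightarrow> (\<Sum>i\<in>-{i0}. 0\<^sup>2 + sigma_I_sq \<tau> (\<mu> i))) at_top"
    using \<phi> stable
    by (intro tendsto_sum tendsto_add tendsto_power F.free_response_tendsto_0 F.stable_limits)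
      (auto intro!: continuous_intros simp: admissible_history_def)
  then have "((\<lambda>t. \<integral>\<omega>. (norm (x t \<omega>))\<^sup>2 \<partial>M) \<longlongrightarrow> (\<Sum>i\<in>-{i0}. 0\<^sup>2 + sigma_I_sq \<tau> (\<mu> i))) at_top"
    by (rule Lim_transform_eventually)
      (use eventually_ge_at_top[of 0] in eventually_elim, simp add: second_moment[OF x])
  then show ?thesis using second_moment(1)[OF x] by (simp add: has_steady_state_variance_def)
qed

text \<open>All modes are driven by the same \<open>w\<close>, so the sum is regrouped by component
  and cell of \<open>w\<close>, whose increments are independent. For Gaussianity the value of
  \<open>V\<close> is immaterial.\<close>

lemma forced_combination_char:
  assumes F: "finite F" "F \<subseteq> {0..}" and Y: "Y \<in> borel_measurable M"
    and YF: "AE \<omega> in M. Y \<omega> = (\<Sum>t\<in>F. \<Sum>i\<in>-{i0}. \<alpha> t i * F.forced_response i (\<lambda>s. B i s \<omega>) t)"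
  obtains V where "V \<ge> 0" "\<And>u. char (distr M borel Y) u = complex_of_real (exp (- (u\<^sup>2 * V / 2)))"
proof -
  obtain N :: nat where "Max (insert 0 F) \<le> real N" using real_arch_simple by blast
  then have N: "t \<le> real N" if "t \<in> F" for t
    using that F(1) Max_ge[of "insert 0 F" t] by simp
  \<comment> \<open>The total coefficient of the \<open>k\<close>-th increment of component
    \<open>j\<close>.\<close>
  define a where "a = (\<lambda>n j k. \<Sum>t\<in>F. \<Sum>i\<in>-{i0}. \<alpha> t i * F.causal_kernel i (t - real (Suc k) / real (Suc n)) * b i $ j)"
  define X where "X = (\<lambda>n \<omega>. \<Sum>j\<in>UNIV. \<Sum>k<N * Suc n. a n j k *
      (w (real (Suc k) / real (Suc n)) \<omega> $ j - w (real k / real (Suc n)) \<omega> $ j))"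
  define v where "v = (\<lambda>n. \<Sum>j\<in>UNIV. \<Sum>k<N * Suc n. (a n j k)\<^sup>2 / real (Suc n))"
  have Xeq: "X n \<omega> = (\<Sum>t\<in>F. \<Sum>i\<in>-{i0}. \<alpha> t i * F.discrete_response i N (Suc n) (\<lambda>s. B i s \<omega>) t)" for n \<omega>
  proof -
    define d where "d = (\<lambda>j k. w (real (Suc k) / real (Suc n)) \<omega> $ j - w (real k / real (Suc n)) \<omega> $ j)"
    define \<rho> where "\<rho> = (\<lambda>t i k. F.causal_kernel i (t - real (Suc k) / real (Suc n)))"
    have Bd: "B i (real (Suc k) / real (Suc n)) \<omega> - B i (real k / real (Suc n)) \<omega> = (\<Sum>j\<in>UNIV. b i $ j * d j k)" for i k
      by (simp add: B_def d_def inner_vec_def right_diff_distrib sum_subtractf)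
    have "X n \<omega> = (\<Sum>j\<in>UNIV. \<Sum>k<N * Suc n. \<Sum>t\<in>F. \<Sum>i\<in>-{i0}. \<alpha> t i * (\<rho> t i k * (b i $ j * d j k)))"
    proof -
      have "X n \<omega> = (\<Sum>j\<in>UNIV. \<Sum>k<N * Suc n. a n j k * d j k)" by (simp only: X_def d_def)
      then show ?thesis by (simp only: a_def \<rho>_def sum_distrib_right mult.assoc)
    qed
    also have "\<dots> = (\<Sum>j\<in>UNIV. \<Sum>t\<in>F. \<Sum>k<N * Suc n. \<Sum>i\<in>-{i0}. \<alpha> t i * (\<rho> t i k * (b i $ j * d j k)))"
      by (intro sum.cong refl sum.swap)
    also have "\<dots> = (\<Sum>t\<in>F. \<Sum>j\<in>UNIV. \<Sum>k<N * Suc n. \<Sum>i\<in>-{i0}. \<alpha> t i * (\<rho> t i k * (b i $ j * d j k)))"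
      by (rule sum.swap)
    also have "\<dots> = (\<Sum>t\<in>F. \<Sum>j\<in>UNIV. \<Sum>i\<in>-{i0}. \<Sum>k<N * Suc n. \<alpha> t i * (\<rho> t i k * (b i $ j * d j k)))"
      by (intro sum.cong refl sum.swap)
    also have "\<dots> = (\<Sum>t\<in>F. \<Sum>i\<in>-{i0}. \<Sum>j\<in>UNIV. \<Sum>k<N * Suc n. \<alpha> t i * (\<rho> t i k * (b i $ j * d j k)))"
      by (intro sum.cong refl sum.swap)
    also have "\<dots> = (\<Sum>t\<in>F. \<Sum>i\<in>-{i0}. \<Sum>k<N * Suc n. \<Sum>j\<in>UNIV. \<alpha> t i * (\<rho> t i k * (b i $ j * d j k)))"
      by (intro sum.cong refl sum.swap)
    also have "\<dots> = (\<Sum>t\<in>F. \<Sum>i\<in>-{i0}. \<alpha> t i * F.discrete_response i N (Suc n) (\<lambda>s. B i s \<omega>) t)"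
      by (simp only: F.discrete_response_def Bd \<rho>_def sum_distrib_left)
    finally show ?thesis .
  qed
  obtain V where "V \<ge> 0" "v \<longlonglongrightarrow> V"
    "\<And>u. char (distr M borel Y) u = complex_of_real (exp (- (u\<^sup>2 * V / 2)))"
  proof (rule gaussian_limit[of X v Y])
    show "X n \<in> borel_measurable M" for n
      unfolding X_def by (intro borel_measurable_sum borel_measurable_times borel_measurable_diff w_meas) auto
    show "v n \<ge> 0" for n unfolding v_def by (intro sum_nonneg) auto
    show "char (distr M borel (X n)) u = complex_of_real (exp (- (u\<^sup>2 * v n / 2)))" for n u
      unfolding X_def v_def by (rule standard_BM_vec_char_increments[OF w]) simp
    show "AE \<omega> in M. (\<lambda>n. X n \<omega>) \<longlonglongrightarrow> Y \<omega>"
      using w_cont YF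
    proof eventually_elim
      case (elim \<omega>)
      have "(\<lambda>n. F.discrete_response i N n (\<lambda>s. B i s \<omega>) t) \<longlonglongrightarrow> F.forced_response i (\<lambda>s. B i s \<omega>) t"
        if "t \<in> F" for t i
        by (rule F.discrete_response_tendsto) (use elim F N that in \<open>auto simp: B_def intro!: continuous_intros\<close>)
      then have "(\<lambda>n. \<Sum>t\<in>F. \<Sum>i\<in>-{i0}. \<alpha> t i * F.discrete_response i N (Suc n) (\<lambda>s. B i s \<omega>) t)
        \<longlonglongrightarrow> (\<Sum>t\<in>F. \<Sum>i\<in>-{i0}. \<alpha> t i * F.forced_response i (\<lambda>s. B i s \<omega>) t)"
        by (intro tendsto_intros LIMSEQ_Suc)
      then show ?case unfolding Xeq elim(2) .
    qed
  qed (use Y in auto)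
  then show thesis using that by blast
qed

lemma gaussian:
  assumes x: "network_error M \<tau> K w \<phi> x"
  shows "gaussian_process M {-\<tau>..} x"
  unfolding gaussian_process_def
proof (intro allI impI)
  fix F and a :: "real \<Rightarrow> real ^ 'n" assume "finite F \<and> F \<subseteq> {-\<tau>..}"
  then have F: "finite F" "F \<subseteq> {-\<tau>..}" by auto
  \<comment> \<open>Times before \<open>0\<close> contribute only the deterministic history and go
    into the constant \<open>d\<close>.\<close>
  define F1 where "F1 = F \<inter> {0..}"
  define F2 where "F2 = F - {0..}"
  define Y where "Y = (\<lambda>\<omega>. \<Sum>t\<in>F. a t \<bullet> x t \<omega>)"
  define d where "d = (\<Sum>t\<in>F2. a t \<bullet> \<phi> t) + (\<Sum>t\<in>F1. \<Sum>i\<in>-{i0}. (a t \<bullet> b i) * F.free_response i (\<lambda>s. b i \<bullet> \<phi> s) t)"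
  have Ym: "Y \<in> borel_measurable M"
    unfolding Y_def using solution_meas[OF x] F by (intro borel_measurable_sum) auto
  have eq: "AE \<omega> in M. Y \<omega> - d = (\<Sum>t\<in>F1. \<Sum>i\<in>-{i0}. (a t \<bullet> b i) * F.forced_response i (\<lambda>s. B i s \<omega>) t)"
    using modes[OF x]
  proof eventually_elim
    case (elim \<omega>)
    have "Y \<omega> = (\<Sum>t\<in>F2 \<union> F1. a t \<bullet> x t \<omega>)"
      unfolding Y_def by (intro sum.cong) (auto simp: F1_def F2_def)
    also have "\<dots> = (\<Sum>t\<in>F2. a t \<bullet> x t \<omega>) + (\<Sum>t\<in>F1. a t \<bullet> x t \<omega>)"
      using F by (intro sum.union_disjoint) (auto simp: F1_def F2_def)
    also have "(\<Sum>t\<in>F2. a t \<bullet> x t \<omega>) = (\<Sum>t\<in>F2. a t \<bullet> \<phi> t)"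
      using elim F by (intro sum.cong) (auto simp: F2_def)
    also have "(\<Sum>t\<in>F1. a t \<bullet> x t \<omega>) = (\<Sum>t\<in>F1. \<Sum>i\<in>-{i0}. (a t \<bullet> b i) *
        (F.free_response i (\<lambda>s. b i \<bullet> \<phi> s) t + F.forced_response i (\<lambda>s. B i s \<omega>) t))"
    proof (intro sum.cong refl)
      fix t assume "t \<in> F1"
      then have t: "t \<ge> 0" by (simp add: F1_def)
      have "a t \<bullet> x t \<omega> = (\<Sum>i\<in>insert i0 (-{i0}). (a t \<bullet> b i) * (b i \<bullet> x t \<omega>))"
        unfolding inner_orthonormal[OF orth, of "a t" "x t \<omega>"] by (intro sum.cong) auto
      also have "\<dots> = (\<Sum>i\<in>-{i0}. (a t \<bullet> b i) * (b i \<bullet> x t \<omega>))"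
        using elim t by simp
      also have "\<dots> = (\<Sum>i\<in>-{i0}. (a t \<bullet> b i) *
        (F.free_response i (\<lambda>s. b i \<bullet> \<phi> s) t + F.forced_response i (\<lambda>s. B i s \<omega>) t))"
        using elim t by (intro sum.cong) auto
      finally show "a t \<bullet> x t \<omega> = (\<Sum>i\<in>-{i0}. (a t \<bullet> b i) *
        (F.free_response i (\<lambda>s. b i \<bullet> \<phi> s) t + F.forced_response i (\<lambda>s. B i s \<omega>) t))" .
    qed
    finally show ?case by (simp add: d_def distrib_left sum.distrib)
  qed
  have ym: "(\<lambda>\<omega>. Y \<omega> - d) \<in> borel_measurable M" using Ym by simp
  obtain V where V: "V \<ge> 0" "\<And>u. char (distr M borel (\<lambda>\<omega>. Y \<omega> - d)) u = complex_of_real (exp (- (u\<^sup>2 * V / 2)))"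
    by (rule forced_combination_char[OF _ _ ym eq]) (use F in \<open>auto simp: F1_def\<close>)
  show "gaussian_rv M (\<lambda>\<omega>. \<Sum>t\<in>F. a t \<bullet> x t \<omega>)"
    using gaussian_of_char(1)[OF ym V Ym, of d] by (simp add: Y_def)
qed

end

section \<open>Existence of solutions and the main theorem\<close>

text \<open>Iteration yields some solution with zero history; variation of constants then identifies
  it with the explicit formula, so that the formula itself solves the equation.\<close>

lemma (in fundamental_solution) forced_response_solves:
  assumes B: "continuous_on {0..} B" and B0: "B 0 = 0"
  obtains z where "continuous_on UNIV z" "\<And>t. t \<le> 0 \<Longrightarrow> z t = 0"
    "\<And>t. t \<ge> 0 \<Longrightarrow> z t = forced_response B t"
    "\<And>t. t \<ge> 0 \<Longrightarrow> z t = B t - l * integral {0..t} (\<lambda>s. z (s - \<tau>))"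
proof -
  have "continuous_on UNIV (\<lambda>t. B (max 0 t))"
    by (intro continuous_on_compose2[OF B] continuous_intros) auto
  then obtain z where z: "continuous_on UNIV z" "\<And>t. t \<le> 0 \<Longrightarrow> z t = B (max 0 t)"
    "\<And>t. t \<ge> 0 \<Longrightarrow> z t = B (max 0 t) - l * integral {0..t} (\<lambda>s. z (s - \<tau>))"
    by (rule delay_equation_exists[OF _ tau, where l=l and G="\<lambda>t. B (max 0 t)"]) blast
  have h: "z t = 0" if "t \<le> 0" for t using z(2)[OF that] that B0 by simp
  have e: "z t = B t - l * integral {0..t} (\<lambda>s. z (s - \<tau>))" if "t \<ge> 0" for t
    using z(3)[OF that] that by simp
  have "z t = forced_response B t" if t: "t \<ge> 0" for t
  proof -
    have "z t = free_response z t + forced_response B t"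
      unfolding free_response_def forced_response_def
      by (rule variation_of_constants[OF continuous_on_subset[OF z(1)] B _ t]) (use e h B0 in auto)
    also have "free_response z t = free_response (\<lambda>_. 0) t" by (rule free_response_cong) (simp add: h)
    finally show ?thesis by simp
  qed
  with z(1) h e that show thesis by blast
qed

context diagonalised_network
begin

lemma centering_expansion: "centering *v v = (\<Sum>i\<in>-{i0}. (b i \<bullet> v) *\<^sub>R b i)"
proof -
  have "centering *v v = (\<Sum>i\<in>insert i0 (-{i0}). (b i \<bullet> (centering *v v)) *\<^sub>R b i)"
    by (subst orthonormal_expansion[OF orth, of "centering *v v"]) (intro sum.cong, auto)
  also have "\<dots> = (\<Sum>i\<in>-{i0}. (b i \<bullet> (centering *v v)) *\<^sub>R b i)"
    by (simp add: inner_b0_centering)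
  also have "\<dots> = (\<Sum>i\<in>-{i0}. (b i \<bullet> v) *\<^sub>R b i)"
    by (intro sum.cong) (auto simp: inner_b_centering)
  finally show ?thesis .
qed

text \<open>The solution is set to \<open>0\<close> on a measurable null set \<open>Z\<close> outside which the driving paths are
  continuous; off \<open>Z\<close> it is a pointwise limit of discrete responses, hence measurable.\<close>

lemma solution_exists: "\<exists>x. network_error M \<tau> K w (\<lambda>_. 0) x"
proof -
  obtain Z where Z: "Z \<in> null_sets M" "{\<omega> \<in> space M. \<not> continuous_on {0..} (\<lambda>t. w t \<omega>)} \<subseteq> Z"
    using w_cont by (auto simp: eventually_ae_filter)
  have Zs: "Z \<in> sets M" using Z(1) by auto
  define f where "f = (\<lambda>i t \<omega>. if \<omega> \<in> Z then 0 else F.forced_response i (\<lambda>s. B i s \<omega>) t)"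
  define x where "x = (\<lambda>t \<omega>. if t \<le> 0 then 0 else \<Sum>i\<in>-{i0}. f i t \<omega> *\<^sub>R b i)"
  have good: "continuous_on {0..} (\<lambda>t. w t \<omega>)" if "\<omega> \<in> space M" "\<omega> \<notin> Z" for \<omega> using Z(2) that by blast
  have B0: "B i 0 \<omega> = 0" for i \<omega> by (simp add: B_def)
  have Bc: "continuous_on {0..} (\<lambda>t. B i t \<omega>)" if "\<omega> \<in> space M" "\<omega> \<notin> Z" for i \<omega>
    unfolding B_def by (intro continuous_intros good that)
  have fm: "f i t \<in> borel_measurable M" if t: "t \<ge> 0" for i t
  proof -
    obtain N :: nat where N: "t \<le> real N" using real_arch_simple by blast
    show ?thesis
    proof (rule borel_measurable_LIMSEQ_real[where
          u="\<lambda>n \<omega>. if \<omega> \<in> Z then 0 else F.discrete_response i N n (\<lambda>s. B i s \<omega>) t"])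
      fix \<omega> assume \<omega>: "\<omega> \<in> space M"
      show "(\<lambda>n. if \<omega> \<in> Z then 0 else F.discrete_response i N n (\<lambda>s. B i s \<omega>) t) \<longlonglongrightarrow> f i t \<omega>"
        unfolding f_def using F.discrete_response_tendsto[OF Bc[OF \<omega>] B0 t N] by auto
    next
      fix n
      have "(\<lambda>\<omega>. F.discrete_response i N n (\<lambda>s. B i s \<omega>) t) \<in> borel_measurable M"
        unfolding F.discrete_response_def
        by (intro borel_measurable_sum borel_measurable_times borel_measurable_diff borel_measurable_const B_meas) auto
      then show "(\<lambda>\<omega>. if \<omega> \<in> Z then 0 else F.discrete_response i N n (\<lambda>s. B i s \<omega>) t) \<in> borel_measurable M"
        by (intro measurable_If_set) (use Zs in auto)
    qed
  qed
  have xm: "x t \<in> borel_measurable M" for t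
    unfolding x_def by (cases "t \<le> 0") (auto intro!: borel_measurable_sum borel_measurable_scaleR fm)
  have path: "continuous_on {-\<tau>..} (\<lambda>t. x t \<omega>) \<and> (\<forall>t\<in>{-\<tau>..0}. x t \<omega> = 0) \<and>
      (\<forall>t\<ge>0. x t \<omega> = 0 - integral {0..t} (\<lambda>s. K *v x (s - \<tau>) \<omega>) + (centering *v w t \<omega> - centering *v w 0 \<omega>)) \<and>
      (\<forall>t\<ge>-\<tau>. 1 \<bullet> x t \<omega> = 0)"
    if \<omega>: "\<omega> \<in> space M" "\<omega> \<notin> Z" for \<omega>
  proof -
    have "\<exists>z. continuous_on UNIV z \<and> (\<forall>t\<le>0. z t = 0) \<and>
       (\<forall>t\<ge>0. z t = F.forced_response i (\<lambda>s. B i s \<omega>) t) \<and>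
       (\<forall>t\<ge>0. z t = B i t \<omega> - \<mu> i * integral {0..t} (\<lambda>s. z (s - \<tau>)))" for i
      by (rule F.forced_response_solves[OF Bc[OF \<omega>] B0, of i]) blast
    then obtain z where z: "\<And>i. continuous_on UNIV (z i)" "\<And>i t. t \<le> 0 \<Longrightarrow> z i t = 0"
       "\<And>i t. t \<ge> 0 \<Longrightarrow> z i t = F.forced_response i (\<lambda>s. B i s \<omega>) t"
       "\<And>i t. t \<ge> 0 \<Longrightarrow> z i t = B i t \<omega> - \<mu> i * integral {0..t} (\<lambda>s. z i (s - \<tau>))"
      by metis
    have xz: "x t \<omega> = (\<Sum>i\<in>-{i0}. z i t *\<^sub>R b i)" for t
      using \<omega> z(2,3) by (auto simp: x_def f_def)
    have zc: "continuous_on S (z i)" for S i using z(1) continuous_on_subset by blast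
    have "continuous_on {-\<tau>..} (\<lambda>t. x t \<omega>)"
      unfolding xz by (intro continuous_intros zc)
    moreover have "x t \<omega> = 0 - integral {0..t} (\<lambda>s. K *v x (s - \<tau>) \<omega>) + (centering *v w t \<omega> - centering *v w 0 \<omega>)"
      if t: "t \<ge> 0" for t
    proof -
      have Kx: "K *v x (s - \<tau>) \<omega> = (\<Sum>i\<in>-{i0}. (\<mu> i * z i (s - \<tau>)) *\<^sub>R b i)" for s
        unfolding xz linear_sum[OF matrix_vector_mul_linear]
        by (intro sum.cong) (auto simp: matrix_vector_mult_scaleR eig)
      have zi: "(\<lambda>s. z i (s - \<tau>)) integrable_on {0..t}" for i
        by (intro integrable_continuous_interval continuous_on_compose2[OF z(1)] continuous_intros) auto
      have "((\<lambda>s. K *v x (s - \<tau>) \<omega>) has_integral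
          (\<Sum>i\<in>-{i0}. (\<mu> i * integral {0..t} (\<lambda>s. z i (s - \<tau>))) *\<^sub>R b i)) {0..t}"
        unfolding Kx
        by (intro has_integral_sum has_integral_scaleR_left has_integral_mult_right integrable_integral zi) auto
      then have I: "integral {0..t} (\<lambda>s. K *v x (s - \<tau>) \<omega>)
          = (\<Sum>i\<in>-{i0}. (\<mu> i * integral {0..t} (\<lambda>s. z i (s - \<tau>))) *\<^sub>R b i)"
        by (rule integral_unique)
      have "centering *v w t \<omega> - centering *v w 0 \<omega> = (\<Sum>i\<in>-{i0}. B i t \<omega> *\<^sub>R b i)"
        unfolding centering_expansion B_def
        by (simp add: inner_diff_right scaleR_left_diff_distrib sum_subtractf)
      then show ?thesis
        unfolding I unfolding xz using z(4)[OF t]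
        by (simp add: scaleR_left_diff_distrib sum_subtractf)
    qed
    moreover have "1 \<bullet> x t \<omega> = 0" for t
      unfolding xz by (simp add: inner_sum_right inner_commute[of 1] inner_b_one)
    moreover have "x t \<omega> = 0" if "t \<le> 0" for t using that by (simp add: x_def)
    ultimately show ?thesis by auto
  qed
  have "AE \<omega> in M. \<omega> \<notin> Z" using Z(1) by (rule AE_not_in)
  then have ae: "AE \<omega> in M. continuous_on {-\<tau>..} (\<lambda>t. x t \<omega>) \<and> (\<forall>t\<in>{-\<tau>..0}. x t \<omega> = 0) \<and>
      (\<forall>t\<ge>0. x t \<omega> = 0 - integral {0..t} (\<lambda>s. K *v x (s - \<tau>) \<omega>) + (centering *v w t \<omega> - centering *v w 0 \<omega>)) \<and>
      (\<forall>t\<ge>-\<tau>. 1 \<bullet> x t \<omega> = 0)"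
    using AE_space by eventually_elim (rule path)
  have "network_error M \<tau> K w (\<lambda>_. 0) x"
    unfolding network_error_def sdde_solution_def
    using xm ae by (auto elim!: eventually_mono)
  then show ?thesis by blast
qed

text \<open>With zero history the second moment is a sum of nonnegative, nondecreasing square
  integrals, so its finite limit bounds each of them. A solution has to exist, since stability
  quantifies over solutions and would otherwise hold vacuously.\<close>

lemma stable_imp_eigenvalues:
  assumes stable: "mean_square_stable M \<tau> K w" and i: "i \<noteq> i0"
  shows "\<mu> i \<in> {0<..<pi / (2 * \<tau>)}"
proof -
  obtain x where x: "network_error M \<tau> K w (\<lambda>_. 0) x" using solution_exists by blast
  have "admissible_history \<tau> (\<lambda>_. 0 :: real ^ 'n)" by (simp add: admissible_history_def)
  then obtain L where "has_steady_state_variance M x L"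
    using stable x unfolding mean_square_stable_def by blast
  then have lim: "((\<lambda>t. \<integral>\<omega>. (norm (x t \<omega>))\<^sup>2 \<partial>M) \<longlongrightarrow> L) at_top"
    by (simp add: has_steady_state_variance_def)
  have eq: "(\<integral>\<omega>. (norm (x t \<omega>))\<^sup>2 \<partial>M) = (\<Sum>i\<in>-{i0}. integral {0..t} (\<lambda>s. (R i s)\<^sup>2))" if "t \<ge> 0" for t
    using second_moment(2)[OF x that] by simp
  show ?thesis
  proof (rule F.square_integrable_imp_stable)
    fix T :: real assume T: "T \<ge> 0"
    show "integral {0..T} (\<lambda>s. (R i s)\<^sup>2) \<le> L"
    proof (rule tendsto_lowerbound[OF lim])
      show "\<forall>\<^sub>F t in at_top. integral {0..T} (\<lambda>s. (R i s)\<^sup>2) \<le> (\<integral>\<omega>. (norm (x t \<omega>))\<^sup>2 \<partial>M)"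
        using eventually_ge_at_top[of T]
      proof eventually_elim
        case (elim t)
        have "integral {0..T} (\<lambda>s. (R i s)\<^sup>2) \<le> integral {0..t} (\<lambda>s. (R i s)\<^sup>2)"
          by (rule F.square_integral_mono[OF elim])
        also have "\<dots> \<le> (\<Sum>i\<in>-{i0}. integral {0..t} (\<lambda>s. (R i s)\<^sup>2))"
          using i by (intro member_le_sum F.square_integral_nonneg) auto
        finally show ?case using eq T elim by simp
      qed
    qed simp
  qed
qed

end

theorem proposition1:
  fixes M :: "'a measure" and M' :: "'b measure"
    and K :: "real ^ 'n ^ 'n" and eig :: "nat \<Rightarrow> real" and \<tau> :: real
    and w :: "real \<Rightarrow> 'a \<Rightarrow> real ^ 'n"
  assumes N: "CARD('n) \<ge> 2"
    and tau: "\<tau> > 0"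
    and sym: "transpose K = K"
    and K_one: "K *v 1 = 0"
    and eig: "eigenvalue_list K eig" and eig1: "eig 1 = 0"
    and w: "standard_BM_vec M w"
  shows "(mean_square_stable M \<tau> K w \<longleftrightarrow>
            (\<forall>j\<in>{2..CARD('n)}. eig j \<in> {0<..<pi / (2 * \<tau>)})) \<and>
         (mean_square_stable M \<tau> K w \<longrightarrow>
            (\<forall>\<phi> x. admissible_history \<tau> \<phi> \<and> network_error M \<tau> K w \<phi> x \<longrightarrow>
               gaussian_process M {-\<tau>..} x \<and>
               has_steady_state_variance M x (\<Sum>j=2..CARD('n). sigma_I_sq \<tau> (eig j))) \<and>
            (\<forall>j\<in>{2..CARD('n)}. \<forall>w' y.
               standard_BM M' w' \<and>
               sdde_solution M' \<tau> (\<lambda>v. eig j * v) w' (\<lambda>_. 0) y \<longrightarrow>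
               has_steady_state_variance M' y (sigma_I_sq \<tau> (eig j))))"
proof -
  obtain b :: "'n \<Rightarrow> real ^ 'n" and \<mu> i0 c where b: "\<And>i j. b i \<bullet> b j = (if i = j then 1 else 0)"
    "\<And>i. K *v b i = \<mu> i *\<^sub>R b i" "b i0 = c *\<^sub>R 1" "c \<noteq> 0"
    and range: "eig ` {2..CARD('n)} = \<mu> ` (- {i0})"
    and sums: "\<And>f :: real \<Rightarrow> real. (\<Sum>j=2..CARD('n). f (eig j)) = (\<Sum>i\<in>-{i0}. f (\<mu> i))"
    by (rule eigenvalue_list_eigenbasis[OF sym K_one eig eig1]) (rule that; assumption?)
  have "\<forall>i. \<exists>r. fundamental_solution \<tau> (\<mu> i) r"
    using fundamental_solution_exists[OF tau] by blast
  from choice[OF this] obtain R where R: "\<And>i. fundamental_solution \<tau> (\<mu> i) (R i)" by blast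
  interpret diagonalised_network M \<tau> K w b \<mu> i0 c R
    by (rule diagonalised_network.intro) (rule sym w b R)+
  \<comment> \<open>The list and the basis share no indexing, so the condition is transported
    through the common set of values.\<close>
  have cond: "(\<forall>j\<in>{2..CARD('n)}. eig j \<in> A) \<longleftrightarrow> (\<forall>i. i \<noteq> i0 \<longrightarrow> \<mu> i \<in> A)" for A
  proof -
    have "(\<forall>j\<in>{2..CARD('n)}. eig j \<in> A) \<longleftrightarrow> (\<forall>l\<in>eig ` {2..CARD('n)}. l \<in> A)" by blast
    also have "\<dots> \<longleftrightarrow> (\<forall>i. i \<noteq> i0 \<longrightarrow> \<mu> i \<in> A)" unfolding range by blast
    finally show ?thesis .
  qed
  have steady: "has_steady_state_variance M x (\<Sum>j=2..CARD('n). sigma_I_sq \<tau> (eig j))"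
    if "\<forall>j\<in>{2..CARD('n)}. eig j \<in> {0<..<pi / (2 * \<tau>)}" "admissible_history \<tau> \<phi>" "network_error M \<tau> K w \<phi> x" for \<phi> x
    unfolding sums using that unfolding cond by (intro steady_state) blast+
  have iff: "mean_square_stable M \<tau> K w \<longleftrightarrow> (\<forall>j\<in>{2..CARD('n)}. eig j \<in> {0<..<pi / (2 * \<tau>)})"
    using stable_imp_eigenvalues steady unfolding cond mean_square_stable_def by blast
  have scalar: "has_steady_state_variance M' y (sigma_I_sq \<tau> (eig j))"
    if "eig j \<in> {0<..<pi / (2 * \<tau>)}" "standard_BM M' w'" "sdde_solution M' \<tau> (\<lambda>v. eig j * v) w' (\<lambda>_. 0) y" for j w' y
  proof -
    obtain r where "fundamental_solution \<tau> (eig j) r" using fundamental_solution_exists[OF tau] by blast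
    then show ?thesis using that by (intro fundamental_solution.scalar_steady_state)
  qed
  show ?thesis using iff steady scalar gaussian by blast
qed

end
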